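(* It is algorithmically decidable, given a finite set of permutations $\beta_1,\dots,\beta_n$, whether the set $\operatorname{Av}(\beta_1,\dots,\beta_n)$ of all permutations which avoid each of $\beta_1,\dots,\beta_n$ as a consecutive subpermutation is: (i) atomic; (ii) well quasi-ordered. That is, each of the properties (i) and (ii) is decidable.
   Context: A permutation of length $n$ is a sequence of elements of $\{1,\dots,n\}$ in which every element appears exactly once; $S$ is the set of all finite permutations. For a finite sequence $\tau$ of distinct real numbers, $\operatorname{perm}(\tau)$ is the unique permutation of the same length whose entries are in the same relative order as those of $\tau$. A permutation $\sigma$ of length $m$ is a consecutive (contiguous) subpermutation of a permutation $\tau=t_1\dots t_n$, written $\sigma\leq_f\tau$, if $\sigma=\operatorname{perm}(t_i,t_{i+1},\dots,t_{i+m-1})$ for some $i\in\{1,\dots,n-m+1\}$; this is a partial order on $S$. $\operatorname{Av}(\beta_1,\dots,\beta_n)=\{\sigma\in S:\beta_i\nleq_f\sigma\text{ for all }i\}$; it is ordered by $\leq_f$. A subset $C$ of a poset is downward closed if $x\in C$, $y\le x$ imply $y\in C$. A downward closed set is atomic if it is not the union of two proper downward closed subsets (equivalently, it has the joint embedding property: for all $x,y\in C$ there is $z\in C$ with $x\le z$, $y\le z$). A poset is well quasi-ordered if it contains no infinite strictly decreasing sequences and no infinite antichains. *)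

theory Defs
  imports
    "HOL-Combinatorics.Multiset_Permutations"
    "HOL-Library.Nat_Bijection"
begin

section \<open>Permutations and the consecutive subpermutation order\<close>

text \<open>
  Permutations are written in one-line notation.
  The empty permutation (\<open>n = 0\<close>) is included.
\<close>

definition perms :: "nat list set" where
  "perms = (\<Union>n. permutations_of_set {1..n})"

lemma perms_iff: "p \<in> perms \<longleftrightarrow> distinct p \<and> set p = {1..length p}"
proof
  assume "p \<in> perms"
  then obtain n where "set p = {1..n}" "distinct p"
    by (auto simp: perms_def permutations_of_set_def)
  then show "distinct p \<and> set p = {1..length p}"
    using distinct_card[of p] by simp
qed (auto simp: perms_def permutations_of_set_def)

definition perm :: "'a::linorder list \<Rightarrow> nat list" where
  "perm xs = (THE p. p \<in> perms \<and> length p = length xs \<and>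
     (\<forall>i<length xs. \<forall>j<length xs. p ! i < p ! j \<longleftrightarrow> xs ! i < xs ! j))"

text \<open>The description in the previous definition is proper for sequences of distinct elements.\<close>

lemma perm_entry:
  assumes "p \<in> perms" "i < length p"
  shows "p ! i = Suc (card {j. j < length p \<and> p ! j < p ! i})"
proof -
  have p: "distinct p" "set p = {1..length p}"
    using assms perms_iff by auto
  have "p ! i \<in> {1..length p}" using p(2) assms(2) nth_mem by blast
  then have "(!) p ` {j. j < length p \<and> p ! j < p ! i} = {1..<p ! i}"
  proof (intro equalityI subsetI)
    fix v assume "v \<in> (!) p ` {j. j < length p \<and> p ! j < p ! i}"
    then obtain j where "j < length p" "v = p ! j" "p ! j < p ! i" by auto
    moreover from this have "v \<in> {1..length p}" using p(2) nth_mem by blast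
    ultimately show "v \<in> {1..<p ! i}" by simp
  next
    fix v assume v: "v \<in> {1..<p ! i}"
    with \<open>p ! i \<in> {1..length p}\<close> have "v \<in> set p" unfolding p(2) by simp
    then obtain j where "j < length p" "p ! j = v" by (auto simp: in_set_conv_nth)
    with v show "v \<in> (!) p ` {j. j < length p \<and> p ! j < p ! i}" by auto
  qed
  moreover have "inj_on ((!) p) {j. j < length p \<and> p ! j < p ! i}"
    using p(1) by (auto simp: inj_on_def nth_eq_iff_index_eq)
  ultimately have "card {j. j < length p \<and> p ! j < p ! i} = p ! i - 1"
    by (metis card_image card_atLeastLessThan)
  with \<open>p ! i \<in> {1..length p}\<close> show ?thesis by simp
qed

lemma perm_ex1:
  fixes xs :: "'a::linorder list"
  assumes "distinct xs"
  shows "\<exists>!p. p \<in> perms \<and> length p = length xs \<and>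
     (\<forall>i<length xs. \<forall>j<length xs. p ! i < p ! j \<longleftrightarrow> xs ! i < xs ! j)"
proof (rule ex_ex1I)
  define r where "r x = card {y \<in> set xs. y \<le> x}" for x
  have r_less: "r x < r y \<longleftrightarrow> x < y" if "x \<in> set xs" "y \<in> set xs" for x y
  proof -
    have "r u < r v" if "u < v" "v \<in> set xs" for u v
    proof -
      have "v \<in> {y \<in> set xs. y \<le> v} - {y \<in> set xs. y \<le> u}" using that by simp
      moreover have "{y \<in> set xs. y \<le> u} \<subseteq> {y \<in> set xs. y \<le> v}" using that(1) by auto
      ultimately have "{y \<in> set xs. y \<le> u} \<subset> {y \<in> set xs. y \<le> v}" by blast
      then show ?thesis unfolding r_def by (intro psubset_card_mono) simp_all
    qed
    then show ?thesis using that by (metis linorder_less_linear order_less_asym)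
  qed
  have "inj_on r (set xs)"
    by (metis inj_onI linorder_less_linear order_less_irrefl r_less)
  moreover have "r ` set xs = {1..length xs}"
  proof (rule card_subset_eq)
    have "r x \<noteq> 0" if "x \<in> set xs" for x
      using that by (auto simp: r_def)
    moreover have "r x \<le> length xs" for x
      unfolding r_def using card_mono[of "set xs" "{y \<in> set xs. y \<le> x}"] card_length[of xs] by auto
    ultimately show "r ` set xs \<subseteq> {1..length xs}" by (auto simp: Suc_le_eq)
    show "card (r ` set xs) = card {1..length xs}"
      using \<open>inj_on r (set xs)\<close> assms by (simp add: card_image distinct_card)
  qed simp
  ultimately have "map r xs \<in> perms" using assms by (simp add: perms_iff distinct_map)
  then show "\<exists>p. p \<in> perms \<and> length p = length xs \<and>
     (\<forall>i<length xs. \<forall>j<length xs. p ! i < p ! j \<longleftrightarrow> xs ! i < xs ! j)"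
    by (intro exI[of _ "map r xs"]) (simp add: r_less)
next
  fix p q
  assume p: "p \<in> perms \<and> length p = length xs \<and>
     (\<forall>i<length xs. \<forall>j<length xs. p ! i < p ! j \<longleftrightarrow> xs ! i < xs ! j)"
  assume q: "q \<in> perms \<and> length q = length xs \<and>
     (\<forall>i<length xs. \<forall>j<length xs. q ! i < q ! j \<longleftrightarrow> xs ! i < xs ! j)"
  show "p = q"
  proof (rule nth_equalityI)
    fix i assume i: "i < length p"
    have "{j. j < length p \<and> p ! j < p ! i} = {j. j < length q \<and> q ! j < q ! i}"
      using p q i by auto
    then show "p ! i = q ! i"
      using perm_entry[of p i] perm_entry[of q i] p q i by simp
  qed (use p q in simp)
qed

definition consec_le :: "nat list \<Rightarrow> nat list \<Rightarrow> bool" (infix \<open>\<le>\<^sub>f\<close> 50) where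
  "\<sigma> \<le>\<^sub>f \<tau> \<longleftrightarrow>
     (\<exists>i. i + length \<sigma> \<le> length \<tau> \<and> \<sigma> = perm (take (length \<sigma>) (drop i \<tau>)))"

definition Av :: "nat list set \<Rightarrow> nat list set" where
  "Av B = {\<sigma> \<in> perms. \<forall>\<beta>\<in>B. \<not> \<beta> \<le>\<^sub>f \<sigma>}"

section \<open>Order-theoretic properties\<close>

text \<open>Here \<open>P\<close> is the carrier of a poset with order relation \<open>le\<close>.\<close>

definition downward_closed :: "'a set \<Rightarrow> ('a \<Rightarrow> 'a \<Rightarrow> bool) \<Rightarrow> 'a set \<Rightarrow> bool" where
  "downward_closed P le C \<longleftrightarrow> C \<subseteq> P \<and> (\<forall>x\<in>C. \<forall>y\<in>P. le y x \<longrightarrow> y \<in> C)"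

definition atomic :: "'a set \<Rightarrow> ('a \<Rightarrow> 'a \<Rightarrow> bool) \<Rightarrow> 'a set \<Rightarrow> bool" where
  "atomic P le C \<longleftrightarrow> downward_closed P le C \<and>
     \<not> (\<exists>D E. downward_closed P le D \<and> downward_closed P le E \<and>
              D \<subset> C \<and> E \<subset> C \<and> C = D \<union> E)"

definition wqo_on :: "('a \<Rightarrow> 'a \<Rightarrow> bool) \<Rightarrow> 'a set \<Rightarrow> bool" where
  "wqo_on le C \<longleftrightarrow>
     \<not> (\<exists>s :: nat \<Rightarrow> 'a. \<forall>i. s i \<in> C \<and> le (s (Suc i)) (s i) \<and> s (Suc i) \<noteq> s i) \<and>
     \<not> (\<exists>A \<subseteq> C. infinite A \<and> (\<forall>x\<in>A. \<forall>y\<in>A. x \<noteq> y \<longrightarrow> \<not> le x y))"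

section \<open>Algorithmic decidability\<close>

text \<open>
  Algorithms are partial recursive functions in Kleene's sense, given by syntactic terms together
  with an evaluation relation: \<open>computes f xs y\<close> says that the computation of \<open>f\<close> on the
  arguments \<open>xs\<close> halts with result \<open>y\<close>. Arities are not tracked:
  \<open>Zero\<close> and \<open>Proj\<close> apply to argument lists of any sufficient length.
  In \<open>PrimRec f g\<close> the recursion argument comes first,
  and \<open>g\<close> receives the predecessor, the previous value and the parameters, in this order.
\<close>

datatype recf =
    Zero
  | Succ
  | Proj nat
  | Comp recf "recf list"
  | PrimRec recf recf
  | Mu recf

inductive computes :: "recf \<Rightarrow> nat list \<Rightarrow> nat \<Rightarrow> bool" where
  zero: "computes Zero xs 0"
| succ: "computes Succ [x] (Suc x)"
| proj: "i < length xs \<Longrightarrow> computes (Proj i) xs (xs ! i)"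
| comp: "list_all2 (\<lambda>g y. computes g xs y) gs ys \<Longrightarrow> computes f ys z \<Longrightarrow>
    computes (Comp f gs) xs z"
| primrec_0: "computes f xs y \<Longrightarrow> computes (PrimRec f g) (0 # xs) y"
| primrec_Suc: "computes (PrimRec f g) (n # xs) y \<Longrightarrow> computes g (n # y # xs) z \<Longrightarrow>
    computes (PrimRec f g) (Suc n # xs) z"
| mu: "computes f (n # xs) 0 \<Longrightarrow> (\<And>m. m < n \<Longrightarrow> \<exists>y>0. computes f (m # xs) y) \<Longrightarrow>
    computes (Mu f) xs n"

lemma computes_functional: "computes f xs y \<Longrightarrow> computes f xs y' \<Longrightarrow> y = y'"
proof (induction arbitrary: y' rule: computes.induct)
  case (comp xs gs ys f z)
  from comp.prems obtain ys' where ys': "list_all2 (\<lambda>g y. computes g xs y) gs ys'" "computes f ys' y'"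
    by (cases rule: computes.cases) auto
  have "ys = ys'"
    using comp.IH(1) ys'(1) by (auto simp: list_all2_conv_all_nth intro!: nth_equalityI)
  with comp.IH(2) ys'(2) show ?case by simp
next
  case (primrec_Suc f g n xs y z)
  from primrec_Suc.prems obtain u where
    "computes (PrimRec f g) (n # xs) u" "computes g (n # u # xs) y'"
    by (cases rule: computes.cases) auto
  with primrec_Suc.IH show ?case by blast
next
  case (mu f n xs)
  from mu.prems have y': "computes f (y' # xs) 0" "\<And>m. m < y' \<Longrightarrow> \<exists>y>0. computes f (m # xs) y"
    by (cases rule: computes.cases; simp)+
  have "\<not> n < y'" using mu.IH(1) y'(2) by (metis less_irrefl)
  moreover have "\<not> y' < n" using mu.IH(2) y'(1) by (metis less_irrefl)
  ultimately show ?case by simp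
next
  case (primrec_0 f xs y g)
  from primrec_0.prems have "computes f xs y'"
    by (cases rule: computes.cases) auto
  with primrec_0.IH show ?case by blast
qed (erule computes.cases; simp; fail)+

text \<open>
  \<open>decidable_on code D Q\<close>: there is a single algorithm that, given the code of any instance
  in \<open>D\<close>, halts and outputs 1 or 0 according to whether the instance has property \<open>Q\<close>.
\<close>

definition decidable_on :: "('a \<Rightarrow> nat) \<Rightarrow> 'a set \<Rightarrow> ('a \<Rightarrow> bool) \<Rightarrow> bool" where
  "decidable_on code D Q \<longleftrightarrow>
     (\<exists>f. \<forall>x\<in>D. computes f [code x] (if Q x then 1 else 0))"

text \<open>
  The code of a finite set of permutations is the binary number whose set bits are the positions
  \<open>list_encode \<beta>\<close>, for \<open>\<beta>\<close> in the set.
\<close>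

definition perm_set_code :: "nat list set \<Rightarrow> nat" where
  "perm_set_code B = set_encode (list_encode ` B)"

lemma inj_on_perm_set_code: "inj_on perm_set_code {B. finite B}"
proof (rule inj_onI)
  fix A B :: "nat list set"
  assume "A \<in> {B. finite B}" "B \<in> {B. finite B}" "perm_set_code A = perm_set_code B"
  then have "list_encode ` A = list_encode ` B"
    unfolding perm_set_code_def by (metis finite_imageI mem_Collect_eq set_encode_inverse)
  then show "A = B" by (simp add: inj_image_eq_iff inj_list_encode)
qed

end

theory Submission
  imports Defs Complex_Main
begin

text \<open>
  Let \<open>C\<close> be the set of permutations that avoid the finite set \<open>B\<close>, and let \<open>b\<close> be at least as
  large as the lengths of the elements of \<open>B\<close>. A permutation of length at least \<open>b\<close> belongs to
  \<open>C\<close> iff all its factors of length \<open>b\<close>, its windows, do. It is therefore a path in a finite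
  graph on the windows, together with a choice of a permutation that has the given windows.
  There is at least one such permutation for each path, since linear orders can be amalgamated,
  but in general there are several. A comparison between two positions is called ambiguous if
  the windows do not determine it. For each of the two properties, the proof shows that it can
  be recognized on those elements of \<open>C\<close> whose length is below a computable bound.

  Atomicity is equivalent to the joint embedding property. Suppose that this holds for short
  elements. If all windows can reach each other in the graph, arbitrary elements can be joined
  by a path. If not, some set \<open>U\<close> of windows can be entered but never left. Each path enters it
  at most once, and by joint embedding an element is determined by its length and the place of
  this crossing; this extends from short elements to all elements, as loops can be cut out and
  every ambiguous comparison gives an ambiguous factor of length at most \<open>2 * b\<close>
  (\<open>ambiguous_short_factor\<close>, \<open>determined_all\<close>). Then elements can be glued together at their
  crossings (\<open>joint_embedding_if_upto\<close>). Conversely, a common extension of short elements can be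
  made short by cutting out loops (\<open>joint_bounded\<close>).

  There are two obstructions to being well quasi-ordered. The first is a path that enters a
  cycle and leaves it again (\<open>two_breaks_bad\<close>). Going around the cycle more and more often
  yields an infinite antichain. The second is an ambiguous comparison one end of which lies deep
  inside a periodic run of the path (\<open>deep_agree\<close>). If the comparison is within a periodic path,
  realizations with two marked places at increasing distance are an antichain
  (\<open>ambiguous_periodic_path\<close>). If it connects an entry before the run with an entry of the run,
  then it remains ambiguous when the latter entry is moved along the run by any number of
  periods, and the first entry can be placed at different heights (\<open>ambiguous_tail\<close>). Without
  these obstructions, an element consists of a core of bounded length and of periodic parts on
  both sides that are determined by their lengths, and Dickson's lemma shows that there is no
  infinite antichain (\<open>good_if_no_deep_ambiguous\<close>). If one of the obstructions occurs at all, it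
  occurs in a short element (\<open>one_sided_bounded\<close>, \<open>deep_ambiguous_bounded\<close>).

  The resulting criteria \<open>atomic_iff_bounded\<close> and \<open>wqo_iff_bounded\<close> only contain bounded
  quantifiers. Written in terms of codes of lists, they are recursive predicates of the code of
  \<open>B\<close>.
\<close>

section \<open>Order patterns of sequences of reals\<close>

text \<open>
  The factor of length \<open>n\<close> of \<open>f\<close> at \<open>i\<close> is order isomorphic to that of \<open>g\<close> at \<open>j\<close>. A
  permutation of length \<open>n\<close> is represented by any injective sequence of reals on \<open>{..<n}\<close> in the
  same relative order. Values are real rather than natural numbers so that there is always room
  for a new entry between two given ones.
\<close>

definition same_order :: "nat \<Rightarrow> (nat \<Rightarrow> real) \<Rightarrow> nat \<Rightarrow> (nat \<Rightarrow> real) \<Rightarrow> nat \<Rightarrow> bool" where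
  "same_order n f i g j \<longleftrightarrow> (\<forall>p<n. \<forall>q<n. f (i + p) < f (i + q) \<longleftrightarrow> g (j + p) < g (j + q))"

definition embeds :: "nat \<Rightarrow> (nat \<Rightarrow> real) \<Rightarrow> nat \<Rightarrow> (nat \<Rightarrow> real) \<Rightarrow> bool" where
  "embeds n f m g \<longleftrightarrow> (\<exists>s. s + n \<le> m \<and> same_order n f 0 g s)"

text \<open>
  The pattern of a factor of length \<open>b\<close>, recorded as a set of index pairs instead of a
  standardized list: two factors are order isomorphic iff these sets are equal, and the sets all
  lie in the finite power set of \<open>{..<b} \<times> {..<b}\<close>.
\<close>

definition window :: "nat \<Rightarrow> (nat \<Rightarrow> real) \<Rightarrow> nat \<Rightarrow> (nat \<times> nat) set" where
  "window b f i = {(p, q). p < b \<and> q < b \<and> f (i + p) < f (i + q)}"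

lemma same_order_refl [simp]: "same_order n f i f i"
  by (simp add: same_order_def)

lemma same_order_sym: "same_order n f i g j \<Longrightarrow> same_order n g j f i"
  by (simp add: same_order_def)

lemma same_order_trans: "same_order n f i g j \<Longrightarrow> same_order n g j h k \<Longrightarrow> same_order n f i h k"
  by (simp add: same_order_def)

lemma same_order_factor: "same_order n f i g j \<Longrightarrow> a + m \<le> n \<Longrightarrow> same_order m f (i + a) g (j + a)"
  unfolding same_order_def by (simp add: add.assoc)

lemma same_order_mono: "same_order n f i g j \<Longrightarrow> m \<le> n \<Longrightarrow> same_order m f i g j"
  using same_order_factor[of n f i g j 0 m] by simp

lemma same_order_eqI: "(\<And>p. p < n \<Longrightarrow> f (i + p) = g (j + p)) \<Longrightarrow> same_order n f i g j"
  by (simp add: same_order_def)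

lemma same_order_shift_left [simp]: "same_order n (\<lambda>p. f (s + p)) i g j = same_order n f (s + i) g j"
  by (simp add: same_order_def add.assoc)

lemma same_order_shift_right [simp]: "same_order n f i (\<lambda>p. g (s + p)) j = same_order n f i g (s + j)"
  by (simp add: same_order_def add.assoc)

lemma same_order_Suc_left [simp]: "same_order n (\<lambda>p. f (Suc p)) i g j = same_order n f (Suc i) g j"
  by (simp add: same_order_def)

lemma same_order_Suc_right [simp]: "same_order n f i (\<lambda>p. g (Suc p)) j = same_order n f i g (Suc j)"
  by (simp add: same_order_def)

lemma same_orderD: "same_order n f i g j \<Longrightarrow> p < n \<Longrightarrow> q < n \<Longrightarrow> f (i + p) < f (i + q) \<longleftrightarrow> g (j + p) < g (j + q)"
  by (simp add: same_order_def)

lemma same_order_inj_on: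
  assumes "same_order n f 0 g s" "inj_on f {..<n}"
  shows "inj_on (\<lambda>p. g (s + p)) {..<n}"
proof (rule inj_onI)
  fix p q assume pq: "p \<in> {..<n}" "q \<in> {..<n}" "g (s + p) = g (s + q)"
  then have "\<not> f p < f q" "\<not> f q < f p"
    using assms(1) by (auto simp: same_order_def)
  then show "p = q" using assms(2) pq by (auto simp: inj_on_def)
qed

lemma inj_on_shift:
  fixes f :: "nat \<Rightarrow> 'a"
  shows "inj_on f {..<n} \<Longrightarrow> s + m \<le> n \<Longrightarrow> inj_on (\<lambda>p. f (s + p)) {..<m}"
proof (rule inj_onI)
  assume *: "inj_on f {..<n}" "s + m \<le> n"
  fix x y assume "x \<in> {..<m}" "y \<in> {..<m}" and eq: "f (s + x) = f (s + y)"
  then have "s + x \<in> {..<n}" "s + y \<in> {..<n}" using *(2) by auto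
  then show "x = y" using inj_onD[OF *(1) eq] by simp
qed

lemma embeds_refl: "embeds n f n f"
  unfolding embeds_def by (rule exI[of _ 0]) simp

lemma embeds_trans:
  assumes "embeds n f m g" "embeds m g l h" shows "embeds n f l h"
proof -
  obtain s where s: "s + n \<le> m" "same_order n f 0 g s" using assms(1) embeds_def by blast
  obtain t where t: "t + m \<le> l" "same_order m g 0 h t" using assms(2) embeds_def by blast
  have "same_order n g s h (t + s)" using same_order_factor[OF t(2), of s n] s(1) by simp
  with s t show ?thesis unfolding embeds_def
    by (intro exI[of _ "t + s"]) (auto intro: same_order_trans)
qed

lemma window_eq_iff: "window b f i = window b g j \<longleftrightarrow> same_order b f i g j"
proof
  assume "window b f i = window b g j"
  then have "\<And>p q. (p, q) \<in> window b f i \<longleftrightarrow> (p, q) \<in> window b g j" by simp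
  then show "same_order b f i g j" by (auto simp: window_def same_order_def)
qed (auto simp: window_def same_order_def)

lemma window_shift [simp]: "window b (\<lambda>p. f (s + p)) i = window b f (s + i)"
  by (simp add: window_def add.assoc)

lemma window_Suc [simp]: "window b (\<lambda>p. f (Suc p)) i = window b f (Suc i)"
  by (simp add: window_def)

lemma same_order_window: "same_order n f i g j \<Longrightarrow> t + b \<le> n \<Longrightarrow> window b f (i + t) = window b g (j + t)"
  by (simp add: window_eq_iff same_order_factor)

lemma window_cong: "(\<And>p. p < b \<Longrightarrow> f (i + p) = g (j + p)) \<Longrightarrow> window b f i = window b g j"
  by (auto simp: window_def)

definition same_windows :: "nat \<Rightarrow> nat \<Rightarrow> (nat \<Rightarrow> real) \<Rightarrow> (nat \<Rightarrow> real) \<Rightarrow> bool" where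
  "same_windows b n f g \<longleftrightarrow> (\<forall>t. t + b \<le> n \<longrightarrow> window b f t = window b g t)"

text \<open>
  Positions are near if some factor of length \<open>b\<close> covers both; the windows then determine how
  the entries compare.
\<close>

definition near :: "nat \<Rightarrow> nat \<Rightarrow> nat \<Rightarrow> bool" where
  "near b p q \<longleftrightarrow> p < q + b \<and> q < p + b"

lemma same_windows_near:
  assumes "b \<le> n" "same_windows b n f g" "p < n" "q < n" "near b p q"
  shows "f p < f q \<longleftrightarrow> g p < g q"
proof -
  define t where "t = min (min p q) (n - b)"
  have t: "t + b \<le> n" "t \<le> p" "t \<le> q" "p - t < b" "q - t < b"
    using assms by (auto simp: t_def near_def)
  then have "same_order b f t g t" using assms(2) by (simp add: same_windows_def window_eq_iff)
  from same_orderD[OF this t(4,5)] t show ?thesis by simp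
qed

lemma same_windowsI_near:
  assumes "\<And>p q. p < n \<Longrightarrow> q < n \<Longrightarrow> near b p q \<Longrightarrow> f p < f q \<longleftrightarrow> g p < g q"
  shows "same_windows b n f g"
  unfolding same_windows_def window_eq_iff same_order_def
proof (intro allI impI)
  fix t p q assume "t + b \<le> n" "p < b" "q < b"
  then show "f (t + p) < f (t + q) \<longleftrightarrow> g (t + p) < g (t + q)"
    by (intro assms) (simp_all add: near_def)
qed

lemma same_windows_refl [simp]: "same_windows b n f f" by (simp add: same_windows_def)
lemma same_windows_sym: "same_windows b n f g \<Longrightarrow> same_windows b n g f" by (simp add: same_windows_def)
lemma same_windows_trans: "same_windows b n f g \<Longrightarrow> same_windows b n g h \<Longrightarrow> same_windows b n f h" by (simp add: same_windows_def)
lemma same_windows_mono: "same_windows b n f g \<Longrightarrow> m \<le> n \<Longrightarrow> same_windows b m f g" by (simp add: same_windows_def)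
lemma same_windows_shift: "same_windows b n f g \<Longrightarrow> s + m \<le> n \<Longrightarrow> same_windows b m (\<lambda>p. f (s + p)) (\<lambda>p. g (s + p))"
  by (simp add: same_windows_def)

lemma same_order_same_windows: "same_order n f 0 g 0 \<Longrightarrow> same_windows b n f g"
  unfolding same_windows_def using same_order_window[of n f 0 g 0] by simp

section \<open>Amalgamation\<close>

lemma between_finite_sets:
  fixes A U :: "real set"
  assumes "finite A" "finite U" "\<And>a u. a \<in> A \<Longrightarrow> u \<in> U \<Longrightarrow> a < u"
  shows "\<exists>v. (\<forall>a\<in>A. a < v) \<and> (\<forall>u\<in>U. v < u)"
proof (cases "A = {} \<or> U = {}")
  case True
  have "Min (insert 0 U) - 1 < u" if "u \<in> U" for u
  proof -
    have "Min (insert 0 U) \<le> u" using assms(2) that by (intro Min_le) simp_all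
    then show ?thesis by linarith
  qed
  moreover have "a < Max (insert 0 A) + 1" if "a \<in> A" for a
  proof -
    have "a \<le> Max (insert 0 A)" using assms(1) that by (intro Max_ge) simp_all
    then show ?thesis by linarith
  qed
  ultimately show ?thesis using True by blast
next
  case False
  then have "Max A < Min U" using assms by simp
  then obtain v where "Max A < v" "v < Min U" using dense by blast
  with False assms show ?thesis by (intro exI[of _ v]) auto
qed

text \<open>
  The new value only has to lie above the entries at positions \<open>d + p\<close> with \<open>g p < g k\<close> and
  below those with \<open>g k < g p\<close>. It is chosen above every entry that is not thereby forced to be
  larger. This particular choice serves to settle undetermined comparisons in the same way all
  along a sequence.
\<close>

lemma insert_highest:
  assumes "inj_on f {..<d + k}" "same_order k f d g 0" "inj_on g {..<Suc k}"
  shows "\<exists>v. v \<notin> f ` {..<d + k} \<and>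
    (\<forall>p<k. (f (d + p) < v \<longleftrightarrow> g p < g k) \<and> (v < f (d + p) \<longleftrightarrow> g k < g p)) \<and>
    (\<forall>p<d + k. (\<forall>r<k. g k < g r \<longrightarrow> f p < f (d + r)) \<longrightarrow> f p < v)"
proof -
  define U where "U = (\<lambda>r. f (d + r)) ` {r. r < k \<and> g k < g r}"
  define A where "A = f ` {p. p < d + k \<and> (\<forall>r<k. g k < g r \<longrightarrow> f p < f (d + r))}"
  have "finite U" "finite A" by (auto simp: U_def A_def)
  moreover have "a < u" if "a \<in> A" "u \<in> U" for a u using that by (auto simp: A_def U_def)
  ultimately obtain v where v: "\<forall>a\<in>A. a < v" "\<forall>u\<in>U. v < u"
    using between_finite_sets[of A U] by auto
  have low: "f p < v" if "p < d + k" "\<forall>r<k. g k < g r \<longrightarrow> f p < f (d + r)" for p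
    using v(1) that by (auto simp: A_def)
  have up: "v < f (d + p)" if "p < k" "g k < g p" for p
    using v(2) that by (auto simp: U_def)
  have low': "f (d + p) < v" if "p < k" "g p < g k" for p
  proof (rule low)
    show "\<forall>r<k. g k < g r \<longrightarrow> f (d + p) < f (d + r)"
      using assms(2) that by (auto simp: same_order_def)
  qed (use that in simp)
  have tri: "g p < g k \<or> g k < g p" if "p < k" for p
    using assms(3) that by (auto simp: inj_on_def neq_iff[symmetric])
  have notin: "v \<noteq> f p" if "p < d + k" for p
  proof (cases "\<forall>r<k. g k < g r \<longrightarrow> f p < f (d + r)")
    case True then show ?thesis using low[OF that] by simp
  next
    case False
    then obtain r where "r < k" "g k < g r" "f (d + r) \<le> f p" by (auto simp: not_less)
    then show ?thesis using up[of r] by simp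
  qed
  show ?thesis
  proof (intro exI[of _ v] conjI allI impI)
    show "v \<notin> f ` {..<d + k}" using notin by auto
    show "f (d + p) < v \<longleftrightarrow> g p < g k" if "p < k" for p
      using low'[of p] up[of p] tri[of p] that by auto
    show "v < f (d + p) \<longleftrightarrow> g k < g p" if "p < k" for p
      using low'[of p] up[of p] tri[of p] that by auto
  qed (use low in blast)
qed

lemma extend_highest:
  assumes "inj_on f {..<d + k}" "same_order k f d g 0" "inj_on g {..<Suc k}"
  shows "\<exists>h. (\<forall>p<d + k. h p = f p) \<and> inj_on h {..<Suc (d + k)} \<and> same_order (Suc k) h d g 0 \<and>
    (\<forall>p<d + k. (\<forall>r<k. g k < g r \<longrightarrow> f p < f (d + r)) \<longrightarrow> f p < h (d + k))"
proof -
  obtain v where v: "v \<notin> f ` {..<d + k}"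
    "\<And>p. p < k \<Longrightarrow> f (d + p) < v \<longleftrightarrow> g p < g k" "\<And>p. p < k \<Longrightarrow> v < f (d + p) \<longleftrightarrow> g k < g p"
    "\<forall>p<d + k. (\<forall>r<k. g k < g r \<longrightarrow> f p < f (d + r)) \<longrightarrow> f p < v"
    using insert_highest[OF assms] by blast
  define h where "h = f(d + k := v)"
  have "inj_on h {..<Suc (d + k)}"
    using assms(1) v(1) unfolding h_def lessThan_Suc
    by (auto simp: inj_on_def)
  moreover have "same_order (Suc k) h d g 0"
    using assms(2) v(2,3) by (auto simp: same_order_def h_def less_Suc_eq)
  ultimately show ?thesis using v(4) by (intro exI[of _ h]) (auto simp: h_def)
qed

text \<open>
  Two linear orders that agree on their overlap have a common extension: the entries of \<open>g\<close>
  beyond the overlap are inserted one after the other.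
\<close>

lemma amalgamation:
  assumes "inj_on f {..<d + k}" "same_order k f d g 0" "inj_on g {..<k + e}"
  shows "\<exists>h. (\<forall>p<d + k. h p = f p) \<and> inj_on h {..<d + k + e} \<and> same_order (k + e) h d g 0"
  using assms(3)
proof (induction e)
  case 0
  then show ?case using assms by (intro exI[of _ f]) simp
next
  case (Suc e)
  have "inj_on g {..<k + e}" using Suc.prems by (rule inj_on_subset) auto
  from Suc.IH[OF this] obtain h where h: "\<forall>p<d + k. h p = f p"
    "inj_on h {..<d + (k + e)}" "same_order (k + e) h d g 0" by (auto simp: add.assoc)
  obtain h' where "\<forall>p<d + (k + e). h' p = h p" "inj_on h' {..<Suc (d + (k + e))}"
    "same_order (Suc (k + e)) h' d g 0"
    using extend_highest[OF h(2,3)] Suc.prems by auto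
  with h(1) show ?case by (intro exI[of _ h']) (auto simp: add.assoc)
qed


section \<open>Realizations of a path of windows\<close>

text \<open>
  The windows of \<open>f\<close>, a sequence of length \<open>m\<close>, run through the stretch of \<open>\<pi>\<close> that begins
  at index \<open>a\<close>. Here \<open>\<pi>\<close> plays the role of a path in the graph of windows, and \<open>f\<close> is one of
  its, in general many, realizations.
\<close>

definition follows :: "nat \<Rightarrow> (nat \<Rightarrow> (nat \<times> nat) set) \<Rightarrow> nat \<Rightarrow> (nat \<Rightarrow> real) \<Rightarrow> nat \<Rightarrow> bool" where
  "follows b \<pi> m f a \<longleftrightarrow> inj_on f {..<m} \<and> (\<forall>t. t + b \<le> m \<longrightarrow> window b f t = \<pi> (a + t))"

lemma follows_inj: "follows b \<pi> m f a \<Longrightarrow> inj_on f {..<m}" by (simp add: follows_def)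
lemma follows_window: "follows b \<pi> m f a \<Longrightarrow> t + b \<le> m \<Longrightarrow> window b f t = \<pi> (a + t)" by (simp add: follows_def)

lemma follows_same_windows: "follows b \<pi> m f a \<Longrightarrow> follows b \<pi> m g a \<Longrightarrow> same_windows b m f g"
  by (simp add: follows_def same_windows_def)

lemma follows_shift: "follows b \<pi> m f a \<Longrightarrow> s + l \<le> m \<Longrightarrow> follows b \<pi> l (\<lambda>p. f (s + p)) (a + s)"
  unfolding follows_def using inj_on_shift[of f m s l] by (auto simp: add.assoc)

lemma follows_mono: "follows b \<pi> m f a \<Longrightarrow> l \<le> m \<Longrightarrow> follows b \<pi> l f a"
  using follows_shift[of b \<pi> m f a 0 l] by simp

lemma follows_if_same_windows: "follows b \<pi> m f a \<Longrightarrow> inj_on g {..<m} \<Longrightarrow> same_windows b m f g \<Longrightarrow> follows b \<pi> m g a"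
  by (simp add: follows_def same_windows_def)

text \<open>
  To continue along the path, the position of the new entry relative to the last \<open>b - 1\<close> entries
  is copied from some other realization \<open>F\<close>; relative to all earlier entries it is as high as
  possible.
\<close>

lemma follows_extend:
  assumes "1 \<le> b" "b \<le> m" "follows b \<pi> m f a" "follows b \<pi> (Suc m) F a"
  shows "\<exists>h. (\<forall>p<m. h p = f p) \<and> follows b \<pi> (Suc m) h a \<and>
    (\<forall>p<m. (\<forall>r. m < r + b \<longrightarrow> r < m \<longrightarrow> F m < F r \<longrightarrow> f p < f r) \<longrightarrow> f p < h m)"
proof -
  define k where "k = b - 1"
  define d where "d = m - k"
  have kd: "d + k = m" "Suc k = b" "d = Suc (m - b)" using assms(1,2) by (auto simp: k_def d_def)
  have "window b f (m - b) = window b F (m - b)" using assms by (simp add: follows_def)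
  then have "same_order b f (m - b) F (m - b)" by (simp add: window_eq_iff)
  from same_order_factor[OF this, of 1 k] have s: "same_order k f d (\<lambda>p. F (d + p)) 0"
    using kd(2) unfolding same_order_shift_right by (simp add: kd(3))
  have i1: "inj_on f {..<d + k}" using assms(3) kd(1) by (simp add: follows_def)
  have i2: "inj_on (\<lambda>p. F (d + p)) {..<Suc k}"
    using inj_on_shift[OF follows_inj[OF assms(4)], of d "Suc k"] kd by simp
  obtain h where h: "\<forall>p<d + k. h p = f p" "inj_on h {..<Suc (d + k)}"
    "same_order (Suc k) h d (\<lambda>p. F (d + p)) 0"
    "\<forall>p<d + k. (\<forall>r<k. F (d + k) < F (d + r) \<longrightarrow> f p < f (d + r)) \<longrightarrow> f p < h (d + k)"
    using extend_highest[OF i1 s i2] by blast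
  have "window b h t = \<pi> (a + t)" if t: "t + b \<le> Suc m" for t
  proof (cases "t + b \<le> m")
    case True
    then have "window b h t = window b f t" using h(1) kd by (intro window_cong) simp
    then show ?thesis using True assms(3) by (simp add: follows_def)
  next
    case False
    then have "t = d" using t kd by simp
    moreover have "window b h d = window b F d"
      using h(3) unfolding same_order_shift_right by (simp add: kd(2) window_eq_iff)
    ultimately show ?thesis using assms(4) t by (simp add: follows_def)
  qed
  then have "follows b \<pi> (Suc m) h a" using h(2) kd(1) by (simp add: follows_def)
  moreover have "f p < h m" if p: "p < m" "\<forall>r. m < r + b \<longrightarrow> r < m \<longrightarrow> F m < F r \<longrightarrow> f p < f r" for p
  proof -
    have "\<forall>r<k. F (d + k) < F (d + r) \<longrightarrow> f p < f (d + r)"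
    proof (intro allI impI)
      fix r assume r: "r < k" "F (d + k) < F (d + r)"
      have "m < (d + r) + b" "d + r < m" using r(1) kd by linarith+
      with p(2) r(2) kd(1) show "f p < f (d + r)" by simp
    qed
    then show ?thesis using h(4) p(1) unfolding kd(1) by blast
  qed
  ultimately show ?thesis using h(1) kd(1) by (intro exI[of _ h]) simp
qed

lemma follows_extend_to:
  assumes "1 \<le> b" "b \<le> m" "\<And>M. \<exists>F. follows b \<pi> M F a" "follows b \<pi> m f a" "m \<le> M"
  shows "\<exists>h. follows b \<pi> M h a \<and> (\<forall>p<m. h p = f p)"
  using \<open>m \<le> M\<close>
proof (induction M rule: dec_induct)
  case base
  then show ?case using assms(4) by blast
next
  case (step M)
  then obtain h where h: "follows b \<pi> M h a" "\<forall>p<m. h p = f p" by blast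
  obtain F where "follows b \<pi> (Suc M) F a" using assms(3) by blast
  then obtain h' where "\<forall>p<M. h' p = h p" "follows b \<pi> (Suc M) h' a"
    using follows_extend[OF assms(1) _ h(1)] assms(2) step.hyps(1) by (meson le_trans)
  with h(2) step.hyps(1) show ?case by (intro exI[of _ h']) auto
qed

section \<open>Forced and ambiguous comparisons\<close>

text \<open>
  The comparisons visible inside a window. Its reflexive transitive closure consists of the
  comparisons that hold in every sequence with the same windows; \<open>shift_up\<close> shows that there are
  no others.
\<close>

definition window_less :: "nat \<Rightarrow> nat \<Rightarrow> (nat \<Rightarrow> real) \<Rightarrow> (nat \<times> nat) set" where
  "window_less b m G = {(w, w'). w < m \<and> w' < m \<and> near b w w' \<and> G w < G w'}"

lemma window_less_star_less:
  assumes "(w, w') \<in> (window_less b m G)\<^sup>*" "b \<le> m" "same_windows b m G H"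
  shows "w = w' \<or> H w < H w'"
  using assms(1)
proof (induction rule: rtrancl_induct)
  case (step y z)
  have "H y < H z" using step.hyps(2) same_windows_near[OF assms(2,3), of y z] by (simp add: window_less_def)
  with step.IH show ?case by auto
qed simp

text \<open>
  Adding a large constant to the entries of a set that is closed upwards under comparisons
  inside windows changes no window, yet puts these entries above all others.
\<close>

lemma shift_up:
  assumes "inj_on G {..<m}" "\<And>w w'. (w, w') \<in> window_less b m G \<Longrightarrow> w \<in> Up \<Longrightarrow> w' \<in> Up"
  shows "\<exists>h. inj_on h {..<m} \<and> same_windows b m G h \<and> (\<forall>p<m. \<forall>q<m.
    h p < h q \<longleftrightarrow> (p \<notin> Up \<and> q \<in> Up) \<or> ((p \<in> Up \<longleftrightarrow> q \<in> Up) \<and> G p < G q))"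
proof -
  define c where "c = 1 + 2 * (\<Sum>p<m. \<bar>G p\<bar>)"
  have le: "\<bar>G p\<bar> \<le> (\<Sum>p<m. \<bar>G p\<bar>)" if "p < m" for p
    using that by (intro member_le_sum) auto
  then have c: "G p < G q + c" if "p < m" "q < m" for p q
    using le[OF that(1)] le[OF that(2)] unfolding c_def by linarith
  define h where "h p = (if p \<in> Up then G p + c else G p)" for p
  have ord: "h p < h q \<longleftrightarrow> (p \<notin> Up \<and> q \<in> Up) \<or> ((p \<in> Up \<longleftrightarrow> q \<in> Up) \<and> G p < G q)"
    if "p < m" "q < m" for p q
    using c[of p q] c[of q p] that by (auto simp: h_def)
  have "inj_on h {..<m}"
  proof (rule inj_onI)
    fix p q assume pq: "p \<in> {..<m}" "q \<in> {..<m}" "h p = h q"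
    then have "G p = G q" using c[of p q] c[of q p] by (auto simp: h_def split: if_splits)
    then show "p = q" using assms(1) pq by (auto simp: inj_on_def)
  qed
  moreover have "same_windows b m G h"
  proof (rule same_windowsI_near)
    fix p q assume pq: "p < m" "q < m" "near b p q"
    then have n: "near b q p" by (simp add: near_def)
    have "p = q \<or> G p < G q \<or> G q < G p" using assms(1) pq by (auto simp: inj_on_def neq_iff[symmetric])
    then show "G p < G q \<longleftrightarrow> h p < h q"
      using assms(2)[of p q] assms(2)[of q p] pq n ord[OF pq(1,2)] by (auto simp: window_less_def)
  qed
  ultimately show ?thesis using ord by blast
qed

text \<open>
  Exchanging two value-neighbours changes no other comparison, and this one is not visible in
  any window.
\<close>

lemma swap_adjacent:
  assumes "inj_on h {..<m}" "i < m" "j < m" "\<not> near b i j" "i \<noteq> j"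
    "\<And>w. w < m \<Longrightarrow> w \<noteq> i \<Longrightarrow> w \<noteq> j \<Longrightarrow> h w < h i \<longleftrightarrow> h w < h j"
  shows "\<exists>h'. inj_on h' {..<m} \<and> same_windows b m h h' \<and> (h' i < h' j \<longleftrightarrow> h j < h i) \<and> (h' j < h' i \<longleftrightarrow> h i < h j)"
proof -
  define h' where "h' = h(i := h j, j := h i)"
  have h': "h' i = h j" "h' j = h i" "\<And>w. w \<noteq> i \<Longrightarrow> w \<noteq> j \<Longrightarrow> h' w = h w"
    using assms(5) by (auto simp: h'_def)
  have ne: "h p \<noteq> h q" if "p < m" "q < m" "p \<noteq> q" for p q
    using assms(1) that by (auto simp: inj_on_def)
  have gt: "h i < h w \<longleftrightarrow> h j < h w" if "w < m" "w \<noteq> i" "w \<noteq> j" for w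
    using assms(6)[OF that] ne[of w i] ne[of w j] that assms(2,3) by auto
  have "inj_on h' {..<m}"
  proof (rule inj_onI)
    fix p q assume "p \<in> {..<m}" "q \<in> {..<m}" "h' p = h' q"
    then show "p = q"
      using ne assms(2,3) by (cases "p = i"; cases "p = j"; cases "q = i"; cases "q = j") (auto simp: h' h'_def split: if_splits)
  qed
  moreover have "same_windows b m h h'"
  proof (rule same_windowsI_near)
    fix p q assume pq: "p < m" "q < m" "near b p q"
    have "\<not> near b j i" using assms(4) unfolding near_def by blast
    then have n: "\<not> (p = i \<and> q = j)" "\<not> (p = j \<and> q = i)" using assms(4) pq(3) by metis+
    consider "p = i" "q = i" | "p = j" "q = j" | "p = i" "q \<noteq> i" "q \<noteq> j" | "p = j" "q \<noteq> i" "q \<noteq> j"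
      | "q = i" "p \<noteq> i" "p \<noteq> j" | "q = j" "p \<noteq> i" "p \<noteq> j" | "p \<noteq> i" "p \<noteq> j" "q \<noteq> i" "q \<noteq> j"
      using n by blast
    then show "h p < h q \<longleftrightarrow> h' p < h' q"
    proof cases
      case 3 then show ?thesis using gt[OF pq(2)] h' by metis
    next
      case 4 then show ?thesis using gt[OF pq(2)] h' by metis
    next
      case 5 then show ?thesis using assms(6)[OF pq(1)] h' by metis
    next
      case 6 then show ?thesis using assms(6)[OF pq(1)] h' by metis
    qed (use h' in simp_all)
  qed
  ultimately show ?thesis using h' by (intro exI[of _ h']) simp
qed

text \<open>
  The windows of \<open>f\<close> do not determine how the entries at \<open>u\<close> and \<open>q\<close> compare.
\<close>

definition ambiguous :: "nat \<Rightarrow> nat \<Rightarrow> (nat \<Rightarrow> real) \<Rightarrow> nat \<Rightarrow> nat \<Rightarrow> bool" where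
  "ambiguous b n f u q \<longleftrightarrow> (\<exists>g h. inj_on g {..<n} \<and> inj_on h {..<n} \<and> same_windows b n f g \<and> same_windows b n f h \<and>
     g u < g q \<and> h q < h u)"

lemma ambiguousI:
  "inj_on g {..<n} \<Longrightarrow> inj_on h {..<n} \<Longrightarrow> same_windows b n f g \<Longrightarrow> same_windows b n f h \<Longrightarrow> g u < g q \<Longrightarrow> h q < h u \<Longrightarrow>
    ambiguous b n f u q"
  unfolding ambiguous_def by blast

lemma ambiguous_sym: "ambiguous b n f u q \<Longrightarrow> ambiguous b n f q u"
  unfolding ambiguous_def by blast

lemma ambiguous_same_windows: "ambiguous b n f u q \<Longrightarrow> same_windows b n f g \<Longrightarrow> ambiguous b n g u q"
  unfolding ambiguous_def by (meson same_windows_sym same_windows_trans)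

lemma ambiguous_shift:
  assumes "ambiguous b n f (s + u) (s + q)" "s + m \<le> n"
  shows "ambiguous b m (\<lambda>p. f (s + p)) u q"
proof -
  obtain g h where "inj_on g {..<n}" "inj_on h {..<n}" "same_windows b n f g" "same_windows b n f h"
    "g (s + u) < g (s + q)" "h (s + q) < h (s + u)" using assms(1) unfolding ambiguous_def by blast
  then show ?thesis using assms(2)
    by (intro ambiguousI[of "\<lambda>p. g (s + p)" _ "\<lambda>p. h (s + p)"]) (auto intro: inj_on_shift same_windows_shift)
qed

lemma ambiguous_not_forced:
  assumes "ambiguous b n f u q" "b \<le> n" "same_windows b n f g"
  shows "(u, q) \<notin> (window_less b n g)\<^sup>*"
proof
  assume s: "(u, q) \<in> (window_less b n g)\<^sup>*"
  obtain h where "same_windows b n f h" "h q < h u" using assms(1) unfolding ambiguous_def by blast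
  moreover from this have "same_windows b n g h" using assms(3) by (meson same_windows_sym same_windows_trans)
  ultimately show False using window_less_star_less[OF s assms(2), of h] by auto
qed

lemma ambiguous_not_near:
  assumes "ambiguous b n f u q" "b \<le> n" "u < n" "q < n"
  shows "\<not> near b u q"
proof
  assume n: "near b u q"
  obtain g h where "same_windows b n f g" "same_windows b n f h" "g u < g q" "h q < h u" using assms(1) unfolding ambiguous_def by blast
  then show False using same_windows_near[OF assms(2) _ assms(3,4) n, of f g] same_windows_near[OF assms(2) _ assms(3,4) n, of f h] by simp
qed

text \<open>
  Arrange the entries in three layers: those forced to lie below the entry at \<open>u\<close> or at \<open>q\<close>,
  then these two, then the rest. No window changes, and the two entries become value-neighbours.
\<close>

lemma ambiguous_adjacent:
  assumes "ambiguous b n f u q" "b \<le> n" "u < n" "q < n" "inj_on f {..<n}"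
  shows "\<exists>h. inj_on h {..<n} \<and> same_windows b n f h \<and>
    (\<forall>w<n. w \<noteq> u \<longrightarrow> w \<noteq> q \<longrightarrow> (h w < h u \<longleftrightarrow> h w < h q))"
proof -
  let ?S = "window_less b n f"
  define X where "X = {w. (w, u) \<in> ?S\<^sup>+ \<or> (w, q) \<in> ?S\<^sup>+}"
  have nst: "(u, q) \<notin> ?S\<^sup>*" "(q, u) \<notin> ?S\<^sup>*"
    using ambiguous_not_forced[OF assms(1,2) same_windows_refl] ambiguous_not_forced[OF ambiguous_sym[OF assms(1)] assms(2) same_windows_refl] by auto
  have irr: "(w, w) \<notin> ?S\<^sup>+" for w
  proof
    assume "(w, w) \<in> ?S\<^sup>+"
    then obtain v where "(w, v) \<in> ?S\<^sup>*" "(v, w) \<in> ?S" by (meson tranclD2)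
    then show False using window_less_star_less[OF _ assms(2) same_windows_refl, of w v f] by (auto simp: window_less_def)
  qed
  have uX: "u \<notin> X" "q \<notin> X" using nst irr by (auto simp: X_def dest: trancl_into_rtrancl)
  have "\<exists>h. inj_on h {..<n} \<and> same_windows b n f h \<and> (\<forall>p<n. \<forall>r<n.
    h p < h r \<longleftrightarrow> (p \<notin> - X \<and> r \<in> - X) \<or> ((p \<in> - X \<longleftrightarrow> r \<in> - X) \<and> f p < f r))"
    by (rule shift_up[OF assms(5)]) (auto simp: X_def dest: trancl_into_trancl2)
  then obtain h1 where h1: "inj_on h1 {..<n}" "same_windows b n f h1" "\<And>p r. p < n \<Longrightarrow> r < n \<Longrightarrow>
    h1 p < h1 r \<longleftrightarrow> (p \<in> X \<and> r \<notin> X) \<or> ((p \<in> X \<longleftrightarrow> r \<in> X) \<and> f p < f r)" by auto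
  have st_eq: "window_less b n h1 = ?S" using same_windows_near[OF assms(2) h1(2)] by (auto simp: window_less_def)
  have "\<exists>h. inj_on h {..<n} \<and> same_windows b n h1 h \<and> (\<forall>p<n. \<forall>r<n.
    h p < h r \<longleftrightarrow> (p \<notin> - (X \<union> {u, q}) \<and> r \<in> - (X \<union> {u, q})) \<or>
      ((p \<in> - (X \<union> {u, q}) \<longleftrightarrow> r \<in> - (X \<union> {u, q})) \<and> h1 p < h1 r))"
  proof (rule shift_up[OF h1(1)])
    fix w w' assume "(w, w') \<in> window_less b n h1" "w \<in> - (X \<union> {u, q})"
    then show "w' \<in> - (X \<union> {u, q})" unfolding st_eq by (auto simp: X_def dest: trancl_into_trancl2)
  qed
  then obtain h where h: "inj_on h {..<n}" "same_windows b n h1 h" "\<And>p r. p < n \<Longrightarrow> r < n \<Longrightarrow>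
    h p < h r \<longleftrightarrow> (p \<in> X \<union> {u, q} \<and> r \<notin> X \<union> {u, q}) \<or>
      ((p \<in> X \<union> {u, q} \<longleftrightarrow> r \<in> X \<union> {u, q}) \<and> h1 p < h1 r)" by auto
  have "h w < h u \<longleftrightarrow> h w < h q" if "w < n" "w \<noteq> u" "w \<noteq> q" for w
    using that h(3) h1(3) uX assms(3,4) by auto
  with h(1) same_windows_trans[OF h1(2) h(2)] show ?thesis by blast
qed

lemma ex_adjacent_below_or_above:
  fixes h :: "nat \<Rightarrow> real"
  assumes "inj_on h {..<Suc d}" "2 \<le> d"
    "\<forall>w<Suc d. w \<noteq> 0 \<longrightarrow> w \<noteq> d \<longrightarrow> (h w < h 0 \<longleftrightarrow> h w < h d)"
  shows "\<exists>a. 0 < a \<and> a < d \<and> (\<forall>w. 0 < w \<longrightarrow> w < d \<longrightarrow> w \<noteq> a \<longrightarrow>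
    (h w < h 0 \<longleftrightarrow> h w < h a) \<and> (h w < h d \<longleftrightarrow> h w < h a))"
proof -
  let ?I = "{w. 0 < w \<and> w < d}"
  define L where "L = {w \<in> ?I. h w < h 0}"
  have ne: "h p \<noteq> h q" if "p < Suc d" "q < Suc d" "p \<noteq> q" for p q
    using assms(1) that by (auto simp: inj_on_def)
  show ?thesis
  proof (cases "L = {}")
    case False
    have "finite L" by (auto simp: L_def)
    then have "Max (h ` L) \<in> h ` L" using False by (intro Max_in) auto
    then obtain a where a: "a \<in> L" "h a = Max (h ` L)" by auto
    have "h w \<le> h a" if "w \<in> L" for w using a(2) \<open>finite L\<close> that by simp
    then have "h w < h 0 \<longleftrightarrow> h w < h a" if "0 < w" "w < d" "w \<noteq> a" for w
      using ne[of w a] that a(1) by (fastforce simp: L_def)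
    with a(1) assms(3) show ?thesis by (intro exI[of _ a]) (auto simp: L_def)
  next
    case True
    have fin: "finite ?I" "?I \<noteq> {}" using assms(2) by (auto intro!: exI[of _ 1])
    then have "Min (h ` ?I) \<in> h ` ?I" by (intro Min_in) auto
    then obtain a where a: "a \<in> ?I" "h a = Min (h ` ?I)" by auto
    have "h a \<le> h w" if "w \<in> ?I" for w unfolding a(2) using fin that by (intro Min_le) auto
    then have "h w < h 0 \<longleftrightarrow> h w < h a" if "0 < w" "w < d" "w \<noteq> a" for w
      using that True by (fastforce simp: L_def)
    with a(1) assms(3) show ?thesis by (intro exI[of _ a]) auto
  qed
qed

text \<open>
  Make positions \<open>0\<close> and \<open>d\<close> value-neighbours and let \<open>a\<close> be the position next to them in value.
  After deletion of position \<open>d\<close> the positions \<open>0\<close> and \<open>a\<close> are value-neighbours, so that they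
  can be exchanged unless they are near; deleting position \<open>0\<close> instead, the same holds for \<open>a\<close>
  and \<open>d\<close>.
\<close>

lemma ambiguous_neighbour:
  assumes "ambiguous b (Suc d) f 0 d" "b \<le> d" "2 \<le> d" "inj_on f {..<Suc d}"
  shows "\<exists>a. 0 < a \<and> a < d \<and> (b \<le> a \<longrightarrow> ambiguous b d f 0 a) \<and>
    (b \<le> d - a \<longrightarrow> ambiguous b d (\<lambda>p. f (1 + p)) (a - 1) (d - 1))"
proof -
  obtain h where h: "inj_on h {..<Suc d}" "same_windows b (Suc d) f h"
    "\<forall>w<Suc d. w \<noteq> 0 \<longrightarrow> w \<noteq> d \<longrightarrow> (h w < h 0 \<longleftrightarrow> h w < h d)"
    using ambiguous_adjacent[OF assms(1)] assms by auto
  obtain a where a: "0 < a" "a < d" and adj: "\<And>w. 0 < w \<Longrightarrow> w < d \<Longrightarrow> w \<noteq> a \<Longrightarrow>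
    (h w < h 0 \<longleftrightarrow> h w < h a) \<and> (h w < h d \<longleftrightarrow> h w < h a)"
    using ex_adjacent_below_or_above[OF h(1) assms(3) h(3)] by blast
  have hd: "inj_on h {..<d}" "same_windows b d f h" using h(1,2) by (auto intro: inj_on_subset same_windows_mono)
  have "ambiguous b d f 0 a" if "b \<le> a"
  proof -
    have "\<exists>h'. inj_on h' {..<d} \<and> same_windows b d h h' \<and> (h' 0 < h' a \<longleftrightarrow> h a < h 0) \<and> (h' a < h' 0 \<longleftrightarrow> h 0 < h a)"
      using a that adj by (intro swap_adjacent[OF hd(1)]) (auto simp: near_def)
    then obtain h' where h': "inj_on h' {..<d}" "same_windows b d h h'" "h' 0 < h' a \<longleftrightarrow> h a < h 0"
      "h' a < h' 0 \<longleftrightarrow> h 0 < h a" by blast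
    have "h 0 \<noteq> h a" using hd(1) a by (auto simp: inj_on_def)
    with h' hd show ?thesis by (meson ambiguousI neq_iff same_windows_trans)
  qed
  moreover have "ambiguous b d (\<lambda>p. f (1 + p)) (a - 1) (d - 1)" if "b \<le> d - a"
  proof -
    let ?k = "\<lambda>p. h (1 + p)"
    have k: "inj_on ?k {..<d}" "same_windows b d (\<lambda>p. f (1 + p)) ?k"
      using inj_on_shift[OF h(1), of 1 d] same_windows_shift[OF h(2), of 1 d] by simp_all
    have "\<exists>h'. inj_on h' {..<d} \<and> same_windows b d ?k h' \<and> (h' (a - 1) < h' (d - 1) \<longleftrightarrow> ?k (d - 1) < ?k (a - 1)) \<and>
      (h' (d - 1) < h' (a - 1) \<longleftrightarrow> ?k (a - 1) < ?k (d - 1))"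
      using a that adj by (intro swap_adjacent[OF k(1)]) (auto simp: near_def)
    then obtain h' where h': "inj_on h' {..<d}" "same_windows b d ?k h'"
      "h' (a - 1) < h' (d - 1) \<longleftrightarrow> ?k (d - 1) < ?k (a - 1)"
      "h' (d - 1) < h' (a - 1) \<longleftrightarrow> ?k (a - 1) < ?k (d - 1)" by blast
    have "?k (a - 1) \<noteq> ?k (d - 1)" using h(1) a by (auto simp: inj_on_def)
    then consider "?k (a - 1) < ?k (d - 1)" | "?k (d - 1) < ?k (a - 1)" by linarith
    then show ?thesis
    proof cases
      case 1 then show ?thesis using h' k by (intro ambiguousI[of ?k _ h']) (auto intro: same_windows_trans)
    next
      case 2 then show ?thesis using h' k by (intro ambiguousI[of h' _ ?k]) (auto intro: same_windows_trans)
    qed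
  qed
  ultimately show ?thesis using a by blast
qed

text \<open>
  Ambiguity is a local phenomenon. At distance \<open>d \<ge> 2 * b\<close>, the position \<open>a\<close> of
  \<open>ambiguous_neighbour\<close> cannot be near both \<open>0\<close> and \<open>d\<close>, and so the distance can be decreased.
\<close>

lemma ambiguous_short_factor:
  assumes "ambiguous b n f u q" "u < q" "q < n" "inj_on f {..<n}" "b \<le> n" "1 \<le> b"
  shows "\<exists>u' q'. u \<le> u' \<and> u' + b \<le> q' \<and> q' \<le> q \<and> q' < u' + 2 * b \<and>
    ambiguous b (Suc (q' - u')) (\<lambda>p. f (u' + p)) 0 (q' - u')"
  using assms(1-5)
proof (induction "q - u" arbitrary: n f u q rule: less_induct)
  case less
  define d where "d = q - u"
  let ?f = "\<lambda>p. f (u + p)"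
  have am: "ambiguous b (Suc d) ?f 0 d"
    using less.prems by (intro ambiguous_shift[of b n]) (auto simp: d_def)
  show ?case
  proof (cases "d < 2 * b")
    case True
    have "u + b \<le> q" using ambiguous_not_near[OF less.prems(1,5)] less.prems(2,3) by (auto simp: near_def)
    with True show ?thesis using am less.prems by (intro exI[of _ u] exI[of _ q]) (auto simp: d_def)
  next
    case False
    have inj: "inj_on ?f {..<Suc d}" using less.prems by (intro inj_on_shift) (auto simp: d_def)
    obtain a where a: "0 < a" "a < d" "b \<le> a \<Longrightarrow> ambiguous b d ?f 0 a"
      "b \<le> d - a \<Longrightarrow> ambiguous b d (\<lambda>p. ?f (1 + p)) (a - 1) (d - 1)"
      using ambiguous_neighbour[OF am _ _ inj] False assms(6) by auto
    show ?thesis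
    proof (cases "b \<le> a")
      case True
      have "inj_on ?f {..<d}" using inj by (rule inj_on_subset) auto
      then obtain u' q' where "0 \<le> u'" "u' + b \<le> q'" "q' \<le> a" "q' < u' + 2 * b"
        "ambiguous b (Suc (q' - u')) (\<lambda>p. ?f (u' + p)) 0 (q' - u')"
        using less.hyps[of a 0 d ?f] a True less.prems(2) by (auto simp: d_def)
      then show ?thesis using a(2) by (intro exI[of _ "u + u'"] exI[of _ "u + q'"]) (auto simp: d_def add.assoc)
    next
      case f: False
      then have "b \<le> d - a" using False by simp
      moreover have "inj_on (\<lambda>p. ?f (1 + p)) {..<d}" using inj by (rule inj_on_shift) auto
      moreover have "d - 1 - (a - 1) < q - u" "a - 1 < d - 1" "d - 1 < d" "b \<le> d" using a False by (auto simp: d_def)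
      ultimately obtain u' q' where "a - 1 \<le> u'" "u' + b \<le> q'" "q' \<le> d - 1" "q' < u' + 2 * b"
        "ambiguous b (Suc (q' - u')) (\<lambda>p. ?f (1 + (u' + p))) 0 (q' - u')"
        using less.hyps[of "d - 1" "a - 1" d "\<lambda>p. ?f (1 + p)"] a(4) by blast
      then show ?thesis using a(2)
        by (intro exI[of _ "u + (1 + u')"] exI[of _ "u + (1 + q')"]) (auto simp: d_def add.assoc)
    qed
  qed
qed

text \<open>
  A rearranged factor with the same windows fits into the surrounding sequence: it is
  amalgamated with the parts on both sides over overlaps of length \<open>b\<close>.
\<close>

lemma factor_variant_extends:
  assumes "inj_on f {..<n}" "s + m \<le> n" "b \<le> m" "inj_on g {..<m}" "same_windows b m (\<lambda>p. f (s + p)) g"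
  shows "\<exists>h. inj_on h {..<n} \<and> same_windows b n f h \<and> same_order m h s g 0"
proof -
  have w: "window b f (s + t) = window b g t" if "t + b \<le> m" for t using assms(5) that by (simp add: same_windows_def)
  have "same_order b f s g 0" using w[of 0] assms(3) by (simp add: window_eq_iff)
  moreover have "inj_on f {..<s + b}" using assms(1) by (rule inj_on_subset) (use assms(2,3) in auto)
  ultimately obtain h1 where h1: "\<forall>p<s + b. h1 p = f p" "inj_on h1 {..<s + m}" "same_order m h1 s g 0"
    using amalgamation[of f s b g "m - b"] assms(3,4) by (auto simp: add.assoc)
  define d where "d = s + m - b"
  have "window b h1 d = window b g (m - b)" using same_order_window[OF h1(3), of "m - b" b] assms(3) by (simp add: d_def)
  then have "same_order b h1 d (\<lambda>p. f (d + p)) 0" using w[of "m - b"] assms(3) unfolding same_order_shift_right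
    by (simp add: window_eq_iff same_order_def d_def)
  moreover have "inj_on (\<lambda>p. f (d + p)) {..<b + (n - (s + m))}"
    using assms(1) by (rule inj_on_shift) (use assms(2,3) in \<open>auto simp: d_def\<close>)
  moreover have dsm: "d + b = s + m" using assms(3) by (simp add: d_def)
  ultimately obtain h where h: "\<forall>p<s + m. h p = h1 p" "inj_on h {..<s + m + (n - (s + m))}"
    "same_order (b + (n - (s + m))) h d (\<lambda>p. f (d + p)) 0"
    using amalgamation[of h1 d b "\<lambda>p. f (d + p)" "n - (s + m)"] h1(2) by auto
  have sm: "same_order m h s g 0"
    using h1(3) h(1) by (auto simp: same_order_def)
  have "window b f t = window b h t" if t: "t + b \<le> n" for t
  proof -
    consider "t \<le> s" | "s < t" "t + b \<le> s + m" | "d < t" using dsm by linarith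
    then show ?thesis
    proof cases
      case 1
      then show ?thesis using h(1) h1(1) assms(3) by (intro window_cong) simp
    next
      case 2
      then have "window b f t = window b g (t - s)" using w[of "t - s"] by simp
      also have "\<dots> = window b h t" using same_order_window[OF sm, of "t - s" b] 2 by simp
      finally show ?thesis .
    next
      case 3
      then show ?thesis using same_order_window[OF h(3), of "t - d" b] t dsm by simp
    qed
  qed
  then show ?thesis using h(2) sm assms(2) by (intro exI[of _ h]) (auto simp: same_windows_def)
qed

lemma ambiguous_extends:
  assumes "ambiguous b m (\<lambda>p. f (s + p)) u q" "s + m \<le> n" "b \<le> m" "inj_on f {..<n}" "u < m" "q < m"
  shows "ambiguous b n f (s + u) (s + q)"
proof -
  obtain g h where gh: "inj_on g {..<m}" "inj_on h {..<m}" "same_windows b m (\<lambda>p. f (s + p)) g"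
    "same_windows b m (\<lambda>p. f (s + p)) h" "g u < g q" "h q < h u" using assms(1) unfolding ambiguous_def by blast
  obtain g' where g': "inj_on g' {..<n}" "same_windows b n f g'" "same_order m g' s g 0"
    using factor_variant_extends[OF assms(4,2,3) gh(1,3)] by blast
  obtain h' where h': "inj_on h' {..<n}" "same_windows b n f h'" "same_order m h' s h 0"
    using factor_variant_extends[OF assms(4,2,3) gh(2,4)] by blast
  show ?thesis using g' h' gh(5,6) assms(5,6) by (intro ambiguousI[of g' _ h']) (auto simp: same_order_def)
qed

section \<open>Classes determined by windows\<close>

text \<open>
  A class of finite sequences, up to order isomorphism, that is closed under factors and such
  that membership of a long sequence depends on its windows only. A set of permutations defined
  by finitely many forbidden consecutive patterns is of this kind as soon as \<open>b\<close> bounds the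
  lengths of the patterns.
\<close>

locale local_class =
  fixes b :: nat and mem :: "nat \<Rightarrow> (nat \<Rightarrow> real) \<Rightarrow> bool"
  assumes b_pos: "1 \<le> b"
    and mem_inj: "mem n f \<Longrightarrow> inj_on f {..<n}"
    and mem_factor: "mem n f \<Longrightarrow> s + m \<le> n \<Longrightarrow> same_order m g 0 f s \<Longrightarrow> mem m g"
    and mem_local: "b \<le> n \<Longrightarrow> inj_on f {..<n} \<Longrightarrow> (\<And>i. i + b \<le> n \<Longrightarrow> mem b (\<lambda>p. f (i + p))) \<Longrightarrow> mem n f"
begin

text \<open>
  The size of the power set of \<open>{..<b} \<times> {..<b}\<close>, hence an upper bound for the number of
  windows.
\<close>

definition num_windows :: nat where "num_windows = 2 ^ (b * b)"

lemma num_windows_pos: "1 \<le> num_windows" by (simp add: num_windows_def)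

lemma mem_shift: "mem n f \<Longrightarrow> s + m \<le> n \<Longrightarrow> mem m (\<lambda>p. f (s + p))"
  by (rule mem_factor) auto

lemma mem_mono: "mem n f \<Longrightarrow> m \<le> n \<Longrightarrow> mem m f"
  using mem_shift[of n f 0 m] by simp

lemma mem_if_windows:
  assumes "b \<le> n" "inj_on f {..<n}"
    "\<And>i. i + b \<le> n \<Longrightarrow> \<exists>m g j. mem m g \<and> j + b \<le> m \<and> window b f i = window b g j"
  shows "mem n f"
proof (rule mem_local[OF assms(1,2)])
  fix i assume "i + b \<le> n"
  then obtain m g j where "mem m g" "j + b \<le> m" "same_order b f i g j"
    using assms(3) by (metis window_eq_iff)
  then show "mem b (\<lambda>p. f (i + p))" by (intro mem_factor[of m g j b]) simp_all
qed

lemma mem_if_same_windows: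
  assumes "mem n f" "b \<le> n" "same_windows b n f g" "inj_on g {..<n}" shows "mem n g"
proof (rule mem_if_windows[OF assms(2,4)])
  fix i assume "i + b \<le> n"
  then show "\<exists>m h j. mem m h \<and> j + b \<le> m \<and> window b g i = window b h j"
    using assms(1,3) by (intro exI[of _ n] exI[of _ f] exI[of _ i]) (simp add: same_windows_def)
qed

text \<open>
  An overlap of length \<open>b - 1\<close> is enough: every window of the amalgam lies in \<open>f\<close> or in \<open>g\<close>.
\<close>

lemma glue:
  assumes "mem (d + k) f" "mem (k + e) g" "same_order k f d g 0" "b \<le> Suc k" "b \<le> d + k + e"
  shows "\<exists>h. (\<forall>p<d + k. h p = f p) \<and> mem (d + k + e) h \<and> same_order (k + e) h d g 0"
proof -
  obtain h where h: "\<forall>p<d + k. h p = f p" "inj_on h {..<d + k + e}" "same_order (k + e) h d g 0"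
    using amalgamation[of f d k g e] assms(1-3) mem_inj by blast
  have "mem (d + k + e) h"
  proof (rule mem_if_windows[OF assms(5) h(2)])
    fix i assume i: "i + b \<le> d + k + e"
    show "\<exists>m g j. mem m g \<and> j + b \<le> m \<and> window b h i = window b g j"
    proof (cases "i + b \<le> d + k")
      case True
      then have "window b h i = window b f i" using h(1) by (intro window_cong) simp
      with True assms(1) show ?thesis by blast
    next
      case False
      then have "d \<le> i" using assms(4) by simp
      then have "window b h i = window b g (i - d)" using same_order_window[OF h(3), of "i - d" b] i by simp
      moreover have "i - d + b \<le> k + e" using \<open>d \<le> i\<close> i by simp
      ultimately show ?thesis using assms(2) by blast
    qed
  qed
  with h show ?thesis by blast
qed

text \<open>
  Follow \<open>f\<close> as far as the window at \<open>i\<close> and continue as \<open>g\<close> does after the equal window at \<open>j\<close>.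
\<close>

lemma splice:
  assumes "mem n f" "i + b \<le> n" "mem m g" "j + b \<le> m" "window b f i = window b g j"
  shows "\<exists>h. (\<forall>p<i + b. h p = f p) \<and> mem (i + (m - j)) h \<and> same_order (m - j) h i g j"
proof -
  have "same_order b f i (\<lambda>p. g (j + p)) 0" using assms(5) unfolding same_order_shift_right by (simp add: window_eq_iff)
  moreover have "mem (i + b) f" using assms(1,2) by (rule mem_mono)
  moreover have "mem (b + (m - j - b)) (\<lambda>p. g (j + p))" using assms(3,4) by (intro mem_shift) auto
  ultimately obtain h where h: "\<forall>p<i + b. h p = f p" "mem (i + b + (m - j - b)) h"
    "same_order (b + (m - j - b)) h i (\<lambda>p. g (j + p)) 0" using glue[of i b f "m - j - b" "\<lambda>p. g (j + p)"] by auto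
  have "i + b + (m - j - b) = i + (m - j)" "b + (m - j - b) = m - j" using assms(4) by auto
  with h show ?thesis unfolding same_order_shift_right by (metis add.right_neutral)
qed

lemma repeat_window: "\<exists>p q. i \<le> p \<and> p < q \<and> q \<le> i + num_windows \<and> window b f p = window b f q"
proof -
  let ?P = "Pow ({..<b} \<times> {..<b})"
  have "card (window b f ` {i..i + num_windows}) \<le> card ?P"
    by (intro card_mono) (auto simp: window_def)
  also have "\<dots> = num_windows" by (simp add: card_Pow card_cartesian_product num_windows_def)
  finally have "\<not> inj_on (window b f) {i..i + num_windows}" by (intro pigeonhole) simp
  then obtain p q where "p \<in> {i..i + num_windows}" "q \<in> {i..i + num_windows}" "p \<noteq> q" "window b f p = window b f q"
    by (auto simp: inj_on_def)
  then show ?thesis by (cases p q rule: linorder_cases) (auto intro: exI[of _ p] exI[of _ q])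
qed

section \<open>Joint embedding\<close>

definition joint :: "nat \<Rightarrow> (nat \<Rightarrow> real) \<Rightarrow> nat \<Rightarrow> (nat \<Rightarrow> real) \<Rightarrow> bool" where
  "joint n f m g \<longleftrightarrow> (\<exists>l h. mem l h \<and> embeds n f l h \<and> embeds m g l h)"

definition joint_in :: "nat \<Rightarrow> nat \<Rightarrow> (nat \<Rightarrow> real) \<Rightarrow> nat \<Rightarrow> (nat \<Rightarrow> real) \<Rightarrow> bool" where
  "joint_in l n f m g \<longleftrightarrow> (\<exists>h. mem l h \<and> embeds n f l h \<and> embeds m g l h)"

lemma joint_sym: "joint n f m g \<Longrightarrow> joint m g n f" by (auto simp: joint_def)

lemma joint_mono: "joint n f m g \<Longrightarrow> embeds n' f' n f \<Longrightarrow> embeds m' g' m g \<Longrightarrow> joint n' f' m' g'"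
  unfolding joint_def by (meson embeds_trans)

text \<open>
  A step of the path of windows into the set \<open>U\<close>.
\<close>

definition crossing :: "(nat \<times> nat) set set \<Rightarrow> nat \<Rightarrow> (nat \<Rightarrow> real) \<Rightarrow> nat \<Rightarrow> bool" where
  "crossing U n f i \<longleftrightarrow> i + b < n \<and> window b f i \<notin> U \<and> window b f (Suc i) \<in> U"

lemma crossing_same_order:
  "same_order n f i g j \<Longrightarrow> t + b < n \<Longrightarrow> crossing U l f (i + t) \<Longrightarrow> j + t + b < m \<Longrightarrow> crossing U m g (j + t)"
  using same_order_window[of n f i g j t b] same_order_window[of n f i g j "Suc t" b] by (simp add: crossing_def)

lemma crossing_same_windows: "crossing U n f i \<Longrightarrow> same_windows b n f g \<Longrightarrow> crossing U n g i"
  unfolding crossing_def same_windows_def by (metis Suc_leI add_Suc less_imp_le_nat)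

text \<open>
  A path that has entered such a set never leaves it. A member of the class has therefore at
  most one crossing, which can serve as the origin of an absolute coordinate system for
  positions.
\<close>

definition successor_closed :: "(nat \<times> nat) set set \<Rightarrow> bool" where
  "successor_closed U \<longleftrightarrow> (\<forall>n f i j. mem n f \<longrightarrow> i \<le> j \<longrightarrow> j + b \<le> n \<longrightarrow> window b f i \<in> U \<longrightarrow> window b f j \<in> U)"

lemma crossing_unique:
  assumes "successor_closed U" "mem n f" "crossing U n f i" "crossing U n f j"
  shows "i = j"
proof -
  have "\<not> i < j" if "crossing U n f i" "crossing U n f j" for i j
  proof
    assume "i < j"
    then have "window b f j \<in> U" using assms(1,2) that unfolding successor_closed_def crossing_def
      by (meson Suc_leI less_imp_le_nat)
    with that(2) show False by (simp add: crossing_def)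
  qed
  with assms(3,4) show ?thesis by (meson linorder_neqE_nat)
qed

text \<open>
  In a common extension both crossings must be the only one there, so the two copies lie at the
  same place.
\<close>

lemma crossing_in_joint:
  assumes "successor_closed U" "mem n f" "mem n g" "crossing U n f i" "crossing U n g i" "joint n f n g"
  shows "same_order n f 0 g 0"
proof -
  obtain l h s t where h: "mem l h" "s + n \<le> l" "same_order n f 0 h s" "t + n \<le> l" "same_order n g 0 h t"
    using assms(6) by (auto simp: joint_def embeds_def)
  have "crossing U l h (s + i)" "crossing U l h (t + i)"
    using crossing_same_order[OF h(3), of i U n l] crossing_same_order[OF h(5), of i U n l] h(2,4) assms(4,5)
    by (auto simp: crossing_def)
  then have "s = t" using crossing_unique[OF assms(1) h(1)] by fastforce
  then show ?thesis using same_order_trans[OF h(3)] same_order_sym[OF h(5)] by blast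
qed

definition joint_upto :: "nat \<Rightarrow> bool" where
  "joint_upto R \<longleftrightarrow> (\<forall>n f m g. n \<le> R \<longrightarrow> m \<le> R \<longrightarrow> mem n f \<longrightarrow> mem m g \<longrightarrow> joint n f m g)"

text \<open>
  The length and the position of the crossing determine a member of the class up to order
  isomorphism.
\<close>

definition determined :: "(nat \<times> nat) set set \<Rightarrow> nat \<Rightarrow> bool" where
  "determined U n \<longleftrightarrow> (\<forall>f g i. mem n f \<longrightarrow> mem n g \<longrightarrow> crossing U n f i \<longrightarrow> crossing U n g i \<longrightarrow> same_order n f 0 g 0)"

text \<open>
  The part of a sequence between two equal windows can be cut out.
\<close>

lemma cut_loop:
  assumes "mem n f" "p < q" "q + b \<le> n" "window b f p = window b f q"
  obtains h where "mem (n - (q - p)) h" "\<And>t. t \<le> p \<Longrightarrow> window b h t = window b f t"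
    "\<And>t. p \<le> t \<Longrightarrow> t + (q - p) + b \<le> n \<Longrightarrow> window b h t = window b f (t + (q - p))"
    "same_order (p + b) h 0 f 0" "same_order (n - q) h p f q"
proof -
  obtain h where h: "\<forall>x<p + b. h x = f x" "mem (p + (n - q)) h" "same_order (n - q) h p f q"
    using splice[OF assms(1) _ assms(1,3,4)] assms(2,3) by auto
  have l: "p + (n - q) = n - (q - p)" using assms(2,3) by simp
  show thesis
  proof (rule that[of h])
    show "mem (n - (q - p)) h" using h(2) l by simp
    show "window b h t = window b f t" if "t \<le> p" for t
      using h(1) that by (intro window_cong) simp
    show "window b h t = window b f (t + (q - p))" if "p \<le> t" "t + (q - p) + b \<le> n" for t
    proof -
      have "t - p + b \<le> n - q" using that assms(2) by simp
      from same_order_window[OF h(3) this] that(1) assms(2) show ?thesis by (simp add: add.commute)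
    qed
    show "same_order (p + b) h 0 f 0" using h(1) by (intro same_order_eqI) simp
  qed (rule h(3))
qed

text \<open>
  Windows in a shorter factor that still contains the crossing agree by induction. Only if the
  crossing lies at one end of the sequences is the window at the opposite end not covered. In
  this case a loop between the two is cut out of both sequences; this keeps the crossing and the
  window in question, and the induction hypothesis applies to the shorter sequences.
\<close>

lemma determined_step_windows:
  assumes determined: "\<And>m. m < n \<Longrightarrow> determined U m" and n: "num_windows + b + 3 < n"
    and f: "mem n f" "crossing U n f i" and g: "mem n g" "crossing U n g i"
  shows "same_windows b n f g"
proof -
  have dn: "determined U (n - 1)" using determined n by simp
  have tail: "same_order (n - 1) f 1 g 1" if "1 \<le> i"
  proof -
    have "mem (n - 1) (\<lambda>p. f (1 + p))" "mem (n - 1) (\<lambda>p. g (1 + p))"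
      using mem_shift[OF f(1), of 1 "n - 1"] mem_shift[OF g(1), of 1 "n - 1"] n by simp_all
    moreover have "crossing U (n - 1) (\<lambda>p. f (1 + p)) (i - 1)" "crossing U (n - 1) (\<lambda>p. g (1 + p)) (i - 1)"
      using f(2) g(2) that by (auto simp: crossing_def window_def)
    ultimately have "same_order (n - 1) (\<lambda>p. f (1 + p)) 0 (\<lambda>p. g (1 + p)) 0"
      using dn unfolding determined_def by blast
    then show ?thesis by simp
  qed
  have init: "same_order (n - 1) f 0 g 0" if "i + b + 1 < n"
  proof -
    have "mem (n - 1) f" "mem (n - 1) g" using f(1) g(1) by (auto intro: mem_mono)
    moreover have "crossing U (n - 1) f i" "crossing U (n - 1) g i"
      using f(2) g(2) that by (auto simp: crossing_def)
    ultimately show ?thesis using determined[of "n - 1"] n unfolding determined_def by auto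
  qed
  consider "1 \<le> i" "i + b + 1 < n" | "i = 0" | "i + b + 1 = n" using f(2) unfolding crossing_def by linarith
  then show ?thesis
  proof cases
    case 1
    have "window b f t = window b g t" if "t + b \<le> n" for t
    proof (cases t)
      case 0
      then show ?thesis using same_order_window[OF init[OF 1(2)], of 0 b] n by simp
    next
      case (Suc t')
      then show ?thesis using same_order_window[OF tail[OF 1(1)], of t' b] that by simp
    qed
    then show ?thesis by (simp add: same_windows_def)
  next
    case 2
    then have init: "same_order (n - 1) f 0 g 0" using init n by simp
    have eq: "window b f t = window b g t" if "t + b < n" for t
      using same_order_window[OF init, of t b] that by simp
    obtain p q where pq: "1 \<le> p" "p < q" "q \<le> 1 + num_windows" "window b f p = window b f q"
      using repeat_window[of 1 f] by auto
    let ?l = "q - p"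
    have qb: "q + b < n" using pq n by simp
    obtain f' where f': "mem (n - ?l) f'" "\<And>t. t \<le> p \<Longrightarrow> window b f' t = window b f t"
      "\<And>t. p \<le> t \<Longrightarrow> t + (q - p) + b \<le> n \<Longrightarrow> window b f' t = window b f (t + (q - p))"
      using cut_loop[OF f(1) pq(2) _ pq(4)] qb by (metis less_imp_le_nat)
    have "window b g p = window b g q" using eq[of p] eq[of q] pq qb by simp
    then obtain g' where g': "mem (n - ?l) g'" "\<And>t. t \<le> p \<Longrightarrow> window b g' t = window b g t"
      "\<And>t. p \<le> t \<Longrightarrow> t + (q - p) + b \<le> n \<Longrightarrow> window b g' t = window b g (t + (q - p))"
      using cut_loop[OF g(1) pq(2)] qb by (metis less_imp_le_nat)
    have "crossing U (n - ?l) f' 0" "crossing U (n - ?l) g' 0"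
      using f(2) g(2) f'(2) g'(2) pq qb 2 by (auto simp: crossing_def)
    then have sm: "same_order (n - ?l) f' 0 g' 0"
      using determined[of "n - ?l"] f'(1) g'(1) pq qb unfolding determined_def by auto
    let ?t = "n - b - ?l"
    have "window b f' ?t = window b g' ?t" using same_order_window[OF sm, of ?t b] qb by simp
    moreover have "p \<le> ?t" "?t + ?l + b \<le> n" "?t + ?l = n - b" using qb pq by auto
    ultimately have "window b f (n - b) = window b g (n - b)" using f'(3)[of ?t] g'(3)[of ?t] by simp
    then show ?thesis using eq unfolding same_windows_def
      by (metis add_diff_cancel_right' le_neq_implies_less)
  next
    case 3
    then have tl: "same_order (n - 1) f 1 g 1" using tail n by simp
    have eq: "window b f t = window b g t" if "1 \<le> t" "t + b \<le> n" for t
      using same_order_window[OF tl, of "t - 1" b] that by simp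
    obtain p q where pq: "1 \<le> p" "p < q" "q \<le> 1 + num_windows" "window b f p = window b f q"
      using repeat_window[of 1 f] by auto
    let ?l = "q - p"
    have qi: "q < i" using pq n 3 by simp
    have qb: "q + b \<le> n" using qi 3 by simp
    obtain f' where f': "mem (n - ?l) f'" "\<And>t. t \<le> p \<Longrightarrow> window b f' t = window b f t"
      "\<And>t. p \<le> t \<Longrightarrow> t + (q - p) + b \<le> n \<Longrightarrow> window b f' t = window b f (t + (q - p))"
      using cut_loop[OF f(1) pq(2) qb pq(4)] by metis
    have "window b g p = window b g q" using eq[of p] eq[of q] pq qi 3 by simp
    then obtain g' where g': "mem (n - ?l) g'" "\<And>t. t \<le> p \<Longrightarrow> window b g' t = window b g t"
      "\<And>t. p \<le> t \<Longrightarrow> t + (q - p) + b \<le> n \<Longrightarrow> window b g' t = window b g (t + (q - p))"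
      using cut_loop[OF g(1) pq(2) qb] by metis
    let ?i = "i - ?l"
    have ii: "p \<le> ?i" "?i + ?l = i" "?i + b + 1 = n - ?l" "p \<le> Suc ?i" using qi pq 3 by auto
    have "crossing U (n - ?l) f' ?i" "crossing U (n - ?l) g' ?i"
    proof -
      have "?i + b < n - ?l" using ii(3) by linarith
      then show "crossing U (n - ?l) f' ?i" "crossing U (n - ?l) g' ?i"
        using f(2) g(2) f'(3)[of ?i] g'(3)[of ?i] f'(3)[of "Suc ?i"] g'(3)[of "Suc ?i"] ii 3
        unfolding crossing_def by simp_all
    qed
    then have sm: "same_order (n - ?l) f' 0 g' 0"
      using determined[of "n - ?l"] f'(1) g'(1) pq qi 3 unfolding determined_def by auto
    have "window b f' 0 = window b g' 0" using same_order_window[OF sm, of 0 b] ii by simp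
    then have "window b f 0 = window b g 0" using f'(2)[of 0] g'(2)[of 0] by simp
    with eq show ?thesis unfolding same_windows_def by (metis One_nat_def less_one not_le_imp_less)
  qed
qed

lemma ambiguous_if_not_same_order:
  assumes "mem n f" "inj_on g {..<n}" "same_windows b n f g" "\<not> same_order n f 0 g 0"
  shows "\<exists>u q. u < q \<and> q < n \<and> ambiguous b n f u q"
proof -
  have fi: "inj_on f {..<n}" using assms(1) by (rule mem_inj)
  obtain x y where xy: "x < n" "y < n" "f x < f y \<longleftrightarrow> \<not> g x < g y"
    using assms(4) by (auto simp: same_order_def)
  have "x \<noteq> y" using xy by auto
  then have ne: "f x \<noteq> f y" "g x \<noteq> g y" using fi assms(2) xy by (auto simp: inj_on_def)
  have "ambiguous b n f x y"
  proof (cases "f x < f y")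
    case True
    then show ?thesis using xy ne fi assms(2,3) by (intro ambiguousI[of f _ g]) auto
  next
    case False
    then show ?thesis using xy ne fi assms(2,3) by (intro ambiguousI[of g _ f]) auto
  qed
  then show ?thesis using xy \<open>x \<noteq> y\<close> ambiguous_sym by (meson linorder_neqE_nat)
qed

lemma ambiguous_not_same_order:
  assumes "ambiguous b n f u q" "mem n f" "b \<le> n" "u < n" "q < n"
  shows "\<exists>g. mem n g \<and> same_windows b n f g \<and> \<not> same_order n f 0 g 0"
proof -
  obtain g h where gh: "inj_on g {..<n}" "inj_on h {..<n}" "same_windows b n f g" "same_windows b n f h" "g u < g q" "h q < h u"
    using assms(1) unfolding ambiguous_def by blast
  then have "mem n g" "mem n h" using assms(2,3) by (auto intro: mem_if_same_windows)
  moreover have "\<not> same_order n f 0 g 0 \<or> \<not> same_order n f 0 h 0" using gh(5,6) assms(4,5) by (fastforce simp: same_order_def)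
  ultimately show ?thesis using gh by blast
qed

lemma determined_not_ambiguous:
  assumes "determined U n" "mem n f" "crossing U n f i" "b \<le> n" "u < n" "q < n"
  shows "\<not> ambiguous b n f u q"
proof
  assume "ambiguous b n f u q"
  then obtain g where g: "mem n g" "same_windows b n f g" "\<not> same_order n f 0 g 0" using ambiguous_not_same_order assms by blast
  then have "crossing U n g i" using crossing_same_windows assms(3) by blast
  with g assms show False by (auto simp: determined_def)
qed

text \<open>
  An ambiguous comparison gives an ambiguous factor of length at most \<open>2 * b\<close>. If this factor
  and the crossing lie in a common proper factor, the induction hypothesis for the latter is
  violated. If not, they lie at opposite ends of a long sequence, and cutting out a loop between
  them gives a shorter sequence that violates the induction hypothesis.
\<close>

lemma determined_step_not_ambiguous:
  assumes determined: "\<And>m. m < n \<Longrightarrow> determined U m" and n: "num_windows + 4 * b + 3 < n"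
    and f: "mem n f" "crossing U n f i" and am: "ambiguous b n f u q" "u < q" "q < n"
  shows False
proof -
  obtain u' q' where uq: "u' + b \<le> q'" "q' \<le> q" "q' < u' + 2 * b"
    "ambiguous b (Suc (q' - u')) (\<lambda>p. f (u' + p)) 0 (q' - u')"
    using ambiguous_short_factor[OF am mem_inj[OF f(1)] _ b_pos] n by auto
  let ?D = "Suc (q' - u')"
  have qn: "q' < n" "b \<le> ?D" "?D \<le> 2 * b" using uq am b_pos by auto
  \<comment> \<open>No shorter member contains both a crossing and this ambiguous factor.\<close>
  have no: False if "mem l g" "l < n" "same_order ?D g v f u'" "v + ?D \<le> l" "crossing U l g j" for l g v j
  proof -
    have "same_windows b ?D (\<lambda>p. f (u' + p)) (\<lambda>p. g (v + p))"
      using that(3) by (intro same_order_same_windows) (simp add: same_order_sym)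
    then have "ambiguous b ?D (\<lambda>p. g (v + p)) 0 (q' - u')" using uq(4) ambiguous_same_windows by blast
    then have "ambiguous b l g (v + 0) (v + (q' - u'))"
      using that(1,4) qn(2) mem_inj by (intro ambiguous_extends) auto
    then show False using determined_not_ambiguous[OF determined[OF that(2)] that(1,5)] that(4) qn(2) by auto
  qed
  \<comment> \<open>The smallest factor that contains the crossing and the ambiguous factor is the whole
    sequence.\<close>
  define lo where "lo = min i u'"
  define hi where "hi = max (i + b + 1) (Suc q')"
  have ib: "i + b < n" using f(2) by (simp add: crossing_def)
  have lh: "lo \<le> i" "lo \<le> u'" "i + b + 1 \<le> hi" "Suc q' \<le> hi" "hi \<le> n"
    using ib qn by (auto simp: lo_def hi_def)
  have cr: "crossing U (hi - lo) (\<lambda>p. f (lo + p)) (i - lo)"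
    using f(2) lh by (auto simp: crossing_def Suc_diff_le[symmetric])
  have "\<not> hi - lo < n"
  proof
    assume "hi - lo < n"
    moreover have "mem (hi - lo) (\<lambda>p. f (lo + p))" using f(1) lh by (intro mem_shift) auto
    moreover have "u' - lo + ?D \<le> hi - lo" using lh uq(1) by auto
    ultimately show False using no[OF _ _ _ _ cr, of "u' - lo"] lh by simp
  qed
  then have hl: "lo = 0" "hi = n" using lh by auto
  consider "i = 0" "num_windows + b + 1 \<le> u'" | "u' = 0" "i + b + 1 = n"
    using hl n uq qn ib unfolding lo_def hi_def by linarith
  then show False
  proof cases
    case 1
    obtain p r where pr: "1 \<le> p" "p < r" "r \<le> 1 + num_windows" "window b f p = window b f r"
      using repeat_window[of 1 f] by auto
    let ?l = "r - p"
    have rb: "r + b \<le> n" using pr(3) 1 qn uq(1) by linarith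
    obtain f' where f': "mem (n - ?l) f'" "\<And>t. t \<le> p \<Longrightarrow> window b f' t = window b f t"
      "same_order (n - r) f' p f r"
      using cut_loop[OF f(1) pr(2) rb pr(4)] by metis
    have "crossing U (n - ?l) f' 0" using f(2) f'(2)[of 0] f'(2)[of 1] pr 1 qn uq by (auto simp: crossing_def)
    moreover have "same_order ?D f' (u' - ?l) f u'"
      using same_order_factor[OF f'(3), of "u' - r" ?D] pr 1 qn uq by (simp add: algebra_simps)
    moreover have "n - ?l < n" "u' - ?l + ?D \<le> n - ?l" using pr 1 qn uq by linarith+
    ultimately show False using no[OF f'(1)] by blast
  next
    case 2
    obtain p r where pr: "2 * b \<le> p" "p < r" "r \<le> 2 * b + num_windows" "window b f p = window b f r"
      using repeat_window[of "2 * b" f] by auto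
    let ?l = "r - p"
    have ri: "r \<le> i" using pr(3) n 2 by simp
    have rb: "r + b \<le> n" using ri ib by linarith
    obtain f' where f': "mem (n - ?l) f'" 
      "\<And>t. p \<le> t \<Longrightarrow> t + (r - p) + b \<le> n \<Longrightarrow> window b f' t = window b f (t + (r - p))"
      "same_order (p + b) f' 0 f 0"
      using cut_loop[OF f(1) pr(2) rb pr(4)] by metis
    let ?i = "i - ?l"
    have ii: "p \<le> ?i" "?i + ?l = i" "?i + b + 1 = n - ?l" "p \<le> Suc ?i" using ri pr 2 by auto
    have "crossing U (n - ?l) f' ?i"
    proof -
      have "?i + b < n - ?l" using ii(3) by linarith
      then show ?thesis using f(2) f'(2)[of ?i] f'(2)[of "Suc ?i"] ii 2 unfolding crossing_def by simp
    qed
    moreover have "same_order ?D f' 0 f u'" using same_order_mono[OF f'(3), of ?D] qn pr 2 by simp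
    moreover have "n - ?l < n" "0 + ?D \<le> n - ?l" using pr ri ib qn ii by linarith+
    ultimately show False using no[OF f'(1)] by blast
  qed
qed

text \<open>
  Short members are determined by joint embedding, longer ones by induction on the length.
\<close>

lemma determined_all:
  assumes "successor_closed U" "joint_upto R" "num_windows + 4 * b + 3 \<le> R"
  shows "determined U n"
proof (induction n rule: less_induct)
  case (less n)
  show ?case unfolding determined_def
  proof (intro allI impI)
    fix f g i assume fg: "mem n f" "mem n g" "crossing U n f i" "crossing U n g i"
    show "same_order n f 0 g 0"
    proof (cases "n \<le> R")
      case True
      then show ?thesis using crossing_in_joint[OF assms(1) fg] assms(2) fg by (simp add: joint_upto_def)
    next
      case False
      then have "same_windows b n f g" using determined_step_windows[OF less.IH _ fg(1,3) fg(2,4)] assms(3) by simp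
      then show ?thesis
        using ambiguous_if_not_same_order[OF fg(1) mem_inj[OF fg(2)]] determined_step_not_ambiguous[OF less.IH _ fg(1,3)] False assms(3)
        by fastforce
    qed
  qed
qed

text \<open>
  By induction, \<open>f\<close> without its last entry and \<open>f\<close> without its first entry embed into members
  with a crossing. If one of these crossings is not on the side of the missing entry, the whole
  of \<open>f\<close> can be glued in. Otherwise the second window of \<open>f\<close> occurs before the crossing in one
  of the two members and after the crossing in the other, so that it would lie both outside and
  inside \<open>U\<close>.
\<close>

lemma embeds_with_crossing:
  assumes "successor_closed U" "joint_upto R" "b + 3 \<le> R" "mem (b + 1) f0" "crossing U (b + 1) f0 0"
  shows "mem n f \<Longrightarrow> \<exists>l h i. mem l h \<and> embeds n f l h \<and> crossing U l h i"
proof (induction n arbitrary: f)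
  case 0
  then show ?case using assms(4,5) unfolding embeds_def same_order_def by (intro exI[of _ "b + 1"] exI[of _ f0] exI[of _ 0]) auto
next
  case (Suc n)
  show ?case
  proof (cases "Suc n \<le> R")
    case True
    then have "joint (Suc n) f (b + 1) f0" using assms(2,3,4) Suc.prems by (simp add: joint_upto_def)
    then obtain l h s where h: "mem l h" "embeds (Suc n) f l h" "s + (b + 1) \<le> l" "same_order (b + 1) f0 0 h s"
      by (auto simp: joint_def embeds_def)
    then have "crossing U l h (s + 0)" using crossing_same_order[OF h(4), of 0 U "b + 1" l] assms(5) by simp
    with h show ?thesis by blast
  next
    case False
    have "mem n f" "mem n (\<lambda>p. f (1 + p))"
      using mem_mono[OF Suc.prems, of n] mem_shift[OF Suc.prems, of 1 n] by simp_all
    then obtain l h i l' h' i' where "mem l h" "embeds n f l h" "crossing U l h i"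
      "mem l' h'" "embeds n (\<lambda>p. f (1 + p)) l' h'" "crossing U l' h' i'" using Suc.IH by metis
    then obtain s s' where h: "mem l h" "s + n \<le> l" "same_order n f 0 h s" "crossing U l h i"
      and h': "mem l' h'" "s' + n \<le> l'" "same_order n f 1 h' s'" "crossing U l' h' i'"
      unfolding embeds_def by auto
    consider "i + b < s + n" | "s' \<le> i'" | "s + n \<le> i + b" "i' < s'" by linarith
    then show ?thesis
    proof cases
      case 1
      obtain k where k: "\<forall>p<s + n. k p = h p" "mem (s + n + 1) k" "same_order (n + 1) k s f 0"
        using glue[of s n h 1 f] mem_mono[OF h(1,2)] Suc.prems h(3) False assms(3)
        by (auto simp: same_order_sym)
      have "same_order (s + n) h 0 k 0" using k(1) by (intro same_order_eqI) simp
      then have "crossing U (s + n + 1) k i"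
        using crossing_same_order[of "s + n" h 0 k 0 i U l "s + n + 1"] 1 h(4) by simp
      moreover have "embeds (Suc n) f (s + n + 1) k"
        unfolding embeds_def using k(3) by (intro exI[of _ s]) (auto simp: same_order_sym)
      ultimately show ?thesis using k(2) by blast
    next
      case 2
      have "mem (n + (l' - s' - n)) (\<lambda>p. h' (s' + p))" using h'(1,2) by (intro mem_shift) auto
      moreover have "same_order n f 1 (\<lambda>p. h' (s' + p)) 0" using h'(3) by simp
      ultimately obtain k where k: "\<forall>p<1 + n. k p = f p" "mem (1 + n + (l' - s' - n)) k"
        "same_order (n + (l' - s' - n)) k 1 (\<lambda>p. h' (s' + p)) 0"
        using glue[of 1 n f "l' - s' - n" "\<lambda>p. h' (s' + p)"] Suc.prems False assms(3) by auto
      have "n + (l' - s' - n) = l' - s'" using h'(2) by simp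
      then have "same_order (l' - s') h' s' k 1" using k(3) by (auto simp: same_order_sym)
      then have "crossing U (1 + (l' - s')) k (1 + (i' - s'))"
      proof -
        have "i' - s' + b < l' - s'" using 2 h'(4) unfolding crossing_def by linarith
        then show ?thesis
          using crossing_same_order[of "l' - s'" h' s' k 1 "i' - s'" U l' "1 + (l' - s')"] 2 h'(4)
            \<open>same_order (l' - s') h' s' k 1\<close> by simp
      qed
      moreover have "1 + n + (l' - s' - n) = 1 + (l' - s')" using h'(2) by simp
      moreover have "same_order (Suc n) f 0 k 0" using k(1) by (intro same_order_eqI) simp
      then have "embeds (Suc n) f (1 + n + (l' - s' - n)) k" unfolding embeds_def by (intro exI[of _ 0]) simp
      ultimately show ?thesis using k(2) by metis
    next
      case 3
      have "b + 2 \<le> n" using False assms(3) by simp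
      have "window b f 1 = window b h' s'" using same_order_window[OF h'(3), of 0 b] \<open>b + 2 \<le> n\<close> by simp
      moreover have "window b h' (Suc i') \<in> U" using h'(4) by (simp add: crossing_def)
      then have "window b h' s' \<in> U" using assms(1) h'(1,2) 3(2) \<open>b + 2 \<le> n\<close> unfolding successor_closed_def
        by (meson Suc_leI add_le_mono le_trans le_add1 nat_add_left_cancel_le add_leD1)
      moreover have "window b f 1 = window b h (s + 1)" using same_order_window[OF h(3), of 1 b] \<open>b + 2 \<le> n\<close> by simp
      moreover have "window b h i \<notin> U" "i + b \<le> l" "s + 1 \<le> i"
        using h(4) 3(1) \<open>b + 2 \<le> n\<close> by (auto simp: crossing_def)
      ultimately show ?thesis using assms(1) h(1) unfolding successor_closed_def by metis
    qed
  qed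
qed

text \<open>
  Glue what \<open>h\<close> has to the left of the crossing to what the longer of the two has to the right
  of it. The factor of the result with the extent of \<open>h\<close>, or of \<open>h'\<close>, around the crossing is
  order isomorphic to it because members are determined by their crossing.
\<close>

lemma joint_of_crossings:
  assumes determined: "\<And>n. determined U n" and "mem l h" "crossing U l h i" "mem l' h'" "crossing U l' h' i'" "i' \<le> i"
  shows "joint l h l' h'"
proof -
  have ib: "i + b + 1 \<le> l" "i' + b + 1 \<le> l'" using assms by (auto simp: crossing_def)
  have embI: "embeds m g n k" if "mem m g" "mem n k" "crossing U m g j" "crossing U n k (v + j)" "v + m \<le> n" for m g n k j v
  proof -
    have "mem m (\<lambda>p. k (v + p))" using that by (intro mem_shift)
    moreover have "crossing U m (\<lambda>p. k (v + p)) j" using that(3,4) by (auto simp: crossing_def)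
    ultimately have "same_order m g 0 (\<lambda>p. k (v + p)) 0" using determined that(1,3) unfolding determined_def by blast
    then show ?thesis using that(5) unfolding embeds_def by auto
  qed
  show ?thesis
  proof (cases "l' - i' \<le> l - i")
    case True
    have "embeds l' h' l h" by (rule embI[OF assms(4,2,5), of "i - i'"]) (use assms(3,6) True ib in auto)
    then show ?thesis using assms(2) embeds_refl unfolding joint_def by blast
  next
    case False
    let ?e = "l' - i' - (b + 1)"
    have m1: "mem (i + (b + 1)) h" using assms(2) ib by (auto intro: mem_mono)
    have m2: "mem (b + 1 + ?e) (\<lambda>p. h' (i' + p))" using assms(4) ib by (intro mem_shift) auto
    have "same_order (b + 1) (\<lambda>p. h (i + p)) 0 (\<lambda>p. h' (i' + p)) 0"
    proof -
      have "mem (b + 1) (\<lambda>p. h (i + p))" "mem (b + 1) (\<lambda>p. h' (i' + p))"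
        using assms ib by (auto intro!: mem_shift)
      moreover have "crossing U (b + 1) (\<lambda>p. h (i + p)) 0" "crossing U (b + 1) (\<lambda>p. h' (i' + p)) 0"
        using assms(3,5) by (auto simp: crossing_def)
      ultimately show ?thesis using determined unfolding determined_def by blast
    qed
    then obtain k where k: "\<forall>p<i + (b + 1). k p = h p" "mem (i + (b + 1) + ?e) k"
      using glue[OF m1 m2] by (auto simp: same_order_sym)
    have len: "i + (b + 1) + ?e = i + (l' - i')" using ib by simp
    have cr: "crossing U (i + (l' - i')) k i"
    proof -
      have "same_order (i + (b + 1)) h 0 k 0" using k(1) by (intro same_order_eqI) simp
      then show ?thesis using crossing_same_order[of "i + (b + 1)" h 0 k 0 i U l "i + (l' - i')"] assms(3) ib by simp
    qed
    have mk: "mem (i + (l' - i')) k" using k(2) unfolding len .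
    have "embeds l h (i + (l' - i')) k" by (rule embI[OF assms(2) mk assms(3), of 0]) (use cr False in auto)
    moreover have "embeds l' h' (i + (l' - i')) k"
      by (rule embI[OF assms(4) mk assms(5), of "i - i'"]) (use cr assms(6) ib in auto)
    ultimately show ?thesis using mk unfolding joint_def by blast
  qed
qed

definition reach :: "(nat \<times> nat) set \<Rightarrow> (nat \<times> nat) set \<Rightarrow> bool" where
  "reach A A' \<longleftrightarrow> (\<exists>n f i j. mem n f \<and> i \<le> j \<and> j + b \<le> n \<and> window b f i = A \<and> window b f j = A')"

lemma successor_closed_reach: "successor_closed {A'. reach A A'}"
  unfolding successor_closed_def
proof (intro allI impI, elim CollectE, intro CollectI)
  fix n f i j assume f: "mem n f" "i \<le> j" "j + b \<le> n" "reach A (window b f i)"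
  then obtain n' f' i' j' where f': "mem n' f'" "i' \<le> j'" "j' + b \<le> n'" "window b f' i' = A"
    "window b f' j' = window b f i" by (auto simp: reach_def)
  obtain h where h: "\<forall>p<j' + b. h p = f' p" "mem (j' + (n - i)) h" "same_order (n - i) h j' f i"
    using splice[OF f'(1,3) f(1) _ f'(5)] f(2,3) by auto
  have "window b h i' = A" using h(1) f'(2) unfolding f'(4)[symmetric] by (intro window_cong) simp
  moreover have "window b h (j' + (j - i)) = window b f j"
    using same_order_window[OF h(3), of "j - i" b] f(2,3) by simp
  moreover have "i' \<le> j' + (j - i)" "j' + (j - i) + b \<le> j' + (n - i)" using f'(2) f(2,3) by auto
  ultimately show "reach A (window b f j)" unfolding reach_def using h(2) by blast
qed

text \<open>
  If the last window of \<open>f\<close> reaches the first window of \<open>g\<close>, a connecting path joins \<open>f\<close> to \<open>g\<close>.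
  If not, the windows reachable from the former are a successor closed set \<open>U\<close> that misses the
  latter. A common extension of these two windows then contains them in the opposite order and
  hence contains a crossing into \<open>U\<close>. The bound \<open>R\<close> leaves room for the short configurations to
  which the lemmas on crossings reduce.
\<close>

theorem joint_embedding_if_upto:
  assumes R: "joint_upto R" "num_windows + 4 * b + 3 \<le> R" and fg: "mem n f" "mem m g"
  shows "joint n f m g"
proof (cases "\<exists>v. mem b v")
  case False
  then have "n < b" "m < b" using fg mem_mono by (meson not_le_imp_less)+
  with R fg show ?thesis unfolding joint_upto_def by simp
next
  case True
  then obtain v where v: "mem b v" by blast
  have long: "\<exists>l h. b \<le> l \<and> mem l h \<and> embeds n f l h" if "mem n f" for n f
  proof (cases "b \<le> n")
    case True
    then show ?thesis using that embeds_refl by blast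
  next
    case False
    then have "joint n f b v" using R v that by (simp add: joint_upto_def)
    then obtain l h s where "mem l h" "embeds n f l h" "s + b \<le> l" unfolding joint_def embeds_def by blast
    then show ?thesis by (meson add_leD2)
  qed
  obtain n' f' m' g' where n': "b \<le> n'" "mem n' f'" "embeds n f n' f'"
    and m': "b \<le> m'" "mem m' g'" "embeds m g m' g'" using long fg by meson
  have "joint n' f' m' g'"
  proof (cases "reach (window b f' (n' - b)) (window b g' 0)")
    case True
    then obtain l k i j where k: "mem l k" "i \<le> j" "j + b \<le> l" "window b k i = window b f' (n' - b)"
      "window b k j = window b g' 0" by (auto simp: reach_def)
    obtain h where h: "\<forall>p<n' - b + b. h p = f' p" "mem (n' - b + (l - i)) h" "same_order (l - i) h (n' - b) k i"
      using splice[OF n'(2) _ k(1) _ k(4)[symmetric]] n'(1) k(2,3) by auto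
    let ?j = "n' - b + (j - i)"
    have jb: "?j + b \<le> n' - b + (l - i)" using k(2,3) by simp
    have "window b h ?j = window b g' 0" using same_order_window[OF h(3), of "j - i" b] k by simp
    then obtain h' where h': "\<forall>p<?j + b. h' p = h p" "mem (?j + m') h'" "same_order m' h' ?j g' 0"
      using splice[OF h(2) jb m'(2), of 0] m'(1) by auto
    have "same_order n' f' 0 h' 0" using h(1) h'(1) n'(1) by (intro same_order_eqI) simp
    then have "embeds n' f' (?j + m') h'" unfolding embeds_def using n'(1) m'(1) by (intro exI[of _ 0]) simp
    moreover have "embeds m' g' (?j + m') h'" unfolding embeds_def using h'(3) by (intro exI[of _ ?j]) (simp add: same_order_sym)
    ultimately show ?thesis using h'(2) unfolding joint_def by blast
  next
    case False
    define U where "U = {A'. reach (window b f' (n' - b)) A'}"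
    have U: "successor_closed U" unfolding U_def by (rule successor_closed_reach)
    have "reach (window b f' (n' - b)) (window b f' (n' - b))"
      unfolding reach_def using n' by (intro exI[of _ n'] exI[of _ f'] exI[of _ "n' - b"]) simp
    then have inU: "window b f' (n' - b) \<in> U" "window b g' 0 \<notin> U" using False by (auto simp: U_def)
    have "mem b (\<lambda>p. f' (n' - b + p))" "mem b g'"
      using mem_shift[OF n'(2), of "n' - b" b] mem_mono[OF m'(2,1)] n'(1) by simp_all
    then have "joint b (\<lambda>p. f' (n' - b + p)) b g'" using R by (simp add: joint_upto_def)
    then obtain l h s t where h: "mem l h" "s + b \<le> l" "same_order b f' (n' - b) h s" "t + b \<le> l" "same_order b g' 0 h t"
      unfolding joint_def embeds_def by auto
    have w: "window b h s \<in> U" "window b h t \<notin> U" using inU h(3,5) by (simp_all add: window_eq_iff[symmetric])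
    have "t < s" using U h w unfolding successor_closed_def by (meson not_le_imp_less)
    then obtain i where i: "t \<le> i" "i < s" "window b h i \<notin> U" "window b h (Suc i) \<in> U"
      using w
    proof (induction "s - t" arbitrary: t thesis)
      case (Suc x)
      show ?case
      proof (cases "window b h (Suc t) \<in> U")
        case True then show ?thesis using Suc.prems by blast
      next
        case False
        then have "Suc t < s" using Suc.prems(2,3) by (metis Suc_lessI)
        then show ?thesis using Suc.hyps(1)[of "Suc t"] Suc.hyps(2) Suc.prems False
          by (metis Suc_diff_Suc Suc_leD diff_Suc_Suc nat.inject)
      qed
    qed simp
    have f0: "mem (b + 1) (\<lambda>p. h (i + p))" using h(1,2) i(2) by (intro mem_shift) auto
    have c0: "crossing U (b + 1) (\<lambda>p. h (i + p)) 0" using i by (simp add: crossing_def)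
    have R': "b + 3 \<le> R" using R(2) by simp
    obtain l1 h1 i1 where 1: "mem l1 h1" "embeds n' f' l1 h1" "crossing U l1 h1 i1"
      using embeds_with_crossing[OF U R(1) R' f0 c0 n'(2)] by blast
    obtain l2 h2 i2 where 2: "mem l2 h2" "embeds m' g' l2 h2" "crossing U l2 h2 i2"
      using embeds_with_crossing[OF U R(1) R' f0 c0 m'(2)] by blast
    have determined: "determined U n" for n using determined_all[OF U R] .
    have "joint l1 h1 l2 h2"
      using joint_of_crossings[OF determined 1(1,3) 2(1,3)] joint_of_crossings[OF determined 2(1,3) 1(1,3)] joint_sym
      by (meson nat_le_linear)
    then show ?thesis using joint_mono 1(2) 2(2) by blast
  qed
  then show ?thesis using joint_mono n'(3) m'(3) by blast
qed

text \<open>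
  If a common extension is very long, then an entry at one end belongs to neither copy, or there
  is a gap between the copies in which a loop can be cut out.
\<close>

lemma joint_shrink:
  assumes h: "mem l h" "s + n \<le> l" "same_order n f 0 h s" "t + m \<le> l" "same_order m g 0 h t" "s \<le> t"
    and l: "n + m + num_windows + b < l"
  shows "\<exists>l'<l. joint_in l' n f m g"
proof -
  have trim: "joint_in l' n f m g" if "x \<le> s" "s + n \<le> x + l'" "t + m \<le> x + l'" "x + l' \<le> l" for x l'
  proof -
    have "same_order n f 0 (\<lambda>p. h (x + p)) (s - x)" "same_order m g 0 (\<lambda>p. h (x + p)) (t - x)"
      using h(3,5,6) that(1) by simp_all
    moreover have "s - x + n \<le> l'" "t - x + m \<le> l'" using that h(6) by auto
    ultimately have "embeds n f l' (\<lambda>p. h (x + p))" "embeds m g l' (\<lambda>p. h (x + p))"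
      unfolding embeds_def by blast+
    then show ?thesis using mem_shift[OF h(1) that(4)] unfolding joint_in_def by blast
  qed
  consider "0 < s" | "s = 0" "t + m < l" | "s = 0" "t + m = l" using h(4) by linarith
  then show ?thesis
  proof cases
    case 1
    then show ?thesis using trim[of s "l - s"] h(2,4) by (intro exI[of _ "l - s"]) auto
  next
    case 2
    then show ?thesis using trim[of 0 "l - 1"] h(2) l by (intro exI[of _ "l - 1"]) auto
  next
    case 3
    obtain p q where pq: "n \<le> p" "p < q" "q \<le> n + num_windows" "window b h p = window b h q"
      using repeat_window[of n h] by auto
    have qb: "q + b \<le> t" using pq(3) l 3 by simp
    have qb': "q + b \<le> l" using qb h(4) by simp
    obtain k where k: "mem (l - (q - p)) k" "same_order (p + b) k 0 h 0" "same_order (l - q) k p h q"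
      using cut_loop[OF h(1) pq(2) qb' pq(4)] by metis
    have "same_order n f 0 k 0" using h(3) 3 same_order_mono[OF k(2), of n] pq(1)
      by (auto intro: same_order_trans same_order_sym)
    then have e1: "embeds n f (l - (q - p)) k" unfolding embeds_def using pq qb h(4) by (intro exI[of _ 0]) auto
    have "same_order m k (p + (t - q)) h t" using same_order_factor[OF k(3), of "t - q" m] qb h(4) by simp
    then have "same_order m g 0 k (p + (t - q))" using h(5) by (blast intro: same_order_trans same_order_sym)
    then have e2: "embeds m g (l - (q - p)) k" unfolding embeds_def using pq qb h(4) by (intro exI[of _ "p + (t - q)"]) auto
    from e1 e2 k(1) have "joint_in (l - (q - p)) n f m g" unfolding joint_in_def by blast
    then show ?thesis using pq qb h(4) by (intro exI[of _ "l - (q - p)"]) auto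
  qed
qed

lemma joint_bounded:
  assumes "joint n f m g"
  shows "\<exists>l\<le>n + m + num_windows + b. joint_in l n f m g"
proof -
  have "\<exists>l. joint_in l n f m g" using assms by (auto simp: joint_def joint_in_def)
  then obtain l where l: "joint_in l n f m g" "\<And>l'. l' < l \<Longrightarrow> \<not> joint_in l' n f m g"
    using LeastI_ex[of "\<lambda>l. joint_in l n f m g"] not_less_Least by meson
  have sym: "joint_in l n f m g \<longleftrightarrow> joint_in l m g n f" for l by (auto simp: joint_in_def)
  obtain h s t where h: "mem l h" "s + n \<le> l" "same_order n f 0 h s" "t + m \<le> l" "same_order m g 0 h t"
    using l(1) by (auto simp: joint_in_def embeds_def)
  have "\<not> n + m + num_windows + b < l"
  proof
    assume a: "n + m + num_windows + b < l"
    show False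
    proof (cases "s \<le> t")
      case True
      then show False using joint_shrink[OF h True a] l(2) by blast
    next
      case False
      then have "t \<le> s" "m + n + num_windows + b < l" using a by auto
      then show False using joint_shrink[OF h(1,4,5,2,3)] l(2) sym by blast
    qed
  qed
  with l(1) show ?thesis by (meson not_le_imp_less)
qed

end

section \<open>Antichains along periodic paths\<close>

definition bad_seq :: "(nat \<Rightarrow> nat) \<Rightarrow> (nat \<Rightarrow> nat \<Rightarrow> real) \<Rightarrow> bool" where
  "bad_seq n f \<longleftrightarrow> (\<forall>i j. i < j \<longrightarrow> \<not> embeds (n i) (f i) (n j) (f j))"

lemma follows_disagree:
  assumes "follows b \<pi> m f a" "follows b \<pi> m g a" "x < m" "y < m" "\<not> (f x < f y \<longleftrightarrow> g x < g y)"
  shows "(f x < f y \<and> g y < g x) \<or> (g x < g y \<and> f y < f x)" "x \<noteq> y"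
proof -
  show "x \<noteq> y" using assms(5) by auto
  then have "f x \<noteq> f y" "g x \<noteq> g y" using assms(1-4) by (auto simp: follows_def inj_on_def)
  then show "(f x < f y \<and> g y < g x) \<or> (g x < g y \<and> f y < f x)" using assms(5) by linarith
qed

lemma realizable_shift: "(\<And>m. \<exists>F. follows b \<pi> m F 0) \<Longrightarrow> \<exists>F. follows b \<pi> m F a"
  using follows_shift[of b \<pi> "a + m" _ 0 a m] by (metis add_0 order_refl)

text \<open>
  Let \<open>D\<close> be the least distance of an ambiguous comparison on the path. All comparisons at
  smaller distances are determined. Let \<open>S\<close> be the set of those positions \<open>t\<close> at which the path
  repeats its first stretch of length \<open>D + 1\<close>. A realization can be chosen such that the
  comparison of \<open>t\<close> and \<open>t + D\<close> has one outcome at \<open>t = 0\<close> and \<open>t = i * k\<close> and the other outcome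
  at all elements of \<open>S\<close> between them. For different \<open>i\<close>, these realizations do not embed into
  each other: the two exceptional places would have to be matched.
\<close>

lemma ambiguous_periodic_path:
  assumes b: "1 \<le> b" and k: "1 \<le> k" and periodic: "\<And>t. \<pi> (t + k) = \<pi> t"
    and real: "\<And>m. \<exists>F. follows b \<pi> m F 0"
    and fg: "b \<le> m" "follows b \<pi> m f a" "follows b \<pi> m g a" "x < m" "y < m" "\<not> (f x < f y \<longleftrightarrow> g x < g y)"
  shows "\<exists>a n z. strict_mono n \<and> (\<forall>i. b \<le> n i \<and> follows b \<pi> (n i) (z i) a) \<and> bad_seq n z"
proof -
  have real': "\<exists>F. follows b \<pi> m F a" for m a using realizable_shift[OF real] .
  define A where "A D \<longleftrightarrow> (\<exists>a m f g. b \<le> m \<and> D < m \<and> follows b \<pi> m f a \<and> follows b \<pi> m g a \<and> f 0 < f D \<and> g D < g 0)" for D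
  have A1: "A (y - x)" if "b \<le> m" "follows b \<pi> m f a" "follows b \<pi> m g a" "x < y" "y < m" "f x < f y" "g y < g x" for m f g a x y
  proof -
    note * = that
    obtain f' where f': "follows b \<pi> (m + b) f' a" "\<forall>p<m. f' p = f p"
      using follows_extend_to[OF b *(1) real' *(2), of "m + b"] by auto
    obtain g' where g': "follows b \<pi> (m + b) g' a" "\<forall>p<m. g' p = g p"
      using follows_extend_to[OF b *(1) real' *(3), of "m + b"] by auto
    have "follows b \<pi> (m + b - x) (\<lambda>p. f' (x + p)) (a + x)" "follows b \<pi> (m + b - x) (\<lambda>p. g' (x + p)) (a + x)"
      using f'(1) g'(1) that(4,5) by (auto intro: follows_shift)
    moreover have "b \<le> m + b - x" "y - x < m + b - x" using that by auto
    moreover have "f' (x + 0) < f' (x + (y - x))" "g' (x + (y - x)) < g' (x + 0)"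
      using f'(2) g'(2) that by auto
    ultimately show ?thesis unfolding A_def by blast
  qed
  have A2: "A (if x < y then y - x else x - y)"
    if "b \<le> m" "follows b \<pi> m f a" "follows b \<pi> m g a" "x < m" "y < m" "\<not> (f x < f y \<longleftrightarrow> g x < g y)" for m f g a x y
  proof -
    have d: "(f x < f y \<and> g y < g x) \<or> (g x < g y \<and> f y < f x)" "x \<noteq> y"
      using follows_disagree[OF that(2-6)] by blast+
    show ?thesis
    proof (cases "x < y")
      case True
      then show ?thesis using d(1) A1[OF that(1-3) True that(5)] A1[OF that(1,3,2) True that(5)] by auto
    next
      case False
      then have "y < x" using d(2) by simp
      then show ?thesis using d(1) A1[OF that(1-3) _ that(4)] A1[OF that(1,3,2) _ that(4)] False by auto
    qed
  qed
  define D where "D = (LEAST D. A D)"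
  have "\<exists>D. A D" using A2[OF fg] by blast
  then have AD: "A D" unfolding D_def by (rule LeastI_ex)
  have agree: "f x < f y \<longleftrightarrow> g x < g y"
    if "b \<le> m" "follows b \<pi> m f a" "follows b \<pi> m g a" "x < m" "y < m" "x < y + D" "y < x + D" for m f g a x y
  proof (rule ccontr)
    assume "\<not> ?thesis"
    from A2[OF that(1-5) this] have "D \<le> (if x < y then y - x else x - y)" unfolding D_def by (rule Least_le)
    then show False using that(6,7) by (auto split: if_splits)
  qed
  obtain a m f g where fg: "b \<le> m" "D < m" "follows b \<pi> m f a" "follows b \<pi> m g a" "f 0 < f D" "g D < g 0"
    using AD unfolding A_def by blast
  have Db: "b \<le> D"
  proof (rule ccontr)
    assume "\<not> b \<le> D"
    then have "near b 0 D" by (simp add: near_def)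
    then show False using same_windows_near[OF fg(1) follows_same_windows[OF fg(3,4)], of 0 D] fg by simp
  qed
  have f: "follows b \<pi> (D + 1) f a" and g: "follows b \<pi> (D + 1) g a" using fg by (auto intro: follows_mono)
  define S where "S = {t. \<forall>x. x + b \<le> D + 1 \<longrightarrow> \<pi> (a + t + x) = \<pi> (a + x)}"
  have per': "\<pi> (t + i * k) = \<pi> t" for t i
  proof (induction i)
    case (Suc i)
    then show ?case using periodic[of "t + i * k"] by (simp add: algebra_simps)
  qed simp
  have kS: "i * k \<in> S" for i
    unfolding S_def using per'[of "a + x" i for x] by (simp add: algebra_simps)
  have fol_S: "follows b \<pi> l h (a + t)" if "follows b \<pi> l h a" "t \<in> S" "l \<le> D + 1" for l h t
    using that unfolding follows_def S_def by auto
  \<comment> \<open>The reversed outcome at \<open>0\<close>, and from then on insertion at the highest place: if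
    \<open>t \<in> S\<close>, then every entry above which \<open>t + D\<close> may not be placed lies above the entry
    at \<open>t\<close> as well.\<close>
  have H: "\<exists>H. follows b \<pi> (D + 1 + L) H a \<and> H D < H 0 \<and> (\<forall>t\<in>S. 1 \<le> t \<longrightarrow> t \<le> L \<longrightarrow> H t < H (t + D))" for L
  proof (induction L)
    case 0
    then show ?case using g fg(6) by (intro exI[of _ g]) simp
  next
    case (Suc L)
    then obtain H where H: "follows b \<pi> (D + 1 + L) H a" "H D < H 0"
      "\<And>t. t \<in> S \<Longrightarrow> 1 \<le> t \<Longrightarrow> t \<le> L \<Longrightarrow> H t < H (t + D)" by blast
    let ?m = "D + 1 + L"
    obtain F where F: "follows b \<pi> (Suc ?m) F a" using real' by blast
    obtain h where h: "\<forall>p<?m. h p = H p" "follows b \<pi> (Suc ?m) h a"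
      "\<forall>p<?m. (\<forall>r. ?m < r + b \<longrightarrow> r < ?m \<longrightarrow> F ?m < F r \<longrightarrow> H p < H r) \<longrightarrow> H p < h ?m"
      using follows_extend[OF b _ H(1) F] Db by auto
    have new: "h t < h (t + D)" if t: "t \<in> S" "t = Suc L" for t
    proof -
      have m: "?m = t + D" using t by simp
      have "H t < H r" if r: "?m < r + b" "r < ?m" "F ?m < F r" for r
      proof -
        define r' where "r' = r - t"
        have r': "r = t + r'" "r' < D" "D < r' + b" using r m Db by (auto simp: r'_def)
        have "follows b \<pi> (D + 1) (\<lambda>p. F (t + p)) (a + t)" using F m by (intro follows_shift) auto
        then have "same_windows b (D + 1) (\<lambda>p. F (t + p)) f" using fol_S[OF f t(1)] follows_same_windows by blast
        then have "F (t + D) < F (t + r') \<longleftrightarrow> f D < f r'"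
          using same_windows_near[of b "D + 1" "\<lambda>p. F (t + p)" f D r'] Db r' by (simp add: near_def)
        then have "f 0 < f r'" using r(3) unfolding m r'(1) using fg(5) by simp
        moreover have "follows b \<pi> D (\<lambda>p. H (t + p)) (a + t)" using H(1) m by (intro follows_shift) auto
        moreover have "follows b \<pi> D f (a + t)" using fol_S[OF follows_mono[OF f] t(1)] by simp
        ultimately have "H (t + 0) < H (t + r')"
          using agree[OF Db, of f "a + t" "\<lambda>p. H (t + p)" 0 r'] r'(2) by simp
        then show ?thesis using r'(1) by simp
      qed
      then have "H t < h ?m" using h(3) m Db b by auto
      moreover have "h t = H t" using h(1) m Db b by auto
      ultimately show ?thesis unfolding m by simp
    qed
    have "h t < h (t + D)" if t: "t \<in> S" "1 \<le> t" "t \<le> Suc L" for t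
    proof (cases "t = Suc L")
      case False
      then have "t \<le> L" using t by simp
      then show ?thesis using H(3)[OF t(1,2)] h(1) by simp
    qed (use new t in blast)
    moreover have "h D < h 0" using h(1) H(2) by simp
    ultimately show ?case using h(2) by (intro exI[of _ h]) simp
  qed
  \<comment> \<open>The last entry is taken from \<open>g\<close>, which has the reversed outcome once more.\<close>
  have Z: "\<exists>z. follows b \<pi> (i * k + D + 1) z a \<and> z D < z 0 \<and> z (i * k + D) < z (i * k) \<and>
    (\<forall>t\<in>S. 0 < t \<longrightarrow> t < i * k \<longrightarrow> z t < z (t + D))" if i: "1 \<le> i" for i
  proof -
    have ik: "1 \<le> i * k" using i k by (metis mult_le_mono nat_mult_1)
    obtain H where H: "follows b \<pi> (D + 1 + (i * k - 1)) H a" "H D < H 0"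
      "\<And>t. t \<in> S \<Longrightarrow> 1 \<le> t \<Longrightarrow> t \<le> i * k - 1 \<Longrightarrow> H t < H (t + D)" using H by blast
    have len: "D + 1 + (i * k - 1) = i * k + D" using ik by simp
    have H1: "follows b \<pi> (i * k + D) H a" using H(1) unfolding len .
    have "follows b \<pi> D (\<lambda>p. H (i * k + p)) (a + i * k)" using H1 by (intro follows_shift) auto
    moreover have "follows b \<pi> D g (a + i * k)" using fol_S[OF follows_mono[OF g] kS] by simp
    ultimately have "H (i * k + x) < H (i * k + y) \<longleftrightarrow> g x < g y" if "x < D" "y < D" for x y
      using agree[OF Db, of "\<lambda>p. H (i * k + p)" "a + i * k" g x y] that by simp
    then have "same_order D (\<lambda>p. H (i * k + p)) 0 g 0" unfolding same_order_def by simp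
    then have "same_order D H (i * k) g 0" by simp
    then obtain z where z: "\<forall>p<i * k + D. z p = H p" "inj_on z {..<i * k + D + 1}" "same_order (D + 1) z (i * k) g 0"
      using amalgamation[of H "i * k" D g 1] follows_inj[OF H1] follows_inj[OF g] by auto
    have "window b z t = \<pi> (a + t)" if t: "t + b \<le> i * k + D + 1" for t
    proof (cases "t + b \<le> i * k + D")
      case True
      then have "window b z t = window b H t" using z(1) by (intro window_cong) simp
      then show ?thesis using True follows_window[OF H1] by simp
    next
      case False
      define t' where "t' = D + 1 - b"
      have t': "t = i * k + t'" "t' + b \<le> D + 1" using False t Db by (auto simp: t'_def)
      then have "window b z t = window b g t'" using same_order_window[OF z(3), of t' b] by simp
      then show ?thesis using follows_window[OF g t'(2)] per'[of "a + t'" i] t'(1) by (simp add: algebra_simps)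
    qed
    then have "follows b \<pi> (i * k + D + 1) z a" using z(2) by (simp add: follows_def)
    moreover have "z D < z 0" using z(1) H(2) ik Db b by auto
    moreover have "z (i * k + D) < z (i * k)" using same_orderD[OF z(3), of D 0] fg(6) by simp
    moreover have "z t < z (t + D)" if "t \<in> S" "0 < t" "t < i * k" for t
      using H(3)[of t] z(1) that by simp
    ultimately show ?thesis by blast
  qed
  then have "\<forall>i. \<exists>z. follows b \<pi> (Suc i * k + D + 1) z a \<and> z D < z 0 \<and> z (Suc i * k + D) < z (Suc i * k) \<and>
    (\<forall>t\<in>S. 0 < t \<longrightarrow> t < Suc i * k \<longrightarrow> z t < z (t + D))" by (metis One_nat_def Suc_le_mono le0)
  then obtain z where z: "\<And>i. follows b \<pi> (Suc i * k + D + 1) (z i) a" "\<And>i. z i D < z i 0"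
    "\<And>i. z i (Suc i * k + D) < z i (Suc i * k)"
    "\<And>i t. t \<in> S \<Longrightarrow> 0 < t \<Longrightarrow> t < Suc i * k \<Longrightarrow> z i t < z i (t + D)" by metis
  define n where "n i = Suc i * k + D + 1" for i
  have "\<not> embeds (n i) (z i) (n j) (z j)" if ij: "i < j" for i j
  proof
    assume "embeds (n i) (z i) (n j) (z j)"
    then obtain s where s: "s + n i \<le> n j" "same_order (n i) (z i) 0 (z j) s" by (auto simp: embeds_def)
    have lt: "Suc i * k < Suc j * k" using ij k by simp
    have sl: "s + Suc i * k \<le> Suc j * k" using s(1) by (simp add: n_def)
    have sS: "s \<in> S"
      unfolding S_def
    proof (intro CollectI allI impI)
      fix x assume x: "x + b \<le> D + 1"
      then have "window b (z i) (0 + x) = window b (z j) (s + x)"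
        by (intro same_order_window[OF s(2)]) (simp add: n_def)
      moreover have "window b (z i) x = \<pi> (a + x)" using follows_window[OF z(1)] x by simp
      moreover have "window b (z j) (s + x) = \<pi> (a + (s + x))"
        using x s(1) by (intro follows_window[OF z(1)]) (simp add: n_def)
      ultimately show "\<pi> (a + s + x) = \<pi> (a + x)" by (simp add: add.assoc)
    qed
    have "z j (s + D) < z j (s + 0)" using same_orderD[OF s(2), of D 0] z(2)[of i] by (simp add: n_def)
    moreover have "s < Suc j * k" using sl k by (cases k) auto
    ultimately have "s = 0" using z(4)[OF sS, of j] by fastforce
    then have "z j (Suc i * k + D) < z j (Suc i * k)"
      using same_orderD[OF s(2), of "Suc i * k + D" "Suc i * k"] z(3)[of i] by (simp add: n_def)
    moreover have "z j (Suc i * k) < z j (Suc i * k + D)"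
      using z(4)[OF kS, of "Suc i" j] lt k by simp
    ultimately show False by simp
  qed
  moreover have "strict_mono n" using k by (intro strict_monoI) (simp add: n_def)
  moreover have "b \<le> n i \<and> follows b \<pi> (n i) (z i) a" for i using z(1) Db by (simp add: n_def)
  ultimately show ?thesis unfolding bad_seq_def by blast
qed

section \<open>Antichains along eventually periodic paths\<close>

text \<open>
  The upward closed set consists of all positions whose entries are forced to lie above that at
  \<open>x\<close>.
\<close>

lemma raise_above:
  assumes "inj_on G {..<m}"
  shows "\<exists>h. inj_on h {..<m} \<and> same_windows b m G h \<and> (\<forall>p<m. \<forall>r<m. h p < h r \<longleftrightarrow>
    ((x, p) \<notin> (window_less b m G)\<^sup>* \<and> (x, r) \<in> (window_less b m G)\<^sup>*) \<or>
    (((x, p) \<in> (window_less b m G)\<^sup>* \<longleftrightarrow> (x, r) \<in> (window_less b m G)\<^sup>*) \<and> G p < G r))"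
proof -
  have "w' \<in> {w. (x, w) \<in> (window_less b m G)\<^sup>*}" if "(w, w') \<in> window_less b m G" "w \<in> {w. (x, w) \<in> (window_less b m G)\<^sup>*}" for w w'
    using that by (auto intro: rtrancl.rtrancl_into_rtrancl)
  from shift_up[OF assms this] show ?thesis by simp
qed

text \<open>
  A step inside a window moves by less than \<open>b\<close> positions and so cannot jump over \<open>{T..<T + b}\<close>.
\<close>

lemma window_less_star_passes:
  assumes "(x, y) \<in> (window_less b m G)\<^sup>*" "x < T" "T \<le> y"
  shows "\<exists>e. T \<le> e \<and> e < T + b \<and> (x, e) \<in> (window_less b m G)\<^sup>* \<and> (e, y) \<in> (window_less b m G)\<^sup>*"
  using assms(1,3)
proof (induction rule: rtrancl_induct)
  case base
  then show ?case using assms(2) by simp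
next
  case (step y z)
  show ?case
  proof (cases "T \<le> y")
    case True
    then show ?thesis using step by (meson rtrancl.rtrancl_into_rtrancl)
  next
    case False
    then have "z < T + b" using step.hyps(2) by (auto simp: window_less_def near_def)
    then show ?thesis using step by (meson rtrancl.rtrancl_into_rtrancl rtrancl.rtrancl_refl)
  qed
qed

text \<open>
  Move from \<open>p\<close> to \<open>q\<close> through increasing values. Each step from a value to the next one changes
  the position by at most \<open>b\<close>.
\<close>

lemma position_distance:
  fixes F :: "nat \<Rightarrow> real"
  assumes fin: "finite S" and adj: "\<And>p q. p \<in> S \<Longrightarrow> q \<in> S \<Longrightarrow> F p < F q \<Longrightarrow>
      (\<And>y. y \<in> S \<Longrightarrow> \<not> (F p < F y \<and> F y < F q)) \<Longrightarrow> p \<le> q + b"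
    and "p \<in> S" "q \<in> S" "F p < F q"
  shows "p \<le> q + b * card {y \<in> S. F p \<le> F y \<and> F y < F q}"
  using assms(3-5)
proof (induction "card {y \<in> S. F p \<le> F y \<and> F y < F q}" arbitrary: p q rule: less_induct)
  case less
  let ?I = "\<lambda>p q. {y \<in> S. F p \<le> F y \<and> F y < F q}"
  have finI: "finite (?I p q)" for p q using fin by simp
  show ?case
  proof (cases "\<exists>y\<in>S. F p < F y \<and> F y < F q")
    case True
    then obtain y where y: "y \<in> S" "F p < F y" "F y < F q" by blast
    have un: "?I p q = ?I p y \<union> ?I y q" using y by auto
    have c: "card (?I p q) = card (?I p y) + card (?I y q)"
      unfolding un by (rule card_Un_disjoint) (use finI in auto)
    have "p \<in> ?I p y" "y \<in> ?I y q" using less.prems y by auto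
    then have "0 < card (?I p y)" "0 < card (?I y q)" using finI by (auto simp: card_gt_0_iff)
    then have "p \<le> y + b * card (?I p y)" "y \<le> q + b * card (?I y q)"
      using less.hyps[of p y] less.hyps[of y q] less.prems y c by auto
    then show ?thesis unfolding c by (simp add: distrib_left)
  next
    case False
    then have "p \<le> q + b" using adj less.prems by blast
    moreover have "p \<in> ?I p q" using less.prems by auto
    then have "1 \<le> card (?I p q)" using finI by (auto simp: Suc_le_eq card_gt_0_iff)
    then have "b \<le> b * card (?I p q)" by simp
    ultimately show ?thesis by linarith
  qed
qed

text \<open>
  The path is periodic from \<open>T\<close> on, but not from \<open>T - 1\<close> on, and comparisons of positions
  \<open>\<ge> T\<close> are determined. This gives a linear order \<open>R\<close> on these positions, which is invariant
  under shifts by \<open>k\<close>. By assumption the positions \<open>q\<close>, \<open>q + k\<close>, \<open>q + 2 * k\<close>, \<dots> increase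
  in this order.

  The interval of \<open>R\<close> between \<open>q + j * k\<close> and \<open>q + (j + 1) * k\<close> contains at most one position of
  each residue class modulo \<open>k\<close>, and value-neighbours are near. All its positions are thus
  within distance \<open>b * k\<close> of \<open>q + j * k\<close>, and so none of them lies in \<open>{T..<T + b}\<close>. A forced
  comparison between \<open>0\<close> and some \<open>q + j * k\<close> would have to pass through \<open>{T..<T + b}\<close>; as the
  comparison of \<open>0\<close> with \<open>q\<close> is ambiguous, it follows that the comparison of \<open>0\<close> with every
  \<open>q + j * k\<close> is ambiguous.

  The realization \<open>z j\<close> places the entry at \<open>0\<close> between the entries at \<open>q + j * k\<close> and
  \<open>q + (j + 1) * k\<close>. An embedding of \<open>z i\<close> into \<open>z j\<close> has shift \<open>0\<close>, because the last break of
  periodicity, at \<open>T - 1\<close>, must be matched, and then the places of the entry at \<open>0\<close> contradict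
  each other.
\<close>

lemma ambiguous_tail_increasing:
  assumes b: "1 \<le> b" and k: "1 \<le> k" and real: "\<And>m. \<exists>F. follows b \<pi> m F 0"
    and T: "1 \<le> T" "\<pi> (T - 1) \<noteq> \<pi> (T - 1 + k)" and periodic: "\<And>t. T \<le> t \<Longrightarrow> \<pi> (t + k) = \<pi> t"
    and unamb: "\<And>m f g x y. b \<le> m \<Longrightarrow> follows b \<pi> m f T \<Longrightarrow> follows b \<pi> m g T \<Longrightarrow> x < m \<Longrightarrow> y < m \<Longrightarrow>
      f x < f y \<longleftrightarrow> g x < g y"
    and f: "follows b \<pi> (q + 1) f 0" "f 0 < f q" and g: "follows b \<pi> (q + 1) g 0" "g q < g 0"
    and q: "T + b * k + b \<le> q"
    and inc: "follows b \<pi> mF F0 0" "q + k < mF" "F0 q < F0 (q + k)"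
  shows "\<exists>n z. strict_mono n \<and> (\<forall>i. b \<le> n i \<and> follows b \<pi> (n i) (z i) 0) \<and> bad_seq n z"
proof -
  have bq: "b \<le> q + 1" using q by simp
  \<comment> \<open>Comparisons of positions \<open>\<ge> T\<close> do not depend on the realization.\<close>
  define R where "R x y \<longleftrightarrow> (\<exists>m F. follows b \<pi> m F 0 \<and> T + b \<le> m \<and> x < m \<and> y < m \<and> F x < F y)" for x y
  have tail: "follows b \<pi> (m - T) (\<lambda>p. F (T + p)) T" if "follows b \<pi> m F 0" "T \<le> m" for m F
    using follows_shift[OF that(1), of T "m - T"] that(2) by simp
  have R_iff: "R x y \<longleftrightarrow> F x < F y" if F: "follows b \<pi> m F 0" "T + b \<le> m" "x < m" "y < m" "T \<le> x" "T \<le> y" for m F x y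
  proof
    assume "R x y"
    then obtain m' G where G: "follows b \<pi> m' G 0" "T + b \<le> m'" "x < m'" "y < m'" "G x < G y"
      unfolding R_def by blast
    let ?m = "min m m'"
    have "follows b \<pi> (?m - T) (\<lambda>p. F (T + p)) T" "follows b \<pi> (?m - T) (\<lambda>p. G (T + p)) T"
      using tail[OF follows_mono[OF F(1), of ?m]] tail[OF follows_mono[OF G(1), of ?m]] F(2) G(2) by auto
    moreover have "b \<le> ?m - T" "x - T < ?m - T" "y - T < ?m - T" using F G by auto
    ultimately show "F x < F y" using unamb[of "?m - T" "\<lambda>p. F (T + p)" "\<lambda>p. G (T + p)" "x - T" "y - T"] F G by simp
  qed (use that in \<open>auto simp: R_def\<close>)
  obtain Fb where Fb: "\<And>m. follows b \<pi> m (Fb m) 0" using real by metis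
  have Rb: "R x y \<longleftrightarrow> Fb m x < Fb m y" if "T + b \<le> m" "x < m" "y < m" "T \<le> x" "T \<le> y" for m x y
    using R_iff[OF Fb that] .
  have R_trans: "R x z" if "R x y" "R y z" "T \<le> x" "T \<le> y" "T \<le> z" for x y z
  proof -
    let ?m = "T + b + x + y + z + 1"
    show ?thesis using that Rb[of ?m x y] Rb[of ?m y z] Rb[of ?m x z] by simp
  qed
  have R_total: "R x y \<or> R y x" if "T \<le> x" "T \<le> y" "x \<noteq> y" for x y
  proof -
    let ?m = "T + b + x + y + 1"
    have "Fb ?m x \<noteq> Fb ?m y" using follows_inj[OF Fb[of ?m]] that(3) by (auto simp: inj_on_def)
    then show ?thesis using that Rb[of ?m x y] Rb[of ?m y x] by auto
  qed
  have R_asym: "\<not> R y x" if "R x y" "T \<le> x" "T \<le> y" for x y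
  proof -
    let ?m = "T + b + x + y + 1"
    show ?thesis using that Rb[of ?m x y] Rb[of ?m y x] by simp
  qed
  have R_shift1: "R (x + k) (y + k) \<longleftrightarrow> R x y" if "T \<le> x" "T \<le> y" for x y
  proof -
    let ?m = "T + b + x + y + 1"
    let ?F = "Fb (?m + k)"
    have "follows b \<pi> (?m - T) (\<lambda>p. ?F (T + k + p)) (T + k)"
      using follows_shift[OF Fb[of "?m + k"], of "T + k" "?m - T"] by simp
    then have "follows b \<pi> (?m - T) (\<lambda>p. ?F (T + k + p)) T"
    proof -
      have "\<pi> (T + k + t) = \<pi> (T + t)" for t using periodic[of "T + t"] by (simp add: add.assoc add.commute[of k])
      with \<open>follows b \<pi> (?m - T) (\<lambda>p. ?F (T + k + p)) (T + k)\<close> show ?thesis unfolding follows_def by simp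
    qed
    moreover have "follows b \<pi> (?m - T) (\<lambda>p. ?F (T + p)) T"
      using tail[OF follows_mono[OF Fb[of "?m + k"], of ?m]] by simp
    ultimately have "?F (T + k + (x - T)) < ?F (T + k + (y - T)) \<longleftrightarrow> ?F (T + (x - T)) < ?F (T + (y - T))"
      using that by (intro unamb[of "?m - T"]) auto
    then have "?F (x + k) < ?F (y + k) \<longleftrightarrow> ?F x < ?F y" using that by (simp add: add.commute)
    then show ?thesis using that Rb[of "?m + k" x y] Rb[of "?m + k" "x + k" "y + k"] by simp
  qed
  have R_shift: "R (x + c * k) (y + c * k) \<longleftrightarrow> R x y" if "T \<le> x" "T \<le> y" for x y c
  proof (induction c)
    case (Suc c)
    then show ?case using R_shift1[of "x + c * k" "y + c * k"] that by (simp add: algebra_simps)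
  qed simp
  have qT: "T \<le> q" using q by simp
  have R_step: "R (q + j * k) (q + Suc j * k)" for j
  proof -
    have "R q (q + k)" using R_iff[OF inc(1), of q "q + k"] inc q by simp
    then show ?thesis using R_shift[of q "q + k" j] qT by (simp add: algebra_simps)
  qed
  have R_chain: "i < j \<Longrightarrow> R (q + i * k) (q + j * k)" for i j
  proof (induction j)
    case (Suc j)
    show ?case
    proof (cases "i = j")
      case True then show ?thesis using R_step by simp
    next
      case False
      then have "R (q + i * k) (q + j * k)" using Suc by simp
      then show ?thesis using R_trans[OF _ R_step] qT by simp
    qed
  qed simp
  have near_adj: "near b p p'" if "T \<le> p" "p < M" "T \<le> p'" "p' < M" "T + b \<le> M" "Fb M p < Fb M p'"
    "\<And>y. T \<le> y \<Longrightarrow> y < M \<Longrightarrow> \<not> (Fb M p < Fb M y \<and> Fb M y < Fb M p')" for p p' M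
  proof (rule ccontr)
    assume n: "\<not> near b p p'"
    let ?h = "\<lambda>x. Fb M (T + x)"
    have folh: "follows b \<pi> (M - T) ?h T" using tail[OF Fb] that(5) by simp
    have "\<exists>h'. inj_on h' {..<M - T} \<and> same_windows b (M - T) ?h h' \<and>
      (h' (p - T) < h' (p' - T) \<longleftrightarrow> ?h (p' - T) < ?h (p - T)) \<and>
      (h' (p' - T) < h' (p - T) \<longleftrightarrow> ?h (p - T) < ?h (p' - T))"
    proof (rule swap_adjacent)
      fix w assume w: "w < M - T" "w \<noteq> p - T" "w \<noteq> p' - T"
      then have ne: "Fb M (T + w) \<noteq> Fb M p" "Fb M (T + w) \<noteq> Fb M p'"
        using inj_onD[OF follows_inj[OF Fb[of M]], of "T + w"] that(1-4) by fastforce+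
      have "T \<le> T + w" "T + w < M" using w by auto
      from that(7)[OF this] ne that(6) show "?h w < ?h (p - T) \<longleftrightarrow> ?h w < ?h (p' - T)"
        using that(1,3) by auto
    next
      show "\<not> near b (p - T) (p' - T)" using n that(1,3) unfolding near_def by linarith
      show "inj_on ?h {..<M - T}" using folh by (rule follows_inj)
      have "p \<noteq> p'" using that(6) by auto
      then show "p - T \<noteq> p' - T" using that(1,3) by simp
    qed (use that in auto)
    then obtain h' where h': "inj_on h' {..<M - T}" "same_windows b (M - T) ?h h'"
      "h' (p' - T) < h' (p - T) \<longleftrightarrow> ?h (p - T) < ?h (p' - T)" by blast
    have "follows b \<pi> (M - T) h' T" using follows_if_same_windows[OF folh h'(1,2)] .
    moreover have "b \<le> M - T" "p - T < M - T" "p' - T < M - T" using that(1-5) by linarith+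
    ultimately have "?h (p - T) < ?h (p' - T) \<longleftrightarrow> h' (p - T) < h' (p' - T)" using unamb folh by blast
    moreover have "?h (p - T) < ?h (p' - T)" using that(1,3,6) by simp
    ultimately show False using h'(3) by simp
  qed
  have gap: False if e: "T \<le> e" "e < T + b" "R (q + j * k) e" "R e (q + Suc j * k)" for e j
  proof -
    define x where "x = q + j * k"
    define M where "M = T + b + x + k + e + 1"
    let ?F = "Fb M"
    let ?S = "{T..<M}"
    have xk: "x + k = q + Suc j * k" by (simp add: x_def)
    have xT: "T \<le> x" using qT by (simp add: x_def)
    have F: "?F y < ?F y' \<longleftrightarrow> R y y'" if "y \<in> ?S" "y' \<in> ?S" for y y'
      using Rb[of M y y'] that by (simp add: M_def)
    have inS: "x \<in> ?S" "e \<in> ?S" "x + k \<in> ?S" using xT e(1) by (auto simp: M_def)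
    \<comment> \<open>Two positions of \<open>J\<close> in the same residue class would be a multiple of \<open>k\<close> apart, but
      shifting the interval by a multiple of \<open>k\<close> makes it disjoint from itself.\<close>
    define J where "J = {y \<in> ?S. ?F x \<le> ?F y \<and> ?F y < ?F (x + k)}"
    have no: False if y: "y \<in> J" "y + c * k \<in> J" "1 \<le> c" for y c
    proof -
      have yS: "y \<in> ?S" "y + c * k \<in> ?S" using y by (auto simp: J_def)
      have "x = y \<or> R x y"
      proof -
        have "?F x = ?F y \<Longrightarrow> x = y" using follows_inj[OF Fb[of M]] inS(1) yS(1) by (auto simp: inj_on_def)
        then show ?thesis using y(1) F[OF inS(1) yS(1)] by (auto simp: J_def)
      qed
      then have 1: "x + c * k = y + c * k \<or> R (x + c * k) (y + c * k)"
        using R_shift[of x y c] xT yS by auto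
      have 2: "R (y + c * k) (x + k)" using y(2) F[OF yS(2) inS(3)] by (auto simp: J_def)
      have 3: "x + k = x + c * k \<or> R (x + k) (x + c * k)"
        using R_chain[of "Suc j" "j + c"] y(3) by (cases "c = 1") (auto simp: x_def algebra_simps)
      have ge: "T \<le> x + k" "T \<le> x + c * k" "T \<le> y + c * k" using xT yS by auto
      have "R (y + c * k) (x + c * k)" using 2 3 R_trans ge by metis
      then show False using 1 R_asym ge by metis
    qed
    have "inj_on (\<lambda>y. y mod k) J"
    proof (rule inj_onI)
      have "\<not> y < y'" if "y \<in> J" "y' \<in> J" "y mod k = y' mod k" for y y'
      proof
        assume lt: "y < y'"
        note md = that(3)
        from lt obtain c where c: "y' = y + k * c" using md by (metis less_imp_le_nat mod_eq_nat2E)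
        then have "1 \<le> c" using lt by (cases c) auto
        then show False using no[OF that(1), of c] that(2) c by (simp add: mult.commute)
      qed
      then show "y = y'" if "y \<in> J" "y' \<in> J" "y mod k = y' mod k" for y y'
        using that by (metis linorder_neqE_nat)
    qed
    then have "card J \<le> card {..<k}" using k by (intro card_inj_on_le[of "\<lambda>y. y mod k"]) auto
    then have cJ: "card J \<le> k" by simp
    have "R e (x + k)" using e(4) unfolding xk .
    moreover have "R x e" using e(3) by (simp add: x_def)
    ultimately have "?F x < ?F e" "?F e < ?F (x + k)" using F inS by blast+
    have "x \<le> e + b * card {y \<in> ?S. ?F x \<le> ?F y \<and> ?F y < ?F e}"
    proof (rule position_distance)
      fix p p' assume p: "p \<in> ?S" "p' \<in> ?S" "?F p < ?F p'"
        "\<And>y. y \<in> ?S \<Longrightarrow> \<not> (?F p < ?F y \<and> ?F y < ?F p')"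
      have "near b p p'" using p by (intro near_adj[of p M p']) (auto simp: M_def)
      then show "p \<le> p' + b" by (simp add: near_def)
    qed (use inS \<open>?F x < ?F e\<close> in auto)
    also have "card {y \<in> ?S. ?F x \<le> ?F y \<and> ?F y < ?F e} \<le> card J"
      unfolding J_def using \<open>?F e < ?F (x + k)\<close> by (intro card_mono) auto
    then have "e + b * card {y \<in> ?S. ?F x \<le> ?F y \<and> ?F y < ?F e} \<le> e + b * k"
      using cJ by (meson add_left_mono le_trans mult_le_mono2)
    finally have "x \<le> e + b * k" by simp
    moreover have "q \<le> x" by (simp add: x_def)
    ultimately show False using q e(2) by linarith
  qed
  have up: "\<exists>h. follows b \<pi> (q + j * k + 1) h 0 \<and> h 0 < h (q + j * k)" for j
  proof -
    obtain h where h: "follows b \<pi> (q + j * k + 1) h 0" "\<forall>p<q + 1. h p = f p"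
      using follows_extend_to[OF b bq real f(1), of "q + j * k + 1"] by auto
    have "h 0 < h q" using h(2) f(2) by simp
    moreover have "j = 0 \<or> h q < h (q + j * k)"
      using R_chain[of 0 j] R_iff[OF h(1), of q "q + j * k"] q by auto
    ultimately show ?thesis using h(1) by (intro exI[of _ h]) auto
  qed
  have down: "\<exists>h. follows b \<pi> (q + j * k + 1) h 0 \<and> h (q + j * k) < h 0" for j
  proof -
    let ?m = "q + j * k + 1"
    have bm: "b \<le> ?m" using bq by simp
    obtain G where G: "follows b \<pi> ?m G 0" "\<forall>p<q + 1. G p = g p"
      using follows_extend_to[OF b bq real g(1), of ?m] by auto
    have Gq: "G q < G 0" using G(2) g(2) by simp
    have "(0, q + j * k) \<notin> (window_less b ?m G)\<^sup>*"
    proof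
      assume "(0, q + j * k) \<in> (window_less b ?m G)\<^sup>*"
      \<comment> \<open>Otherwise the comparison is forced through some \<open>e\<close>, whose value lies above \<open>0\<close>,
        hence above \<open>q\<close>, and below \<open>q + j * k\<close>: it lies in one of the gaps.\<close>
      then obtain e where e: "T \<le> e" "e < T + b" "(0, e) \<in> (window_less b ?m G)\<^sup>*" "(e, q + j * k) \<in> (window_less b ?m G)\<^sup>*"
        using window_less_star_passes[of 0 "q + j * k" b ?m G T] T(1) qT by auto
      have em: "e < ?m" "e \<noteq> q + i * k" for i using e(2) q by auto
      have "G 0 < G e" using window_less_star_less[OF e(3) bm same_windows_refl] e(1) T(1) by auto
      then have Rqe: "R q e" using R_iff[OF G(1), of q e] Gq q e em by simp
      have "G e < G (q + j * k)" using window_less_star_less[OF e(4) bm same_windows_refl] em by auto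
      then have "R e (q + j * k)" using R_iff[OF G(1), of e "q + j * k"] q e em by simp
      then have ex: "\<exists>i. R e (q + i * k)" by blast
      define i where "i = (LEAST i. R e (q + i * k))"
      have Ri: "R e (q + i * k)" unfolding i_def using ex by (rule LeastI_ex)
      have "i \<noteq> 0" using Ri R_asym[OF Rqe qT e(1)] by (cases "i = 0") auto
      then obtain i' where i': "i = Suc i'" by (cases i) auto
      have "\<not> R e (q + i' * k)" using not_less_Least[of i' "\<lambda>i. R e (q + i * k)"] i' i_def by simp
      then have "R (q + i' * k) e" using R_total[of e "q + i' * k"] e(1) qT em by auto
      then show False using gap[OF e(1,2)] Ri i' by blast
    qed
    moreover obtain h where h: "inj_on h {..<?m}" "same_windows b ?m G h" "\<And>p r. p < ?m \<Longrightarrow> r < ?m \<Longrightarrow>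
      h p < h r \<longleftrightarrow> ((0, p) \<notin> (window_less b ?m G)\<^sup>* \<and> (0, r) \<in> (window_less b ?m G)\<^sup>*) \<or>
        (((0, p) \<in> (window_less b ?m G)\<^sup>* \<longleftrightarrow> (0, r) \<in> (window_less b ?m G)\<^sup>*) \<and> G p < G r)"
      using raise_above[OF follows_inj[OF G(1)], of b 0] by blast
    ultimately show ?thesis using follows_if_same_windows[OF G(1) h(1,2)] by (intro exI[of _ h]) simp
  qed
  \<comment> \<open>Starting from a realization in which the entry at \<open>0\<close> is larger than the last one, lift
    the last entry together with everything that is forced to lie above it.\<close>
  have Z: "\<exists>z. follows b \<pi> (q + Suc j * k + 1) z 0 \<and> z 0 < z (q + Suc j * k) \<and> z (q + j * k) < z 0" for j
  proof -
    let ?m = "q + Suc j * k + 1" and ?x = "q + Suc j * k" and ?y = "q + j * k"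
    have bm: "b \<le> ?m" using bq by simp
    obtain h where h: "follows b \<pi> ?m h 0" "h ?x < h 0" using down by blast
    obtain h2 where h2: "follows b \<pi> ?m h2 0" "h2 0 < h2 ?x" using up by blast
    have yx: "h ?y < h ?x" using R_step[of j] R_iff[OF h(1), of ?y ?x] q by simp
    have 0: "(?x, 0) \<notin> (window_less b ?m h)\<^sup>*"
      using window_less_star_less[of ?x 0 b ?m h h2] bm follows_same_windows[OF h(1) h2(1)] h2(2) q b by auto
    have y: "(?x, ?y) \<notin> (window_less b ?m h)\<^sup>*"
      using window_less_star_less[of ?x ?y b ?m h h] bm yx k by auto
    obtain z where z: "inj_on z {..<?m}" "same_windows b ?m h z" "\<And>p r. p < ?m \<Longrightarrow> r < ?m \<Longrightarrow>
      z p < z r \<longleftrightarrow> ((?x, p) \<notin> (window_less b ?m h)\<^sup>* \<and> (?x, r) \<in> (window_less b ?m h)\<^sup>*) \<or>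
        (((?x, p) \<in> (window_less b ?m h)\<^sup>* \<longleftrightarrow> (?x, r) \<in> (window_less b ?m h)\<^sup>*) \<and> h p < h r)"
      using raise_above[OF follows_inj[OF h(1)], of b ?x] by blast
    have "z 0 < z ?x" using z(3)[of 0 ?x] 0 by simp
    moreover have "z ?y < z 0" using z(3)[of ?y 0] 0 y yx h(2) by simp
    ultimately show ?thesis using follows_if_same_windows[OF h(1) z(1,2)] by blast
  qed
  then obtain z where z: "\<And>j. follows b \<pi> (q + Suc j * k + 1) (z j) 0" "\<And>j. z j 0 < z j (q + Suc j * k)"
    "\<And>j. z j (q + j * k) < z j 0" by metis
  define n where "n j = q + Suc j * k + 1" for j
  have "\<not> embeds (n i) (z i) (n j) (z j)" if ij: "i < j" for i j
  proof
    assume "embeds (n i) (z i) (n j) (z j)"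
    then obtain s where s: "s + n i \<le> n j" "same_order (n i) (z i) 0 (z j) s" by (auto simp: embeds_def)
    have len: "T - 1 + k + b \<le> n i" using q b by (simp add: n_def)
    have w: "\<pi> (s + t) = \<pi> t" if "t + b \<le> n i" for t
    proof -
      have "window b (z j) (s + t) = window b (z i) t" using same_order_window[OF s(2) that] by simp
      moreover have "s + t + b \<le> n j" using that s(1) by simp
      ultimately show ?thesis using follows_window[OF z(1), of t i] follows_window[OF z(1), of "s + t" j] that
        by (simp add: n_def)
    qed
    have "\<pi> (s + (T - 1)) \<noteq> \<pi> (s + (T - 1) + k)"
      using w[of "T - 1"] w[of "T - 1 + k"] len T(2) by (simp add: add.assoc)
    then have "\<not> T \<le> s + (T - 1)" using periodic[of "s + (T - 1)"] by metis
    then have "s = 0" using T(1) by linarith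
    then have "z j 0 < z j (q + Suc i * k)"
      using same_orderD[OF s(2), of 0 "q + Suc i * k"] z(2)[of i] by (simp add: n_def)
    moreover have "Suc i = j \<or> z j (q + Suc i * k) < z j (q + j * k)"
    proof (cases "Suc i = j")
      case False
      then have "Suc i < j" using ij by simp
      then have "Suc i * k < j * k" using k by (intro mult_less_mono1) auto
      then have "q + Suc i * k < q + Suc j * k + 1" "q + j * k < q + Suc j * k + 1" by auto
      moreover have "T + b \<le> q + Suc j * k + 1" "T \<le> q + Suc i * k" "T \<le> q + j * k" using q by auto
      ultimately show ?thesis using R_chain[OF \<open>Suc i < j\<close>] R_iff[OF z(1)] by blast
    qed simp
    ultimately show False using z(3)[of j] by auto
  qed
  moreover have "strict_mono n" using k by (intro strict_monoI) (simp add: n_def)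
  moreover have "b \<le> n i \<and> follows b \<pi> (n i) (z i) 0" for i using z(1) bq by (simp add: n_def)
  ultimately show ?thesis unfolding bad_seq_def by blast
qed

lemma follows_uminus_iff:
  assumes "inj_on f {..<m}"
  shows "follows b (\<lambda>t. (\<pi> t)\<inverse>) m (\<lambda>p. - f p) a \<longleftrightarrow> follows b \<pi> m f a"
proof -
  have "window b (\<lambda>p. - f p) t = (window b f t)\<inverse>" for t by (auto simp: window_def)
  moreover have "inj_on (\<lambda>p. - f p) {..<m}" using assms by (auto simp: inj_on_def)
  ultimately show ?thesis using assms by (simp add: follows_def)
qed

lemma follows_uminus: "follows b \<pi> m f a \<Longrightarrow> follows b (\<lambda>t. (\<pi> t)\<inverse>) m (\<lambda>p. - f p) a"
  using follows_uminus_iff[OF follows_inj] by blast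

lemma follows_uminus_converse: 
  assumes "follows b (\<lambda>t. (\<pi> t)\<inverse>) m f a" shows "follows b \<pi> m (\<lambda>p. - f p) a"
  using follows_uminus[OF assms] by simp

lemma embeds_uminus: "embeds n (\<lambda>p. - f p) m (\<lambda>p. - g p) \<longleftrightarrow> embeds n f m g"
  unfolding embeds_def same_order_def by auto

text \<open>
  If the entries at \<open>q\<close>, \<open>q + k\<close>, \<dots> decrease, negate all sequences.
\<close>

lemma ambiguous_tail:
  assumes b: "1 \<le> b" and k: "1 \<le> k" and real: "\<And>m. \<exists>F. follows b \<pi> m F 0"
    and T: "1 \<le> T" "\<pi> (T - 1) \<noteq> \<pi> (T - 1 + k)" and periodic: "\<And>t. T \<le> t \<Longrightarrow> \<pi> (t + k) = \<pi> t"
    and unamb: "\<And>m f g x y. b \<le> m \<Longrightarrow> follows b \<pi> m f T \<Longrightarrow> follows b \<pi> m g T \<Longrightarrow> x < m \<Longrightarrow> y < m \<Longrightarrow>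
      f x < f y \<longleftrightarrow> g x < g y"
    and f: "follows b \<pi> (q + 1) f 0" "f 0 < f q" and g: "follows b \<pi> (q + 1) g 0" "g q < g 0"
    and q: "T + b * k + b \<le> q"
  shows "\<exists>n z. strict_mono n \<and> (\<forall>i. b \<le> n i \<and> follows b \<pi> (n i) (z i) 0) \<and> bad_seq n z"
proof -
  obtain F where F: "follows b \<pi> (q + k + 1) F 0" using real by blast
  have "F q \<noteq> F (q + k)" using inj_onD[OF follows_inj[OF F], of q "q + k"] k by auto
  then consider "F q < F (q + k)" | "F (q + k) < F q" by linarith
  then show ?thesis
  proof cases
    case 1
    show ?thesis by (rule ambiguous_tail_increasing[OF b k real T periodic unamb f g q F _ 1]) auto
  next
    case 2
    let ?\<pi> = "\<lambda>t. (\<pi> t)\<inverse>"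
    have "\<exists>n z. strict_mono n \<and> (\<forall>i. b \<le> n i \<and> follows b ?\<pi> (n i) (z i) 0) \<and> bad_seq n z"
    proof (rule ambiguous_tail_increasing[OF b k])
      show "\<exists>F. follows b ?\<pi> m F 0" for m using real[of m] follows_uminus by blast
      show "?\<pi> (T - 1) \<noteq> ?\<pi> (T - 1 + k)" using T(2) by (metis converse_converse)
      show "?\<pi> (t + k) = ?\<pi> t" if "T \<le> t" for t using periodic[OF that] by simp
      show "f x < f y \<longleftrightarrow> g x < g y" if "b \<le> m" "follows b ?\<pi> m f T" "follows b ?\<pi> m g T" "x < m" "y < m" for m f g x y
        using unamb[OF that(1) follows_uminus_converse[OF that(2)] follows_uminus_converse[OF that(3)] that(5,4)] by simp
      show "follows b ?\<pi> (q + 1) (\<lambda>p. - g p) 0" "follows b ?\<pi> (q + 1) (\<lambda>p. - f p) 0"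
        using f g follows_uminus by blast+
      show "follows b ?\<pi> (q + k + 1) (\<lambda>p. - F p) 0" using F follows_uminus by blast
    qed (use T f g q 2 in auto)
    then obtain n z where z: "strict_mono n" "\<And>i. b \<le> n i \<and> follows b ?\<pi> (n i) (z i) 0" "bad_seq n z" by blast
    have "bad_seq n (\<lambda>i p. - z i p)" using z(3) by (simp add: bad_seq_def embeds_uminus)
    moreover have "\<forall>i. b \<le> n i \<and> follows b \<pi> (n i) (\<lambda>p. - z i p) 0" using z(2) follows_uminus_converse by blast
    ultimately show ?thesis using z(1) by (intro exI[of _ n] exI[of _ "\<lambda>i p. - z i p"]) blast
  qed
qed

section \<open>Cycles that are entered and left\<close>

context local_class
begin

definition has_bad_seq :: bool where
  "has_bad_seq \<longleftrightarrow> (\<exists>n f. strict_mono n \<and> (\<forall>i. b \<le> n i \<and> mem (n i) (f i)) \<and> bad_seq n f)"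

definition periodic :: "(nat \<Rightarrow> real) \<Rightarrow> nat \<Rightarrow> nat \<Rightarrow> nat \<Rightarrow> bool" where
  "periodic f k i j \<longleftrightarrow> (\<forall>t. i \<le> t \<longrightarrow> t + k \<le> j \<longrightarrow> window b f t = window b f (t + k))"

text \<open>
  No cycle of the window graph is both entered and left: if a window repeats, then the windows
  are periodic from this cycle on up to one of the two ends.
\<close>

definition one_sided :: "nat \<Rightarrow> (nat \<Rightarrow> real) \<Rightarrow> nat \<Rightarrow> nat \<Rightarrow> bool" where
  "one_sided n f i j \<longleftrightarrow> (i < j \<longrightarrow> j + b \<le> n \<longrightarrow> window b f i = window b f j \<longrightarrow>
     periodic f (j - i) 0 j \<or> periodic f (j - i) i (n - b))"

text \<open>
  A periodic stretch with a break of periodicity at each end: the path enters a cycle and leaves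
  it again.
\<close>

definition two_breaks :: "(nat \<Rightarrow> real) \<Rightarrow> nat \<Rightarrow> nat \<Rightarrow> bool" where
  "two_breaks f k r \<longleftrightarrow> 1 \<le> k \<and> 2 \<le> r \<and> mem (r + k + b) f \<and>
     (\<forall>t\<le>r. window b f t \<noteq> window b f (t + k) \<longleftrightarrow> t = 0 \<or> t = r)"

lemma two_breaks_not_one_sided:
  assumes "two_breaks f k r" shows "\<not> one_sided (r + k + b) f 1 (1 + k)"
proof -
  have f: "1 \<le> k" "2 \<le> r" "\<And>t. t \<le> r \<Longrightarrow> window b f t \<noteq> window b f (t + k) \<longleftrightarrow> t = 0 \<or> t = r"
    using assms by (auto simp: two_breaks_def)
  have "\<not> periodic f k 0 (1 + k)" using f(3)[of 0] unfolding periodic_def by fastforce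
  moreover have "\<not> periodic f k 1 (r + k)" using f(2) f(3)[of r] unfolding periodic_def by fastforce
  ultimately show ?thesis using f(1,2) f(3)[of 1] by (auto simp: one_sided_def)
qed

text \<open>
  Take the breaks that are closest to the repeated window on both sides.
\<close>

lemma two_breaks_if_not_one_sided:
  assumes "mem n f" "\<not> one_sided n f i j"
  shows "\<exists>f' r. two_breaks f' (j - i) r"
proof -
  define k where "k = j - i"
  have ij: "i < j" "j + b \<le> n" "window b f i = window b f j" "\<not> periodic f k 0 j" "\<not> periodic f k i (n - b)"
    using assms(2) by (auto simp: one_sided_def k_def)
  have k: "j = i + k" "1 \<le> k" using ij(1) by (auto simp: k_def)
  let ?br = "\<lambda>t. window b f t \<noteq> window b f (t + k)"
  obtain l0 where l0: "l0 + k \<le> j" "?br l0" using ij(4) by (auto simp: periodic_def)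
  obtain r0 where r0: "i \<le> r0" "r0 + k \<le> n - b" "?br r0" using ij(5) by (auto simp: periodic_def)
  have nbi: "\<not> ?br i" using ij(3) k by simp
  then have l0i: "l0 < i" using l0 k by (metis add_le_cancel_right le_neq_implies_less)
  define l where "l = Max {l. l < i \<and> ?br l}"
  have "l \<in> {l. l < i \<and> ?br l}" unfolding l_def using l0i l0 by (intro Max_in) auto
  then have l: "l < i" "?br l" by auto
  have lmax: "\<not> ?br t" if "l < t" "t < i" for t
  proof
    assume "?br t"
    then have "t \<le> l" unfolding l_def using that(2) by (intro Max_ge) auto
    with that(1) show False by simp
  qed
  define r where "r = (LEAST r. i \<le> r \<and> ?br r)"
  have r0': "i \<le> r0 \<and> ?br r0" using r0 by blast
  have r: "i \<le> r \<and> ?br r" unfolding r_def by (rule LeastI[of "\<lambda>r. i \<le> r \<and> ?br r", OF r0'])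
  have rr0: "r \<le> r0" unfolding r_def by (rule Least_le[of "\<lambda>r. i \<le> r \<and> ?br r", OF r0'])
  have rmin: "\<not> ?br t" if "i \<le> t" "t < r" for t
    using not_less_Least[of t "\<lambda>r. i \<le> r \<and> ?br r"] that unfolding r_def by blast
  have ri: "i < r" using r nbi by (metis le_neq_implies_less)
  have br: "?br t \<longleftrightarrow> t = l \<or> t = r" if "l \<le> t" "t \<le> r" for t
    using l(2) r lmax[of t] rmin[of t] that by (metis le_neq_implies_less not_le_imp_less)
  have "r - l + k + b + l \<le> n" using rr0 r0(2) ij(2) l(1) ri by simp
  then have "mem (r - l + k + b) (\<lambda>p. f (l + p))" using assms(1) by (intro mem_shift) auto
  moreover have "window b f (l + t) \<noteq> window b f (l + (t + k)) \<longleftrightarrow> t = 0 \<or> t = r - l" if "t \<le> r - l" for t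
    using br[of "l + t"] that l(1) ri by (auto simp: add.assoc)
  ultimately have "two_breaks (\<lambda>p. f (l + p)) k (r - l)"
    unfolding two_breaks_def using k l(1) ri by auto
  then show ?thesis unfolding k_def by blast
qed

text \<open>
  Go around the cycle once more.
\<close>

lemma pump:
  assumes "two_breaks f k r"
  shows "\<exists>f'. two_breaks f' k (r + k)"
proof -
  have f: "1 \<le> k" "2 \<le> r" "mem (r + k + b) f" "\<And>t. t \<le> r \<Longrightarrow> window b f t \<noteq> window b f (t + k) \<longleftrightarrow> t = 0 \<or> t = r"
    using assms by (auto simp: two_breaks_def)
  have "window b f (1 + k) = window b f 1" using f(4)[of 1] f(2) by auto
  then obtain h where h: "\<forall>p<1 + k + b. h p = f p" "mem (1 + k + (r + k + b - 1)) h"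
    "same_order (r + k + b - 1) h (1 + k) f 1"
    using splice[OF f(3) _ f(3), of "1 + k" 1] f(2) by auto
  have w1: "window b h t = window b f t" if "t \<le> 1 + k" for t
    using h(1) that by (intro window_cong) simp
  have w2: "window b h (t + k) = window b f t" if "1 \<le> t" "t \<le> r + k" for t
    using same_order_window[OF h(3), of "t - 1" b] that by (simp add: add.commute)
  have br: "window b h t \<noteq> window b h (t + k) \<longleftrightarrow> t = 0 \<or> t = r + k" if t: "t \<le> r + k" for t
  proof -
    consider "t = 0" | "1 \<le> t" "t \<le> 1 + k" | "1 + k < t" by linarith
    then show ?thesis
    proof cases
      case 1
      then show ?thesis using w1[of 0] w1[of k] f(4)[of 0] by simp
    next
      case 2
      then have "window b h (t + k) = window b f t" using w2 t by simp
      moreover have "window b h t = window b f t" using 2 w1 by simp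
      ultimately show ?thesis using 2 f(2) by simp
    next
      case 3
      define s where "s = t - k"
      have s: "t = s + k" "1 \<le> s" "s \<le> r" using 3 t by (auto simp: s_def)
      have "window b h t = window b f s" using w2[of s] s by simp
      moreover have "window b h (t + k) = window b f (s + k)" using w2[of "s + k"] s by simp
      ultimately show ?thesis using f(4)[of s] s by auto
    qed
  qed
  have "1 + k + (r + k + b - 1) = r + k + k + b" using f(2) by simp
  with h(2) have "mem (r + k + k + b) h" by metis
  then show ?thesis using br f(1,2) unfolding two_breaks_def by (intro exI[of _ h]) auto
qed

text \<open>
  Go around the cycle once less.
\<close>

lemma unpump:
  assumes "two_breaks f k r" "k + 2 \<le> r"
  shows "\<exists>f'. two_breaks f' k (r - k)"
proof -
  have f: "1 \<le> k" "2 \<le> r" "mem (r + k + b) f" "\<And>t. t \<le> r \<Longrightarrow> window b f t \<noteq> window b f (t + k) \<longleftrightarrow> t = 0 \<or> t = r"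
    using assms by (auto simp: two_breaks_def)
  have eq: "window b f 1 = window b f (1 + k)" using f(4)[of 1] f(2) by auto
  have b1: "1 + k + b \<le> r + k + b" "1 < 1 + k" using f(1,2) by auto
  obtain h where h: "mem (r + k + b - (1 + k - 1)) h" "\<And>t. t \<le> 1 \<Longrightarrow> window b h t = window b f t"
    "\<And>t. 1 \<le> t \<Longrightarrow> t + (1 + k - 1) + b \<le> r + k + b \<Longrightarrow> window b h t = window b f (t + (1 + k - 1))"
    using cut_loop[OF f(3) b1(2,1) eq] by metis
  have w: "window b h t = window b f (t + k)" if "1 \<le> t" "t \<le> r" for t using h(3)[of t] that by simp
  have br: "window b h t \<noteq> window b h (t + k) \<longleftrightarrow> t = 0 \<or> t = r - k" if t: "t \<le> r - k" for t
  proof (cases "t = 0")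
    case True
    have "window b h (0 + k) = window b f (k + k)" using w[of k] assms(2) f(1) by simp
    also have "\<dots> = window b f k" using f(4)[of k] f(1) assms(2) by auto
    finally show ?thesis using True h(2)[of 0] f(4)[of 0] by simp
  next
    case False
    then have "window b h t = window b f (t + k)" "window b h (t + k) = window b f (t + k + k)"
      using w[of t] w[of "t + k"] t assms(2) by auto
    then show ?thesis using f(4)[of "t + k"] False t assms(2) by auto
  qed
  have "r + k + b - (1 + k - 1) = r - k + k + b" using assms(2) by simp
  then have "mem (r - k + k + b) h" using h(1) by simp
  then show ?thesis using br f(1) assms(2) unfolding two_breaks_def by (intro exI[of _ h]) auto
qed

text \<open>
  Pumping gives members with breaks at distance \<open>r + m * k\<close>, for all \<open>m\<close>. An embedding has to
  match the two breaks of one member with the two breaks of the other one.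
\<close>

lemma two_breaks_bad:
  assumes "two_breaks f k r" shows has_bad_seq
proof -
  have "\<exists>f'. two_breaks f' k (r + m * k)" for m
  proof (induction m)
    case (Suc m)
    have "r + Suc m * k = r + m * k + k" by simp
    with Suc pump show ?case by metis
  qed (use assms in auto)
  then obtain z where z: "\<And>m. two_breaks (z m) k (r + m * k)" by metis
  define n where "n m = r + m * k + k + b" for m
  have k: "1 \<le> k" "2 \<le> r" using assms by (auto simp: two_breaks_def)
  have br: "window b (z m) t \<noteq> window b (z m) (t + k) \<longleftrightarrow> t = 0 \<or> t = r + m * k" if "t \<le> r + m * k" for m t
    using z[of m] that by (auto simp: two_breaks_def)
  have "\<not> embeds (n i) (z i) (n j) (z j)" if "i < j" for i j
  proof
    assume "embeds (n i) (z i) (n j) (z j)"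
    then obtain s where s: "s + n i \<le> n j" "same_order (n i) (z i) 0 (z j) s" by (auto simp: embeds_def)
    have w: "window b (z i) t = window b (z j) (s + t)" if "t + b \<le> n i" for t
      using same_order_window[OF s(2) that] by simp
    have lt: "i * k < j * k" using that k by simp
    have sl: "s + i * k \<le> j * k" using s(1) by (simp add: n_def)
    have "window b (z j) s \<noteq> window b (z j) (s + k)"
      using br[of 0 i] w[of 0] w[of k] by (simp add: n_def)
    then have "s = 0" using br[of s j] sl k by auto
    have "window b (z j) (r + i * k) \<noteq> window b (z j) (r + i * k + k)"
      using br[of "r + i * k" i] w[of "r + i * k"] w[of "r + i * k + k"] \<open>s = 0\<close> by (simp add: n_def)
    then show False using br[of "r + i * k" j] lt k by auto
  qed
  moreover have "strict_mono n" using k by (intro strict_monoI) (simp add: n_def)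
  moreover have "b \<le> n i \<and> mem (n i) (z i)" for i using z[of i] by (simp add: n_def two_breaks_def)
  ultimately show ?thesis unfolding has_bad_seq_def bad_seq_def by blast
qed

lemma one_sided_if_good: "\<not> has_bad_seq \<Longrightarrow> mem n f \<Longrightarrow> one_sided n f i j"
  using two_breaks_if_not_one_sided two_breaks_bad by blast

text \<open>
  A violation contains two breaks, with period \<open>k \<le> num_windows\<close>. Cutting out periods brings
  their distance down to at most \<open>k + 1\<close>.
\<close>

lemma one_sided_bounded:
  assumes "\<And>n f i j. n \<le> M \<Longrightarrow> mem n f \<Longrightarrow> one_sided n f i j" "2 * num_windows + 1 + b \<le> M"
    "mem n f" "j \<le> i + num_windows"
  shows "one_sided n f i j"
proof (rule ccontr)
  assume "\<not> ?thesis"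
  then obtain f' r where r: "two_breaks f' (j - i) r" using two_breaks_if_not_one_sided assms(3) by blast
  have "\<not> two_breaks f k r" if "k \<le> num_windows" for f k r
  proof (induction r arbitrary: f rule: less_induct)
    case (less r)
    show ?case
    proof
      assume f: "two_breaks f k r"
      then have k: "1 \<le> k" "mem (r + k + b) f" by (auto simp: two_breaks_def)
      show False
      proof (cases "k + 2 \<le> r")
        case True
        then show False using unpump[OF f True] less[of "r - k"] k by auto
      next
        case False
        then show False using two_breaks_not_one_sided[OF f] assms(1)[OF _ k(2)] assms(2) that by simp
      qed
    qed
  qed
  then show False using r assms(4) by simp
qed

section \<open>Ambiguous comparisons deep inside a periodic run\<close>

text \<open>
  A run that is longer than its period can be continued for ever.
\<close>

lemma periodic_extension:
  assumes f: "mem n f" "periodic f k T (n - b)" "T + k + b \<le> n" "1 \<le> k"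
  obtains \<pi> where "\<And>t. t + b \<le> n \<Longrightarrow> \<pi> t = window b f t" "\<And>t. T \<le> t \<Longrightarrow> \<pi> (t + k) = \<pi> t"
    "\<And>m. \<exists>F. follows b \<pi> m F 0" "\<And>m g a. b \<le> m \<Longrightarrow> follows b \<pi> m g a \<Longrightarrow> mem m g"
proof -
  define \<pi> where "\<pi> t = (if t < T then window b f t else window b f (T + (t - T) mod k))" for t
  have 1: "\<pi> t = window b f t" if "t + b \<le> n" for t
    using that
  proof (induction t rule: less_induct)
    case (less t)
    show ?case
    proof (cases "T + k \<le> t")
      case True
      then have "\<pi> t = \<pi> (t - k)" by (auto simp: \<pi>_def le_mod_geq add.commute)
      also have "\<dots> = window b f (t - k)" using less True f(4) by simp
      also have "\<dots> = window b f t" using f(2) True less.prems unfolding periodic_def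
        by (metis add_diff_cancel_right' add_le_imp_le_diff le_add_diff_inverse2 add_leD2)
      finally show ?thesis .
    qed (auto simp: \<pi>_def)
  qed
  have 2: "\<pi> (t + k) = \<pi> t" if "T \<le> t" for t
  proof -
    have "t + k - T = (t - T) + k" using that by simp
    then have "(t + k - T) mod k = (t - T) mod k" by (metis mod_add_self2)
    then show ?thesis using that by (simp add: \<pi>_def)
  qed
  have 3: "\<exists>j. j + b \<le> n \<and> \<pi> t = window b f j" for t
  proof (cases "t < T")
    case True
    then show ?thesis using f(3) by (intro exI[of _ t]) (simp add: \<pi>_def)
  next
    case False
    have "(t - T) mod k < k" using f(4) by simp
    then show ?thesis using False f(3) by (intro exI[of _ "T + (t - T) mod k"]) (simp add: \<pi>_def)
  qed
  have fn: "follows b \<pi> n f 0" using 1 mem_inj[OF f(1)] by (simp add: follows_def)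
  have 4: "\<exists>F. follows b \<pi> m F 0" if "n \<le> m" for m
    using that
  proof (induction m rule: dec_induct)
    case (step m)
    then obtain F where F: "follows b \<pi> m F 0" by blast
    define i where "i = m - b"
    have i: "i + b = m" "T + k \<le> i" using step.hyps f(3) by (auto simp: i_def)
    have "window b F (i - k) = \<pi> (i - k)" "window b F i = \<pi> i" using F i by (auto simp: follows_def)
    moreover have "\<pi> (i - k) = \<pi> i" using 2[of "i - k"] i by simp
    ultimately have "same_order b F i (\<lambda>p. F (i - k + p)) 0" by (simp add: window_eq_iff[symmetric])
    moreover have "inj_on F {..<i + b}" using F i by (simp add: follows_def)
    moreover have "inj_on (\<lambda>p. F (i - k + p)) {..<b + 1}"
      using follows_inj[OF F] i f(4) by (intro inj_on_shift) auto
    ultimately obtain h where h: "\<forall>p<i + b. h p = F p" "inj_on h {..<i + b + 1}"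
      "same_order (b + 1) h i (\<lambda>p. F (i - k + p)) 0" using amalgamation by blast
    have "window b h t = \<pi> t" if t: "t + b \<le> Suc m" for t
    proof (cases "t \<le> i")
      case True
      then have "window b h t = window b F t" using h(1) by (intro window_cong) simp
      then show ?thesis using follows_window[OF F, of t] True i by simp
    next
      case False
      then have ti: "t = i + 1" using t i by simp
      then have "window b h t = window b F (i - k + 1)" using same_order_window[OF h(3), of 1 b] by simp
      also have "\<dots> = \<pi> (i - k + 1)" using follows_window[OF F, of "i - k + 1"] i f(4) by simp
      also have "\<dots> = \<pi> t" using 2[of "i - k + 1"] i ti by simp
      finally show ?thesis .
    qed
    then show ?case using h(2) i by (intro exI[of _ h]) (simp add: follows_def)
  qed (use fn in blast)
  have 5: "\<exists>F. follows b \<pi> m F 0" for m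
  proof -
    obtain F where "follows b \<pi> (max n m) F 0" using 4[of "max n m"] by auto
    then have "follows b \<pi> m F 0" by (rule follows_mono) simp
    then show ?thesis by blast
  qed
  have 6: "mem m g" if "b \<le> m" "follows b \<pi> m g a" for m g a
    using that f(1) 3 follows_window[OF that(2)] follows_inj[OF that(2)] by (intro mem_if_windows) metis+
  show thesis by (rule that[OF 1 2 5 6])
qed

text \<open>
  The requirement of \<open>ambiguous_tail\<close> on the distance between \<open>q\<close> and the beginning \<open>T\<close> of the
  periodic run, for all periods \<open>k \<le> num_windows\<close>.
\<close>

definition depth :: nat where "depth = b * num_windows + b"

text \<open>
  Cut the sequences down to the factor that ends at \<open>q\<close> and begins at \<open>u\<close> or, if this is further
  to the left, at the run that ends at \<open>q\<close>. If the windows of this factor are periodic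
  altogether, then \<open>ambiguous_periodic_path\<close> applies. Otherwise, \<open>ambiguous_tail\<close> applies to the
  first position \<open>T\<close> from which on they are periodic; comparisons on the periodic part are
  determined, again by \<open>ambiguous_periodic_path\<close>.
\<close>

lemma deep_agree:
  assumes good: "\<not> has_bad_seq" and fg: "mem n f" "mem n g" "b \<le> n" "same_windows b n f g"
    and uq: "u < q" "q < n" and k: "1 \<le> k" "k \<le> num_windows" and q: "depth \<le> q" "periodic f k (q - depth) (q + 1 - b)"
    and dis: "f u < f q" "g q < g u"
  shows False
proof -
  have bK: "b * k + b \<le> depth" unfolding depth_def using k by simp
  have kb: "k \<le> b * k" using b_pos by simp
  have badI: False if "strict_mono n'" "\<forall>i. b \<le> n' i \<and> follows b \<pi> (n' i) (z i) a" "bad_seq n' z"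
    "\<And>m g a. b \<le> m \<Longrightarrow> follows b \<pi> m g a \<Longrightarrow> mem m g" for \<pi> n' z a
    using that good unfolding has_bad_seq_def by blast
  \<comment> \<open>The common beginning of both factors to which the sequences are cut down.\<close>
  define v where "v = min u (q - depth)"
  define f' g' where "f' p = f (v + p)" and "g' p = g (v + p)" for p
  let ?u = "u - v" and ?q = "q - v"
  have v: "v \<le> u" "v \<le> q - depth" "v \<le> q" "?q + 1 + v \<le> n" using uq q(1) by (auto simp: v_def)
  have mf: "mem (?q + 1) f'" "mem (?q + 1) g'"
    unfolding f'_def g'_def using fg(1,2) v by (auto intro!: mem_shift)
  have swf: "same_windows b (?q + 1) f' g'" unfolding f'_def g'_def using fg(4) v by (auto intro: same_windows_shift)
  have qK: "depth \<le> ?q" using v q(1) by simp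
  have perf: "periodic f' k (?q - depth) (?q + 1 - b)"
    unfolding periodic_def
  proof (intro allI impI)
    fix t assume t: "?q - depth \<le> t" "t + k \<le> ?q + 1 - b"
    have "q - depth \<le> v + t" "v + t + k \<le> q + 1 - b" using t v qK bK kb by linarith+
    then show "window b f' t = window b f' (t + k)" using q(2) unfolding periodic_def f'_def by (simp add: add.assoc)
  qed
  have dis': "f' ?u < f' ?q" "g' ?q < g' ?u" using dis v by (auto simp: f'_def g'_def)
  define T where "T = (LEAST T. periodic f' k T (?q + 1 - b))"
  have T: "periodic f' k T (?q + 1 - b)" unfolding T_def using perf by (rule LeastI)
  have TK: "T \<le> ?q - depth" unfolding T_def using perf by (rule Least_le)
  have Tk: "T + k + b \<le> ?q + 1" using TK qK bK kb by linarith
  obtain \<pi> where \<pi>: "\<And>t. t + b \<le> ?q + 1 \<Longrightarrow> \<pi> t = window b f' t" "\<And>t. T \<le> t \<Longrightarrow> \<pi> (t + k) = \<pi> t"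
    "\<And>m. \<exists>F. follows b \<pi> m F 0" "\<And>m g a. b \<le> m \<Longrightarrow> follows b \<pi> m g a \<Longrightarrow> mem m g"
    using periodic_extension[OF mf(1) T Tk k(1)] by metis
  have ff: "follows b \<pi> (?q + 1) f' 0" using \<pi>(1) mem_inj[OF mf(1)] by (simp add: follows_def)
  then have gg: "follows b \<pi> (?q + 1) g' 0" using swf mem_inj[OF mf(2)] follows_if_same_windows by blast
  have b1: "b \<le> ?q + 1" using Tk by simp
  show False
  proof (cases "T = 0")
    case True
    have ux: "?u < ?q + 1" "?q < ?q + 1" using uq(1) v by auto
    have "\<not> (f' ?u < f' ?q \<longleftrightarrow> g' ?u < g' ?q)" using dis' by auto
    from ambiguous_periodic_path[OF b_pos k(1) _ \<pi>(3) b1 ff gg ux this] \<pi>(2) True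
    obtain a n' z where "strict_mono n'" "\<forall>i. b \<le> n' i \<and> follows b \<pi> (n' i) (z i) a" "bad_seq n' z"
      by auto
    then show False using badI \<pi>(4) by blast
  next
    case False
    have "u < q - depth"
    proof (rule ccontr)
      assume "\<not> u < q - depth"
      then have "?q = depth" using q(1) by (simp add: v_def)
      then show False using TK False by simp
    qed
    then have u0: "?u = 0" by (simp add: v_def)
    have "\<not> periodic f' k (T - 1) (?q + 1 - b)"
      using not_less_Least[of "T - 1" "\<lambda>T. periodic f' k T (?q + 1 - b)"] False by (simp add: T_def)
    then obtain t where t: "T - 1 \<le> t" "t + k \<le> ?q + 1 - b" "window b f' t \<noteq> window b f' (t + k)"
      unfolding periodic_def by blast
    have "t = T - 1" using t T False unfolding periodic_def by (metis Suc_leI Suc_pred le_neq_implies_less neq0_conv One_nat_def)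
    then have Tb: "\<pi> (T - 1) \<noteq> \<pi> (T - 1 + k)" using t \<pi>(1)[of t] \<pi>(1)[of "t + k"] b1 by auto
    have unamb: "f1 x < f1 y \<longleftrightarrow> g1 x < g1 y"
      if *: "b \<le> m" "follows b \<pi> m f1 T" "follows b \<pi> m g1 T" "x < m" "y < m" for m f1 g1 x y
    proof (rule ccontr)
      assume dis1: "\<not> ?thesis"
      let ?\<pi> = "\<lambda>t. \<pi> (T + t)"
      have sh: "follows b ?\<pi> l h a \<longleftrightarrow> follows b \<pi> l h (T + a)" for l h a by (simp add: follows_def add.assoc)
      have "\<exists>a n z. strict_mono n \<and> (\<forall>i. b \<le> n i \<and> follows b ?\<pi> (n i) (z i) a) \<and> bad_seq n z"
      proof (rule ambiguous_periodic_path[OF b_pos k(1) _ _ *(1) _ _ *(4,5) dis1])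
        show "\<pi> (T + (t + k)) = \<pi> (T + t)" for t using \<pi>(2)[of "T + t"] by (simp add: add.assoc)
        show "\<exists>F. follows b ?\<pi> m F 0" for m unfolding sh using realizable_shift[OF \<pi>(3)] by simp
        show "follows b ?\<pi> m f1 0" "follows b ?\<pi> m g1 0" unfolding sh using * by simp_all
      qed
      then show False unfolding sh using badI \<pi>(4) by metis
    qed
    have qT: "T + b * k + b \<le> ?q" using TK qK bK by linarith
    have "f' 0 < f' ?q" "g' ?q < g' 0" using dis' u0 by auto
    moreover have "1 \<le> T" using False by simp
    ultimately have "\<exists>n z. strict_mono n \<and> (\<forall>i. b \<le> n i \<and> follows b \<pi> (n i) (z i) 0) \<and> bad_seq n z"
      by (intro ambiguous_tail[OF b_pos k(1) \<pi>(3) _ Tb _ _ ff _ gg _ qT] \<pi>(2) unamb) assumption+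
    then obtain n' z where "strict_mono n'" "\<forall>i. b \<le> n' i \<and> follows b \<pi> (n' i) (z i) 0" "bad_seq n' z"
      by blast
    then show False using badI \<pi>(4) by blast
  qed
qed

end

section \<open>Sufficiency of the two conditions\<close>

text \<open>
  Dickson's lemma for pairs of natural numbers.
\<close>

lemma dickson_pair:
  fixes a c :: "nat \<Rightarrow> nat"
  assumes "infinite I"
  shows "\<exists>i\<in>I. \<exists>j\<in>I. i < j \<and> a i \<le> a j \<and> c i \<le> c j"
proof (rule ccontr)
  assume no: "\<not> ?thesis"
  define v where "v = (LEAST v. \<exists>i\<in>I. a i = v)"
  have "I \<noteq> {}" using assms by auto
  then have "\<exists>v. \<exists>i\<in>I. a i = v" by blast
  then have "\<exists>i\<in>I. a i = v" unfolding v_def by (rule LeastI_ex)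
  then obtain i0 where i0: "i0 \<in> I" "a i0 = v" by blast
  have min: "a i0 \<le> a j" if "j \<in> I" for j unfolding i0(2) v_def using that by (intro Least_le) blast
  define J where "J = {j \<in> I. i0 < j}"
  have "I \<subseteq> {..i0} \<union> J" by (auto simp: J_def)
  then have "infinite J" using assms by (metis finite_Un finite_atMost finite_subset)
  have "c j < c i0" if "j \<in> J" for j using no i0(1) min that by (force simp: J_def)
  then have "c ` J \<subseteq> {..<c i0}" by auto
  then have "finite (c ` J)" by (rule finite_subset) simp
  then obtain x where x: "infinite {j \<in> J. c j = c x}"
    using pigeonhole_infinite[OF \<open>infinite J\<close>] by blast
  define L where "L = {j \<in> J. c j = c x}"
  define w where "w = (LEAST w. \<exists>i\<in>L. a i = w)"
  have "L \<noteq> {}" using x unfolding L_def by fastforce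
  then have "\<exists>w. \<exists>i\<in>L. a i = w" by blast
  then have "\<exists>i\<in>L. a i = w" unfolding w_def by (rule LeastI_ex)
  then obtain i where i: "i \<in> L" "a i = w" by blast
  have min: "a i \<le> a j" if "j \<in> L" for j unfolding i(2) w_def using that by (intro Least_le) blast
  have "infinite L" using x by (simp add: L_def)
  then obtain j where j: "j \<in> L" "i < j" by (metis finite_nat_set_iff_bounded_le not_le_imp_less)
  then show False using no i(1) min[OF j(1)] by (force simp: L_def J_def)
qed

context local_class
begin

text \<open>
  A long periodic run ends at \<open>q\<close>.
\<close>

definition right_deep :: "(nat \<Rightarrow> real) \<Rightarrow> nat \<Rightarrow> bool" where
  "right_deep f q \<longleftrightarrow> (\<exists>k. 1 \<le> k \<and> k \<le> num_windows \<and> depth \<le> q \<and> periodic f k (q - depth) (q + 1 - b))"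

text \<open>
  A long periodic run begins at \<open>u\<close>.
\<close>

definition left_deep :: "nat \<Rightarrow> (nat \<Rightarrow> real) \<Rightarrow> nat \<Rightarrow> bool" where
  "left_deep n f u \<longleftrightarrow> (\<exists>k. 1 \<le> k \<and> k \<le> num_windows \<and> u + depth < n \<and> periodic f k u (u + depth + 1 - b))"

lemma depth_bounds: "b \<le> depth" "num_windows \<le> depth" "num_windows + b \<le> depth"
proof -
  have "num_windows \<le> b * num_windows" using mult_le_mono1[OF b_pos, of num_windows] by simp
  then show "b \<le> depth" "num_windows \<le> depth" "num_windows + b \<le> depth" unfolding depth_def by linarith+
qed

lemma periodic_mono: "periodic f k i j \<Longrightarrow> i \<le> i' \<Longrightarrow> j' \<le> j \<Longrightarrow> periodic f k i' j'"
  by (auto simp: periodic_def)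

lemma periodic_shift: "periodic (\<lambda>p. f (s + p)) k i j \<longleftrightarrow> periodic f k (s + i) (s + j)"
proof
  assume *: "periodic (\<lambda>p. f (s + p)) k i j"
  show "periodic f k (s + i) (s + j)" unfolding periodic_def
  proof (intro allI impI)
    fix t assume t: "s + i \<le> t" "t + k \<le> s + j"
    then have "i \<le> t - s" "t - s + k \<le> j" by auto
    then have "window b f (s + (t - s)) = window b f (s + (t - s + k))" using * by (auto simp: periodic_def)
    then show "window b f t = window b f (t + k)" using t(1) by simp
  qed
qed (auto simp: periodic_def add.assoc)

lemma periodic_same_windows:
  assumes "same_windows b n f g" "periodic f k i j" "j + b \<le> n" shows "periodic g k i j"
  using assms by (auto simp: periodic_def same_windows_def)

lemma right_deep_same_windows:
  assumes "same_windows b n f g" "q < n" "right_deep f q" shows "right_deep g q"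
proof -
  obtain k where k: "1 \<le> k" "k \<le> num_windows" "depth \<le> q" "periodic f k (q - depth) (q + 1 - b)"
    using assms(3) by (auto simp: right_deep_def)
  have "q + 1 - b + b \<le> n" using assms(2) k(3) depth_bounds(1) by simp
  then show ?thesis using periodic_same_windows[OF assms(1) k(4)] k(1-3) unfolding right_deep_def by blast
qed

lemma left_deep_same_windows:
  assumes "same_windows b n f g" "left_deep n f u" shows "left_deep n g u"
proof -
  obtain k where k: "1 \<le> k" "k \<le> num_windows" "u + depth < n" "periodic f k u (u + depth + 1 - b)"
    using assms(2) by (auto simp: left_deep_def)
  have "u + depth + 1 - b + b \<le> n" using k(3) depth_bounds(1) by simp
  then show ?thesis using periodic_same_windows[OF assms(1) k(4)] k(1-3) unfolding left_deep_def by blast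
qed

text \<open>
  Next to cycles that are both entered and left, these comparisons are the second kind of
  obstruction to being well quasi-ordered.
\<close>

definition deep_ambiguous :: "nat \<Rightarrow> (nat \<Rightarrow> real) \<Rightarrow> nat \<Rightarrow> nat \<Rightarrow> bool" where
  "deep_ambiguous n f u q \<longleftrightarrow> b \<le> n \<and> mem n f \<and> u < q \<and> q < n \<and> ambiguous b n f u q \<and> (right_deep f q \<or> left_deep n f u)"

definition all_one_sided :: bool where
  "all_one_sided \<longleftrightarrow> (\<forall>n f i j. mem n f \<longrightarrow> j \<le> i + num_windows \<longrightarrow> one_sided n f i j)"

text \<open>
  Among any \<open>num_windows + 1\<close> consecutive windows one repeats, and then there is a periodic run
  from there to one of the ends. Between a longest run at the left end and a longest run at the
  right end there are therefore at most \<open>num_windows\<close> further windows. The runs may be shorter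
  than their periods.
\<close>

lemma run_decomposition:
  assumes os: all_one_sided and f: "mem n f" "b \<le> n"
  obtains s t k1 k2 where "s \<le> t" "t \<le> n - b" "t \<le> s + num_windows + 1" "1 \<le> k1" "k1 \<le> num_windows" "periodic f k1 0 s"
    "1 \<le> k2" "k2 \<le> num_windows" "periodic f k2 t (n - b)"
proof -
  let ?L = "n - b"
  let ?S = "{s. s \<le> ?L \<and> (\<exists>k. 1 \<le> k \<and> k \<le> num_windows \<and> periodic f k 0 s)}"
  let ?T = "\<lambda>t. t \<le> ?L \<and> (\<exists>k. 1 \<le> k \<and> k \<le> num_windows \<and> periodic f k t ?L)"
  have 0: "0 \<in> ?S" using num_windows_pos by (auto simp: periodic_def intro!: exI[of _ 1])
  have fin: "finite ?S" by simp
  define s where "s = Max ?S"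
  have "s \<in> ?S" unfolding s_def by (rule Max_in[OF fin]) (use 0 in blast)
  then have s: "s \<le> ?L" "\<exists>k. 1 \<le> k \<and> k \<le> num_windows \<and> periodic f k 0 s" by auto
  have smax: "x \<le> s" if "x \<in> ?S" for x unfolding s_def using fin that by (rule Max_ge)
  define t where "t = (LEAST t. ?T t)"
  have TL: "?T ?L" using num_windows_pos by (auto simp: periodic_def intro!: exI[of _ 1])
  have t: "?T t" unfolding t_def by (rule LeastI[of ?T, OF TL])
  have tmin: "t \<le> x" if "?T x" for x unfolding t_def by (rule Least_le[of ?T, OF that])
  have ts: "t \<le> s + num_windows + 1"
  proof (rule ccontr)
    assume a: "\<not> ?thesis"
    obtain i j where ij: "s + 1 \<le> i" "i < j" "j \<le> s + 1 + num_windows" "window b f i = window b f j"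
      using repeat_window[of "s + 1" f] by auto
    have jL: "j \<le> ?L" "j + b \<le> n" using ij(3) a t f(2) by auto
    have "one_sided n f i j" using os f(1) ij unfolding all_one_sided_def by simp
    then have "periodic f (j - i) 0 j \<or> periodic f (j - i) i ?L" using ij jL by (simp add: one_sided_def)
    moreover have k: "1 \<le> j - i" "j - i \<le> num_windows" using ij by auto
    ultimately have "j \<in> ?S \<or> ?T i" using jL ij by auto
    then have "j \<le> s \<or> t \<le> i" using smax[of j] tmin[of i] by blast
    then show False using ij a by linarith
  qed
  obtain k1 where k1: "1 \<le> k1" "k1 \<le> num_windows" "periodic f k1 0 s" using s by blast
  obtain k2 where k2: "1 \<le> k2" "k2 \<le> num_windows" "periodic f k2 t ?L" using t by blast
  show thesis
    by (rule that[of s "max s t" k1 k2]) (use s t ts k1 k2 periodic_mono in auto)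
qed

text \<open>
  Choose \<open>u\<close> and \<open>q\<close> at minimal distance \<open>d\<close> and suppose that \<open>d\<close> is large. By
  \<open>ambiguous_neighbour\<close> there is a third position \<open>a\<close> such that its comparison with each of \<open>u\<close>
  and \<open>q\<close> is ambiguous at a smaller distance, unless the positions are near. By minimality, \<open>a\<close>
  is near that one of \<open>u\<close> and \<open>q\<close> which is deep, and the comparison with the other one is
  ambiguous but not deep. By \<open>run_decomposition\<close>, however, one of two positions at such a large
  distance is deep.
\<close>

lemma deep_ambiguous_bounded:
  assumes os: all_one_sided and ex: "deep_ambiguous n0 f0 u0 q0"
  shows "\<exists>n f u q. n \<le> 3 * depth + num_windows + 2 * b + 5 \<and> deep_ambiguous n f u q"
proof -
  define P where "P d \<longleftrightarrow> (\<exists>n f u q. deep_ambiguous n f u q \<and> d = q - u)" for d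
  have "\<exists>d. P d" using ex by (auto simp: P_def)
  define d where "d = (LEAST d. P d)"
  have Pd: "P d" unfolding d_def using \<open>\<exists>d. P d\<close> by (rule LeastI_ex)
  have dmin: "\<not> deep_ambiguous n f u q" if "q - u < d" for n f u q
    using not_less_Least[of "q - u" P] that unfolding d_def P_def by blast
  obtain n f u q where nf: "deep_ambiguous n f u q" "d = q - u" using Pd P_def by blast
  then have f: "b \<le> n" "mem n f" "u < q" "q < n" "ambiguous b n f u q" "right_deep f q \<or> left_deep n f u"
    by (auto simp: deep_ambiguous_def)
  note Kb = depth_bounds
  define C where "C = 2 * depth + num_windows + 2 * b + 3"
  have shift_amb: "deep_ambiguous m (\<lambda>p. f (v + p)) (u - v) (q - v)"
    if "v + m \<le> n" "v \<le> u" "q < v + m" "b \<le> m" "right_deep (\<lambda>p. f (v + p)) (q - v) \<or> left_deep m (\<lambda>p. f (v + p)) (u - v)" for v m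
    unfolding deep_ambiguous_def using that f mem_shift[OF f(2) that(1)]
      ambiguous_shift[of b n f v "u - v" "q - v" m] by auto
  show ?thesis
    using f(6)
  proof
    assume "right_deep f q"
    then obtain k where k: "1 \<le> k" "k \<le> num_windows" "depth \<le> q" "periodic f k (q - depth) (q + 1 - b)" by (auto simp: right_deep_def)
    have rd: "right_deep (\<lambda>p. f (v + p)) (q - v)" if "v \<le> q - depth" for v
      unfolding right_deep_def periodic_shift using k that Kb by (intro exI[of _ k]) (auto intro: periodic_mono)
    define v where "v = min u (q - depth)"
    have v: "v \<le> u" "v \<le> q - depth" "v \<le> q" using f(3) by (auto simp: v_def)
    have B: "deep_ambiguous (q - v + 1) (\<lambda>p. f (v + p)) (u - v) (q - v)"
      using shift_amb[of v "q - v + 1"] rd[of v] v f k Kb by auto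
    show ?thesis
    proof (cases "d \<le> C")
      case True
      then have "q - v + 1 \<le> 3 * depth + num_windows + 2 * b + 5" using nf(2) k(3) unfolding v_def C_def by linarith
      then show ?thesis using B by blast
    next
      case False
      then have vu: "v = u" "depth < d" using nf(2) unfolding v_def C_def by linarith+
      define F where "F p = f (u + p)" for p
      have BF: "deep_ambiguous (Suc d) F 0 d" using B vu nf(2) by (simp add: F_def[abs_def])
      have rF: "right_deep F d" using rd[of u] v vu nf(2) by (simp add: F_def[abs_def])
      have F: "mem (Suc d) F" "ambiguous b (Suc d) F 0 d" using BF by (auto simp: deep_ambiguous_def)
      have bd: "b \<le> d" "2 \<le> d" using False b_pos unfolding C_def by linarith+
      obtain a where a: "0 < a" "a < d" "b \<le> a \<Longrightarrow> ambiguous b d F 0 a"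
        "b \<le> d - a \<Longrightarrow> ambiguous b d (\<lambda>p. F (1 + p)) (a - 1) (d - 1)"
        using ambiguous_neighbour[OF F(2) bd mem_inj[OF F(1)]] by blast
      have da: "d - a < b"
      proof (rule ccontr)
        assume "\<not> ?thesis"
        then have am: "ambiguous b d (\<lambda>p. F (1 + p)) (a - 1) (d - 1)" using a(4) by simp
        have "mem d (\<lambda>p. F (1 + p))" using mem_shift[OF F(1), of 1 d] by simp
        moreover have "right_deep (\<lambda>p. F (1 + p)) (d - 1)"
        proof -
          have "right_deep (\<lambda>p. f (u + 1 + p)) (q - (u + 1))" using rd[of "u + 1"] vu nf(2) by simp
          then show ?thesis using nf(2) by (simp add: F_def[abs_def])
        qed
        ultimately have "deep_ambiguous d (\<lambda>p. F (1 + p)) (a - 1) (d - 1)"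
          using am a(1,2) bd by (auto simp: deep_ambiguous_def)
        then show False using dmin[of "d - 1" "a - 1"] a(1,2) by auto
      qed
      then have ab: "b \<le> a" using False unfolding C_def by linarith
      have Fd: "mem d F" using F(1) by (rule mem_mono) simp
      have "\<not> deep_ambiguous d F 0 a" using dmin[of a 0] a(2) by simp
      then have nd: "\<not> right_deep F a" "\<not> left_deep d F 0"
        using a(1,2) a(3)[OF ab] Fd bd unfolding deep_ambiguous_def by auto
      obtain s t k1 k2 where runs: "s \<le> t" "t \<le> d - b" "t \<le> s + num_windows + 1" "1 \<le> k1" "k1 \<le> num_windows" "periodic F k1 0 s"
        "1 \<le> k2" "k2 \<le> num_windows" "periodic F k2 t (d - b)" using run_decomposition[OF os Fd bd(1)] by metis
      have "s < depth + 1"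
      proof (rule ccontr)
        assume "\<not> ?thesis"
        then have "periodic F k1 0 (0 + depth + 1 - b)" using periodic_mono[OF runs(6), of 0 "0 + depth + 1 - b"] by simp
        then have "left_deep d F 0" unfolding left_deep_def using runs(4,5) vu(2) by (intro exI[of _ k1]) simp
        then show False using nd by simp
      qed
      then have tK: "t + depth \<le> a" using runs(3) da False unfolding C_def by linarith
      have "periodic F k2 (a - depth) (a + 1 - b)" by (rule periodic_mono[OF runs(9)]) (use tK a(2) in auto)
      then have "right_deep F a" unfolding right_deep_def using runs(7,8) tK by (intro exI[of _ k2]) simp
      then show ?thesis using nd by simp
    qed
  next
    assume "left_deep n f u"
    then obtain k where k: "1 \<le> k" "k \<le> num_windows" "u + depth < n" "periodic f k u (u + depth + 1 - b)" by (auto simp: left_deep_def)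
    have ld: "left_deep m (\<lambda>p. f (u + p)) 0" if "depth < m" for m
      unfolding left_deep_def periodic_shift using k that Kb by (intro exI[of _ k]) (auto simp: add.assoc)
    define w where "w = max q (u + depth)"
    have w: "q \<le> w" "u + depth \<le> w" "w < n" using f k by (auto simp: w_def)
    have B: "deep_ambiguous (w - u + 1) (\<lambda>p. f (u + p)) 0 (q - u)"
      using shift_amb[of u "w - u + 1"] ld[of "w - u + 1"] w f Kb by auto
    show ?thesis
    proof (cases "d \<le> C")
      case True
      then have "w - u + 1 \<le> 3 * depth + num_windows + 2 * b + 5" using nf(2) f(3) unfolding w_def C_def by linarith
      then show ?thesis using B by blast
    next
      case False
      then have wq: "w = q" "depth < d" using nf(2) unfolding w_def C_def by linarith+
      define F where "F p = f (u + p)" for p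
      have BF: "deep_ambiguous (Suc d) F 0 d" using B wq nf(2) f(3) by (simp add: F_def[abs_def])
      have lF: "left_deep d F 0" using ld[of d] wq by (simp add: F_def[abs_def])
      have F: "mem (Suc d) F" "ambiguous b (Suc d) F 0 d" using BF by (auto simp: deep_ambiguous_def)
      have bd: "b \<le> d" "2 \<le> d" using False b_pos unfolding C_def by linarith+
      obtain a where a: "0 < a" "a < d" "b \<le> a \<Longrightarrow> ambiguous b d F 0 a"
        "b \<le> d - a \<Longrightarrow> ambiguous b d (\<lambda>p. F (1 + p)) (a - 1) (d - 1)"
        using ambiguous_neighbour[OF F(2) bd mem_inj[OF F(1)]] by blast
      have ab: "a < b"
      proof (rule ccontr)
        assume "\<not> ?thesis"
        moreover have "mem d F" using F(1) by (rule mem_mono) simp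
        ultimately have "deep_ambiguous d F 0 a" using a lF bd by (auto simp: deep_ambiguous_def)
        then show False using dmin[of a 0] a(2) by simp
      qed
      let ?G = "\<lambda>p. F (1 + p)"
      have "b \<le> d - a" using False ab unfolding C_def by linarith
      then have am: "ambiguous b d ?G (a - 1) (d - 1)" using a(4) by simp
      have Gd: "mem d ?G" using mem_shift[OF F(1), of 1 d] by simp
      have "\<not> deep_ambiguous d ?G (a - 1) (d - 1)" using dmin[of "d - 1" "a - 1"] a(1,2) by auto
      then have nd: "\<not> right_deep ?G (d - 1)" "\<not> left_deep d ?G (a - 1)"
        using a(1,2) am Gd bd unfolding deep_ambiguous_def by auto
      obtain s t k1 k2 where runs: "s \<le> t" "t \<le> d - b" "t \<le> s + num_windows + 1" "1 \<le> k1" "k1 \<le> num_windows" "periodic ?G k1 0 s"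
        "1 \<le> k2" "k2 \<le> num_windows" "periodic ?G k2 t (d - b)" using run_decomposition[OF os Gd bd(1)] by metis
      have "d - 1 < t + depth"
      proof (rule ccontr)
        assume c: "\<not> ?thesis"
        have "periodic ?G k2 (d - 1 - depth) (d - 1 + 1 - b)"
          by (rule periodic_mono[OF runs(9)]) (use c bd in auto)
        then have "right_deep ?G (d - 1)" unfolding right_deep_def using runs(7,8) wq(2) by (intro exI[of _ k2]) simp
        then show False using nd by simp
      qed
      then have "a + depth \<le> s" using runs(3) ab False unfolding C_def by linarith
      then have "periodic ?G k1 (a - 1) (a - 1 + depth + 1 - b)" using a(1) b_pos by (intro periodic_mono[OF runs(6)]) linarith+
      moreover have "a - 1 + depth < d" using \<open>a + depth \<le> s\<close> runs(1,2) a(1,2) bd b_pos by linarith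
      ultimately have "left_deep d ?G (a - 1)" unfolding left_deep_def using runs(4,5) by (intro exI[of _ k1]) simp
      then show ?thesis using nd by simp
    qed
  qed
qed

text \<open>
  Split each member into a core and two outer parts, where the core reaches into the periodic
  runs at both ends by \<open>depth\<close> positions. The length of the core is bounded, so infinitely many
  members share the periods and the core, and by Dickson's lemma both outer parts of one of them
  are at most as long as those of a later one. The first member embeds into the second one in
  such a way that the cores match: the windows in the outer parts agree by periodicity, and a
  comparison that is not determined by the windows lies inside the core, as there are no
  ambiguous comparisons that involve a deep position.
\<close>

theorem good_if_no_deep_ambiguous:
  fixes n :: "nat \<Rightarrow> nat"
  assumes os: all_one_sided and nb: "\<And>n f u q. \<not> deep_ambiguous n f u q"
    and fs: "\<And>i. mem (n i) (f i)" "\<And>i. b \<le> n i"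
  shows "\<exists>i j. i < j \<and> embeds (n i) (f i) (n j) (f j)"
proof -
  have "\<exists>s t k1 k2. s \<le> t \<and> t \<le> n i - b \<and> t \<le> s + num_windows + 1 \<and> 1 \<le> k1 \<and> k1 \<le> num_windows \<and> periodic (f i) k1 0 s \<and>
    1 \<le> k2 \<and> k2 \<le> num_windows \<and> periodic (f i) k2 t (n i - b)" for i
    using run_decomposition[OF os fs] by metis
  then obtain s t k1 k2 where runs: "\<And>i. s i \<le> t i" "\<And>i. t i \<le> n i - b" "\<And>i. t i \<le> s i + num_windows + 1"
    "\<And>i. 1 \<le> k1 i" "\<And>i. k1 i \<le> num_windows" "\<And>i. periodic (f i) (k1 i) 0 (s i)"
    "\<And>i. 1 \<le> k2 i" "\<And>i. k2 i \<le> num_windows" "\<And>i. periodic (f i) (k2 i) (t i) (n i - b)" by metis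
  \<comment> \<open>The core consists of the windows from \<open>cs i\<close> to \<open>ce i\<close>, hence of \<open>c i\<close> entries; \<open>cs i\<close>
    and \<open>re i\<close> are the lengths of the outer parts. By truncated subtraction, \<open>cs i = 0\<close> if
    the left run is too short.\<close>
  define cs ce c re where "cs i = s i - depth" and "ce i = min (n i - b) (t i + depth)"
    and "c i = ce i + b - cs i" and "re i = n i - b - ce i" for i
  let ?C = "2 * depth + num_windows + 1 + b"
  have core: "cs i \<le> ce i" "cs i + c i = ce i + b" "n i = cs i + c i + re i" "c i \<le> ?C"
    "s i \<le> ce i" "cs i \<le> s i" for i
  proof -
    have 1: "cs i \<le> s i" "s i \<le> cs i + depth" unfolding cs_def by linarith+
    have 2: "s i \<le> ce i" "ce i \<le> n i - b" "ce i \<le> t i + depth" using runs(1,2)[of i] unfolding ce_def by auto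
    have 3: "cs i + c i = ce i + b" using 1 2 unfolding c_def by simp
    have 4: "n i = ce i + b + re i" using 2(2) fs(2)[of i] unfolding re_def by simp
    show "cs i \<le> ce i" "cs i + c i = ce i + b" "n i = cs i + c i + re i" "c i \<le> ?C" "s i \<le> ce i" "cs i \<le> s i"
      using 1 2 3 4 runs(3)[of i] by linarith+
  qed
  \<comment> \<open>The periods, the length of the core and the pattern of the core.\<close>
  define \<tau> where "\<tau> i = (k1 i, k2 i, c i, window (c i) (f i) (cs i))" for i
  have "range \<tau> \<subseteq> {..num_windows} \<times> {..num_windows} \<times> {..?C} \<times> Pow ({..<?C} \<times> {..<?C})"
    using runs(5,8) core(4) by (auto simp: \<tau>_def window_def intro: less_le_trans)
  then have "finite (\<tau> ` UNIV)" by (rule finite_subset) simp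
  then obtain i0 where "infinite {i \<in> UNIV. \<tau> i = \<tau> i0}"
    using pigeonhole_infinite[of "UNIV :: nat set" \<tau>] by auto
  then obtain i j where ij: "\<tau> i = \<tau> i0" "\<tau> j = \<tau> i0" "i < j" "cs i \<le> cs j" "re i \<le> re j"
    using dickson_pair[of _ cs re] by blast
  have eq: "k1 j = k1 i" "k2 j = k2 i" "c j = c i" "same_order (c i) (f i) (cs i) (f j) (cs j)"
  proof -
    have "\<tau> i = \<tau> j" using ij(1,2) by simp
    then show "k1 j = k1 i" "k2 j = k2 i" "c j = c i" "same_order (c i) (f i) (cs i) (f j) (cs j)"
      unfolding \<tau>_def prod.inject window_eq_iff[symmetric] by metis+
  qed
  define \<delta> where "\<delta> = cs j - cs i"
  define g where "g p = f j (\<delta> + p)" for p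
  have \<delta>: "cs j = \<delta> + cs i" "\<delta> + n i \<le> n j" using ij(4,5) core(3)[of i] core(3)[of j] eq(3) by (auto simp: \<delta>_def)
  have mg: "mem (n i) g" unfolding g_def[abs_def] using fs(1)[of j] \<delta>(2) by (rule mem_shift)
  have wg: "window b g x = window b (f j) (\<delta> + x)" for x by (simp add: g_def[abs_def])
  have wcore: "window b (f i) x = window b g x" if "cs i \<le> x" "x \<le> ce i" for x
    using same_order_window[OF eq(4), of "x - cs i" b] that core(2)[of i] \<delta>(1) by (simp add: wg add.assoc)
  have wleft: "window b (f i) x = window b g x" if "x \<le> ce i" for x
    using that
  proof (induction "ce i - x" arbitrary: x rule: less_induct)
    case less
    show ?case
    proof (cases "cs i \<le> x")
      case False
      then have si: "s i = cs i + depth" "s j = cs j + depth" using ij(4) unfolding cs_def by linarith+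
      have k: "1 \<le> k1 i" "x + k1 i \<le> s i" "\<delta> + x + k1 i \<le> s j"
        using runs(4,5)[of i] False si depth_bounds \<delta>(1) by linarith+
      have le: "x + k1 i \<le> ce i" using k(2) core(5)[of i] by simp
      have "window b (f i) x = window b (f i) (x + k1 i)" using runs(6)[of i] k(2) by (simp add: periodic_def)
      also have "\<dots> = window b g (x + k1 i)" using less.hyps[of "x + k1 i"] k(1) le by linarith
      also have "\<dots> = window b (f j) (\<delta> + x)" using runs(6)[of j] k(3) eq(1) by (simp add: periodic_def wg add.assoc)
      finally show ?thesis by (simp add: wg)
    qed (use wcore less.prems in blast)
  qed
  have w: "window b (f i) x = window b g x" if "x + b \<le> n i" for x
    using that
  proof (induction x rule: less_induct)
    case (less x)
    show ?case
    proof (cases "x \<le> ce i")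
      case False
      then have re: "0 < re i" "0 < re j" using less.prems ij(5) core(2,3)[of i] by linarith+
      then have ti: "ce i = t i + depth" "ce j = t j + depth" unfolding re_def ce_def by linarith+
      have cej: "ce j = \<delta> + ce i" using core(2)[of i] core(2)[of j] eq(3) \<delta>(1) by linarith
      define y where "y = x - k2 i"
      have y: "x = y + k2 i" "t i \<le> y" "t j \<le> \<delta> + y" "y < x"
        using False ti cej runs(7,8)[of i] depth_bounds(2) unfolding y_def by linarith+
      have "window b (f i) x = window b (f i) y" using runs(9)[of i] y less.prems by (simp add: periodic_def)
      also have "\<dots> = window b g y" using less.IH[OF y(4)] less.prems y(4) by simp
      also have "\<dots> = window b (f j) (\<delta> + x)"
        using runs(9)[of j] y(3) less.prems \<delta>(2) eq(2) unfolding y(1) wg periodic_def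
        by (metis add.assoc add_le_imp_le_diff le_trans nat_add_left_cancel_le)
      finally show ?thesis by (simp add: wg)
    qed (use wleft in blast)
  qed
  then have swg: "same_windows b (n i) (f i) g" by (simp add: same_windows_def)
  have "same_order (n i) (f i) 0 g 0"
  proof (rule ccontr)
    assume ns: "\<not> ?thesis"
    then obtain x y where xy: "x < n i" "y < n i" "\<not> (f i x < f i y \<longleftrightarrow> g x < g y)" by (auto simp: same_order_def)
    have ne: "x \<noteq> y" using xy(3) by auto
    have nxy: "f i x \<noteq> f i y" "g x \<noteq> g y"
      using inj_onD[OF mem_inj[OF fs(1)[of i]], of x y] inj_onD[OF mem_inj[OF mg], of x y] xy(1,2) ne by auto
    have am: "ambiguous b (n i) (f i) x y"
    proof (cases "f i x < f i y")
      case True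
      then show ?thesis using xy nxy mem_inj[OF fs(1)[of i]] mem_inj[OF mg] swg
        by (intro ambiguousI[of "f i" _ g]) auto
    next
      case False
      then show ?thesis using xy nxy mem_inj[OF fs(1)[of i]] mem_inj[OF mg] swg
        by (intro ambiguousI[of g _ "f i"]) auto
    qed
    define u q where "u = min x y" and "q = max x y"
    have uq: "u < q" "q < n i" "ambiguous b (n i) (f i) u q"
      using xy ne am ambiguous_sym[OF am] by (auto simp: u_def q_def min_def max_def)
    have nd: "\<not> right_deep (f i) q" "\<not> left_deep (n i) (f i) u"
      using nb[of "n i" "f i" u q] uq fs[of i] fs(1) by (auto simp: deep_ambiguous_def)
    have "q < ce i + b"
    proof (rule ccontr)
      assume c: "\<not> ?thesis"
      then have "0 < re i" using uq(2) core(2,3)[of i] by linarith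
      then have ti: "ce i = t i + depth" unfolding re_def ce_def by linarith
      have "periodic (f i) (k2 i) (q - depth) (q + 1 - b)"
        by (rule periodic_mono[OF runs(9)]) (use c ti uq(2) in auto)
      then have "right_deep (f i) q" unfolding right_deep_def using runs(7,8) c ti by (intro exI[of _ "k2 i"]) auto
      then show False using nd by simp
    qed
    moreover have "cs i \<le> u"
    proof (rule ccontr)
      assume c: "\<not> ?thesis"
      then have si: "s i = cs i + depth" unfolding cs_def by linarith
      have "periodic (f i) (k1 i) u (u + depth + 1 - b)"
        by (rule periodic_mono[OF runs(6)]) (use c si b_pos in auto)
      moreover have "u + depth < n i" using c si runs(1,2)[of i] fs(2)[of i] by linarith
      ultimately have "left_deep (n i) (f i) u" unfolding left_deep_def using runs(4,5) by (intro exI[of _ "k1 i"]) auto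
      then show False using nd by simp
    qed
    ultimately have "cs i \<le> x" "x < cs i + c i" "cs i \<le> y" "y < cs i + c i"
      using core(2)[of i] by (auto simp: u_def q_def)
    then have "f i x < f i y \<longleftrightarrow> g x < g y"
      using same_orderD[OF eq(4), of "x - cs i" "y - cs i"] \<delta>(1) by (simp add: g_def add.assoc)
    with xy(3) show False by simp
  qed
  then have "embeds (n i) (f i) (n j) (f j)" unfolding embeds_def g_def[abs_def] using \<delta>(2) by (intro exI[of _ \<delta>]) simp
  with ij(3) show ?thesis by blast
qed

end

section \<open>Reversal and the bounded criterion\<close>

text \<open>
  Reading sequences backwards exchanges the roles of left deep and right deep positions.
\<close>

definition reverse :: "nat \<Rightarrow> (nat \<Rightarrow> real) \<Rightarrow> nat \<Rightarrow> real" where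
  "reverse n f p = f (n - 1 - p)"

lemma reverse_reverse: "p < n \<Longrightarrow> reverse n (reverse n f) p = f p"
  by (simp add: reverse_def)

lemma same_order_reverse:
  assumes "same_order n f i g j" "i + n \<le> l" "j + n \<le> m"
  shows "same_order n (reverse l f) (l - n - i) (reverse m g) (m - n - j)"
  unfolding same_order_def
proof (intro allI impI)
  fix p q assume pq: "p < n" "q < n"
  have e: "reverse l f (l - n - i + p) = f (i + (n - 1 - p))" "reverse m g (m - n - j + p) = g (j + (n - 1 - p))" if "p < n" for p
  proof -
    have "l - 1 - (l - n - i + p) = i + (n - 1 - p)" "m - 1 - (m - n - j + p) = j + (n - 1 - p)"
      using that assms(2,3) by linarith+
    then show "reverse l f (l - n - i + p) = f (i + (n - 1 - p))" "reverse m g (m - n - j + p) = g (j + (n - 1 - p))"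
      by (simp_all add: reverse_def)
  qed
  show "reverse l f (l - n - i + p) < reverse l f (l - n - i + q) \<longleftrightarrow> reverse m g (m - n - j + p) < reverse m g (m - n - j + q)"
    unfolding e[OF pq(1)] e[OF pq(2)] using pq by (intro same_orderD[OF assms(1)]) auto
qed

lemma same_order_reverse_reverse: "same_order n (reverse n (reverse n f)) 0 f 0"
  by (rule same_order_eqI) (simp add: reverse_reverse)

lemma inj_on_reverse: "inj_on f {..<n} \<Longrightarrow> inj_on (reverse n f) {..<n}"
proof (rule inj_onI)
  fix p q assume *: "inj_on f {..<n}" "p \<in> {..<n}" "q \<in> {..<n}" "reverse n f p = reverse n f q"
  then have "n - 1 - p = n - 1 - q" by (intro inj_onD[OF *(1)]) (auto simp: reverse_def)
  then show "p = q" using *(2,3) by auto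
qed

lemma embeds_reverse:
  assumes "embeds n f m g" shows "embeds n (reverse n f) m (reverse m g)"
proof -
  obtain s where s: "s + n \<le> m" "same_order n f 0 g s" using assms by (auto simp: embeds_def)
  have "same_order n (reverse n f) (n - n - 0) (reverse m g) (m - n - s)" by (rule same_order_reverse[OF s(2)]) (use s(1) in auto)
  then show ?thesis unfolding embeds_def using s(1) by (intro exI[of _ "m - n - s"]) auto
qed

lemma window_reverse:
  assumes "i + b \<le> n" "j + b \<le> n" "window b f i = window b g j"
  shows "window b (reverse n f) (n - b - i) = window b (reverse n g) (n - b - j)"
  using assms same_order_reverse unfolding window_eq_iff by blast

context local_class
begin

definition mem_reverse :: "nat \<Rightarrow> (nat \<Rightarrow> real) \<Rightarrow> bool" where
  "mem_reverse n f \<longleftrightarrow> mem n (reverse n f)"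

lemma mem_cong: "mem n f \<Longrightarrow> same_order n g 0 f 0 \<Longrightarrow> mem n g"
  by (rule mem_factor[of n f 0]) auto

lemma mem_reverse_reverse: "mem n f \<Longrightarrow> mem_reverse n (reverse n f)"
  unfolding mem_reverse_def by (erule mem_cong) (rule same_order_reverse_reverse)

lemma local_class_reverse: "local_class b mem_reverse"
proof
  show "1 \<le> b" by (rule b_pos)
  show "inj_on f {..<n}" if "mem_reverse n f" for n f
  proof -
    have "inj_on (reverse n (reverse n f)) {..<n}" using that mem_inj inj_on_reverse unfolding mem_reverse_def by blast
    then show ?thesis by (rule inj_on_cong[THEN iffD1, rotated]) (simp add: reverse_reverse)
  qed
  show "mem_reverse m g" if "mem_reverse n f" "s + m \<le> n" "same_order m g 0 f s" for n f s m g
  proof -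
    have "same_order m (reverse m g) (m - m - 0) (reverse n f) (n - m - s)" by (rule same_order_reverse[OF that(3)]) (use that(2) in auto)
    then show ?thesis using that(1,2) mem_factor[of n "reverse n f" "n - m - s" m "reverse m g"] unfolding mem_reverse_def by simp
  qed
  show "mem_reverse n f" if "b \<le> n" "inj_on f {..<n}" "\<And>i. i + b \<le> n \<Longrightarrow> mem_reverse b (\<lambda>p. f (i + p))" for n f
    unfolding mem_reverse_def
  proof (rule mem_local[OF that(1) inj_on_reverse[OF that(2)]])
    fix i assume i: "i + b \<le> n"
    then have "mem b (reverse b (\<lambda>p. f (n - b - i + p)))" using that(3)[of "n - b - i"] unfolding mem_reverse_def by simp
    moreover have "same_order b (\<lambda>p. reverse n f (i + p)) 0 (reverse b (\<lambda>p. f (n - b - i + p))) 0"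
    proof (rule same_order_eqI)
      fix p assume "p < b"
      then have "n - 1 - (i + p) = n - b - i + (b - 1 - p)" using i by linarith
      then show "reverse n f (i + (0 + p)) = reverse b (\<lambda>p. f (n - b - i + p)) (0 + p)" by (simp add: reverse_def)
    qed
    ultimately show "mem b (\<lambda>p. reverse n f (i + p))" by (rule mem_cong)
  qed
qed

lemma reversed_good:
  assumes good: "\<not> has_bad_seq" shows "\<not> local_class.has_bad_seq b mem_reverse"
proof
  interpret reversed: local_class b mem_reverse by (rule local_class_reverse)
  assume "reversed.has_bad_seq"
  then obtain n f where f: "strict_mono n" "\<And>i. b \<le> n i \<and> mem_reverse (n i) (f i)" "bad_seq n f"
    unfolding reversed.has_bad_seq_def by blast
  have "\<not> embeds (n i) (reverse (n i) (f i)) (n j) (reverse (n j) (f j))" if "i < j" for i j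
  proof
    assume "embeds (n i) (reverse (n i) (f i)) (n j) (reverse (n j) (f j))"
    then have "embeds (n i) (reverse (n i) (reverse (n i) (f i))) (n j) (reverse (n j) (reverse (n j) (f j)))" by (rule embeds_reverse)
    moreover have "embeds (n i) (f i) (n i) (reverse (n i) (reverse (n i) (f i)))"
      unfolding embeds_def by (intro exI[of _ 0]) (simp add: same_order_sym[OF same_order_reverse_reverse])
    moreover have "embeds (n j) (reverse (n j) (reverse (n j) (f j))) (n j) (f j)"
      unfolding embeds_def by (intro exI[of _ 0]) (simp add: same_order_reverse_reverse)
    ultimately have "embeds (n i) (f i) (n j) (f j)" by (meson embeds_trans)
    with f(3) that show False by (simp add: bad_seq_def)
  qed
  then have "bad_seq n (\<lambda>i. reverse (n i) (f i))" by (simp add: bad_seq_def)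
  with good f(1,2) show False unfolding has_bad_seq_def mem_reverse_def by metis
qed

text \<open>
  The left deep case is the right deep case for the reversed sequences.
\<close>

lemma no_deep_ambiguous_if_good:
  assumes good: "\<not> has_bad_seq" shows "\<not> deep_ambiguous n f u q"
proof
  interpret reversed: local_class b mem_reverse by (rule local_class_reverse)
  assume "deep_ambiguous n f u q"
  then have f: "b \<le> n" "mem n f" "u < q" "q < n" "right_deep f q \<or> left_deep n f u" "ambiguous b n f u q"
    by (auto simp: deep_ambiguous_def)
  then obtain g h where gh: "inj_on g {..<n}" "inj_on h {..<n}" "same_windows b n f g" "same_windows b n f h" "g u < g q" "h q < h u"
    unfolding ambiguous_def by blast
  have m: "mem n g" "mem n h" using gh f mem_if_same_windows by blast+
  have sgh: "same_windows b n g h" using gh same_windows_sym same_windows_trans by blast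
  from f(5) show False
  proof
    assume "right_deep f q"
    then have "right_deep g q" using right_deep_same_windows[OF gh(3) f(4)] by blast
    then obtain k where "1 \<le> k" "k \<le> num_windows" "depth \<le> q" "periodic g k (q - depth) (q + 1 - b)" by (auto simp: right_deep_def)
    then show False using deep_agree[OF good m f(1) sgh f(3,4)] gh(5,6) by blast
  next
    assume "left_deep n f u"
    then have "left_deep n h u" using left_deep_same_windows[OF gh(4)] by blast
    then obtain k where k: "1 \<le> k" "k \<le> num_windows" "u + depth < n" "periodic h k u (u + depth + 1 - b)" by (auto simp: left_deep_def)
    have mr: "mem_reverse n (reverse n h)" "mem_reverse n (reverse n g)" using m mem_reverse_reverse by blast+
    have swr: "same_windows b n (reverse n h) (reverse n g)"
      unfolding same_windows_def
    proof (intro allI impI)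
      fix t assume t: "t + b \<le> n"
      have "window b h (n - b - t) = window b g (n - b - t)" using sgh t unfolding same_windows_def by simp
      then have "window b (reverse n h) (n - b - (n - b - t)) = window b (reverse n g) (n - b - (n - b - t))"
        by (intro window_reverse) (use t in auto)
      then show "window b (reverse n h) t = window b (reverse n g) t" using t by simp
    qed
    let ?u = "n - 1 - q" and ?q = "n - 1 - u"
    have uq: "?u < ?q" "?q < n" "depth \<le> ?q" using f(3,4) k(3) by auto
    have "reversed.periodic (reverse n h) k (?q - depth) (?q + 1 - b)"
      unfolding reversed.periodic_def
    proof (intro allI impI)
      fix t assume t: "?q - depth \<le> t" "t + k \<le> ?q + 1 - b"
      define t' where "t' = n - b - (t + k)"
      have t': "u \<le> t'" "t' + k \<le> u + depth + 1 - b" "n - b - t' = t + k" "n - b - (t' + k) = t" "t' + k + b \<le> n"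
      proof -
        have q1: "?q + 1 + u = n" using f(3,4) by linarith
        have A: "t + k + b + u \<le> n" using t(2) q1 uq(3) depth_bounds(1) by linarith
        have B: "n \<le> t + depth + 1 + u" using t(1) q1 by linarith
        have C: "t' + (t + k + b) = n" using A unfolding t'_def by linarith
        show "u \<le> t'" "t' + k \<le> u + depth + 1 - b" "n - b - t' = t + k" "n - b - (t' + k) = t" "t' + k + b \<le> n"
          using A B C by linarith+
      qed
      have "window b h t' = window b h (t' + k)" using k(4) t'(1,2) by (simp add: periodic_def)
      then have "window b (reverse n h) (n - b - t') = window b (reverse n h) (n - b - (t' + k))"
        by (intro window_reverse) (use t' in auto)
      then show "window b (reverse n h) t = window b (reverse n h) (t + k)" using t'(3,4) by simp
    qed
    moreover have "reverse n h ?u < reverse n h ?q" "reverse n g ?q < reverse n g ?u"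
      using gh(5,6) f(3,4) by (auto simp: reverse_def)
    ultimately show False
      using reversed.deep_agree[OF reversed_good[OF good] mr f(1) swr uq(1,2) k(1,2) uq(3)] by blast
  qed
qed

text \<open>
  Being well quasi-ordered is thus a property of the members of length at most \<open>M\<close>.
\<close>

theorem good_iff_bounded:
  assumes M: "3 * depth + 3 * num_windows + 2 * b + 5 \<le> M"
  shows "\<not> has_bad_seq \<longleftrightarrow> (\<forall>n f i j. n \<le> M \<longrightarrow> mem n f \<longrightarrow> one_sided n f i j) \<and>
    (\<forall>n f u q. n \<le> M \<longrightarrow> \<not> deep_ambiguous n f u q)" (is "?good \<longleftrightarrow> ?P \<and> ?Q")
proof
  assume ?good
  then show "?P \<and> ?Q" using one_sided_if_good no_deep_ambiguous_if_good by blast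
next
  assume PQ: "?P \<and> ?Q"
  have "2 * num_windows + 1 + b \<le> M" using M by simp
  then have os: all_one_sided
    unfolding all_one_sided_def using one_sided_bounded[of M] PQ by blast
  have "\<not> deep_ambiguous n f u q" for n f u q
  proof
    assume "deep_ambiguous n f u q"
    then obtain n' f' u' q' where b: "n' \<le> 3 * depth + num_windows + 2 * b + 5" "deep_ambiguous n' f' u' q'"
      using deep_ambiguous_bounded[OF os] by blast
    then have "n' \<le> M" using M by linarith
    with b(2) PQ show False by blast
  qed
  then show ?good using good_if_no_deep_ambiguous[OF os] unfolding has_bad_seq_def bad_seq_def by metis
qed

theorem good_sequences:
  fixes n :: "nat \<Rightarrow> nat"
  assumes "\<not> has_bad_seq" "\<And>i. mem (n i) (f i)" "\<And>i. b \<le> n i"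
  shows "\<exists>i j. i < j \<and> embeds (n i) (f i) (n j) (f j)"
proof (rule good_if_no_deep_ambiguous)
  show all_one_sided unfolding all_one_sided_def using one_sided_if_good[OF assms(1)] by blast
qed (use assms no_deep_ambiguous_if_good in auto)

end

section \<open>Permutations that avoid a finite set\<close>

text \<open>
  The default value \<open>0\<close> is also the one that \<open>code_nth\<close> below returns outside of the list.
\<close>

definition entries :: "nat list \<Rightarrow> nat \<Rightarrow> real" where
  "entries xs p = (if p < length xs then real (xs ! p) else 0)"

lemma perm_spec:
  assumes "distinct xs"
  shows "perm xs \<in> perms" "length (perm xs) = length xs"
    "\<And>i j. i < length xs \<Longrightarrow> j < length xs \<Longrightarrow> perm xs ! i < perm xs ! j \<longleftrightarrow> xs ! i < xs ! j"
  using theI'[OF perm_ex1[OF assms]] unfolding perm_def by blast+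

lemma perm_unique:
  assumes "distinct xs" "p \<in> perms" "length p = length xs"
    "\<And>i j. i < length xs \<Longrightarrow> j < length xs \<Longrightarrow> p ! i < p ! j \<longleftrightarrow> xs ! i < xs ! j"
  shows "perm xs = p"
  unfolding perm_def by (rule the1_equality[OF perm_ex1[OF assms(1)]]) (use assms in blast)

lemma inj_on_entries: "x \<in> perms \<Longrightarrow> inj_on (entries x) {..<length x}"
  by (auto simp: inj_on_def entries_def perms_iff nth_eq_iff_index_eq)

lemma perms_eq_if_same_order:
  assumes "x \<in> perms" "y \<in> perms" "length x = length y" "same_order (length x) (entries x) 0 (entries y) 0"
  shows "x = y"
proof -
  have dx: "distinct x" using assms(1) by (simp add: perms_iff)
  have "perm x = x" by (rule perm_unique[OF dx assms(1)]) auto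
  moreover have "perm x = y"
    by (rule perm_unique[OF dx assms(2)]) (use assms(3,4) in \<open>auto simp: same_order_def entries_def\<close>)
  ultimately show ?thesis by simp
qed

lemma consec_le_iff_embeds:
  assumes "x \<in> perms" "y \<in> perms"
  shows "x \<le>\<^sub>f y \<longleftrightarrow> embeds (length x) (entries x) (length y) (entries y)"
proof -
  have "x = perm (take (length x) (drop i y)) \<longleftrightarrow> same_order (length x) (entries x) 0 (entries y) i"
    if i: "i + length x \<le> length y" for i
  proof -
    let ?w = "take (length x) (drop i y)"
    have w: "distinct ?w" "length ?w = length x" "\<And>p. p < length x \<Longrightarrow> ?w ! p = y ! (i + p)"
      using assms(2) i by (auto simp: perms_iff)
    have v: "entries y (i + p) = real (y ! (i + p))" if "p < length x" for p using that i by (simp add: entries_def)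
    show ?thesis
    proof
      assume "x = perm ?w"
      then have "x ! p < x ! q \<longleftrightarrow> y ! (i + p) < y ! (i + q)" if "p < length x" "q < length x" for p q
        using perm_spec(3)[OF w(1), of p q] w(2,3) that by simp
      then show "same_order (length x) (entries x) 0 (entries y) i" unfolding same_order_def using v by (simp add: entries_def)
    next
      assume s: "same_order (length x) (entries x) 0 (entries y) i"
      have "perm ?w = x"
      proof (rule perm_unique[OF w(1) assms(1) w(2)[symmetric]])
        fix p q assume "p < length ?w" "q < length ?w"
        then have pq: "p < length x" "q < length x" unfolding w(2) .
        show "x ! p < x ! q \<longleftrightarrow> ?w ! p < ?w ! q"
          unfolding w(3)[OF pq(1)] w(3)[OF pq(2)]
          using same_orderD[OF s pq] v[OF pq(1)] v[OF pq(2)] pq by (simp add: entries_def)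
      qed
      then show "x = perm ?w" by simp
    qed
  qed
  then show ?thesis unfolding consec_le_def embeds_def by auto
qed

definition standardize :: "nat \<Rightarrow> (nat \<Rightarrow> real) \<Rightarrow> nat list" where
  "standardize n f = perm (map f [0..<n])"

lemma standardize_spec:
  assumes "inj_on f {..<n}"
  shows "standardize n f \<in> perms" "length (standardize n f) = n" "same_order n (entries (standardize n f)) 0 f 0"
proof -
  have d: "distinct (map f [0..<n])" using assms by (simp add: distinct_map atLeast0LessThan)
  show "standardize n f \<in> perms" "length (standardize n f) = n" using perm_spec(1,2)[OF d] by (simp_all add: standardize_def)
  then show "same_order n (entries (standardize n f)) 0 f 0"
    using perm_spec(3)[OF d] by (simp add: same_order_def entries_def standardize_def)
qed

lemma embeds_cong:
  assumes "embeds n f m g" "same_order n f' 0 f 0" "same_order m g 0 g' 0" shows "embeds n f' m g'"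
proof -
  have "embeds n f' n f" "embeds m g m g'" unfolding embeds_def using assms(2,3) by (auto intro!: exI[of _ 0])
  then show ?thesis using assms(1) embeds_trans by blast
qed

lemma embeds_le: "embeds n f m g \<Longrightarrow> n \<le> m" by (auto simp: embeds_def)

definition avoids :: "nat list set \<Rightarrow> nat \<Rightarrow> (nat \<Rightarrow> real) \<Rightarrow> bool" where
  "avoids B n f \<longleftrightarrow> inj_on f {..<n} \<and> (\<forall>\<beta>\<in>B. \<not> embeds (length \<beta>) (entries \<beta>) n f)"

lemma Av_iff_avoids:
  assumes "B \<subseteq> perms" shows "x \<in> Av B \<longleftrightarrow> x \<in> perms \<and> avoids B (length x) (entries x)"
  unfolding Av_def avoids_def using assms inj_on_entries consec_le_iff_embeds by blast

lemma avoids_standardize: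
  assumes "B \<subseteq> perms" "avoids B n f" shows "standardize n f \<in> Av B"
proof -
  have s: "standardize n f \<in> perms" "length (standardize n f) = n" "same_order n (entries (standardize n f)) 0 f 0"
    using assms(2) standardize_spec unfolding avoids_def by blast+
  have "\<not> embeds (length \<beta>) (entries \<beta>) n (entries (standardize n f))" if "\<beta> \<in> B" for \<beta>
    using embeds_cong[of "length \<beta>" "entries \<beta>" n "entries (standardize n f)" "entries \<beta>" f] s(3) assms(2) that
    by (auto simp: avoids_def)
  then show ?thesis using s assms(1) inj_on_entries[OF s(1)] by (simp add: Av_iff_avoids avoids_def)
qed

text \<open>
  An occurrence of a pattern of length at most \<open>b\<close> is contained in a window.
\<close>

lemma local_class_avoids:
  assumes "1 \<le> b" "\<And>\<beta>. \<beta> \<in> B \<Longrightarrow> length \<beta> \<le> b"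
  shows "local_class b (avoids B)"
proof
  show "1 \<le> b" by fact
  show "inj_on f {..<n}" if "avoids B n f" for n f using that by (simp add: avoids_def)
  show "avoids B m g" if *: "avoids B n f" "s + m \<le> n" "same_order m g 0 f s" for n f s m g
  proof -
    have "inj_on (\<lambda>p. f (s + p)) {..<m}" using * by (auto simp: avoids_def intro: inj_on_shift)
    moreover have "same_order m (\<lambda>p. f (s + p)) 0 g 0" using same_order_sym[OF *(3)] by simp
    ultimately have "inj_on g {..<m}" using same_order_inj_on by fastforce
    moreover have "embeds m g n f" using *(2,3) by (auto simp: embeds_def)
    ultimately show ?thesis using *(1) embeds_trans unfolding avoids_def by blast
  qed
  show "avoids B n f" if *: "b \<le> n" "inj_on f {..<n}" "\<And>i. i + b \<le> n \<Longrightarrow> avoids B b (\<lambda>p. f (i + p))" for n f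
    unfolding avoids_def
  proof (intro conjI ballI notI)
    fix \<beta> assume \<beta>: "\<beta> \<in> B" "embeds (length \<beta>) (entries \<beta>) n f"
    then obtain s where s: "s + length \<beta> \<le> n" "same_order (length \<beta>) (entries \<beta>) 0 f s" by (auto simp: embeds_def)
    define i where "i = min s (n - b)"
    have i: "i + b \<le> n" "i \<le> s" "s - i + length \<beta> \<le> b"
      using s(1) *(1) assms(2)[OF \<beta>(1)] by (auto simp: i_def)
    have "embeds (length \<beta>) (entries \<beta>) b (\<lambda>p. f (i + p))"
      unfolding embeds_def using s(2) i by (intro exI[of _ "s - i"]) simp
    then show False using *(3)[OF i(1)] \<beta>(1) by (simp add: avoids_def)
  qed (rule *(2))
qed

text \<open>
  Elements \<open>x\<close> and \<open>y\<close> without a common upper bound split the class into the elements that are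
  not above \<open>x\<close> and those that are not above \<open>y\<close>. Conversely, for a splitting into \<open>D\<close> and \<open>E\<close>,
  elements outside of \<open>D\<close> and outside of \<open>E\<close> have no common upper bound.
\<close>

lemma atomic_iff_joint:
  assumes "B \<subseteq> perms"
  shows "atomic perms (\<le>\<^sub>f) (Av B) \<longleftrightarrow> (\<forall>x\<in>Av B. \<forall>y\<in>Av B. \<exists>z\<in>Av B. x \<le>\<^sub>f z \<and> y \<le>\<^sub>f z)"
proof -
  have trans: "x \<le>\<^sub>f z" if "x \<le>\<^sub>f y" "y \<le>\<^sub>f z" "x \<in> perms" "y \<in> perms" "z \<in> perms" for x y z
    using that embeds_trans unfolding consec_le_iff_embeds[OF that(3,4)] consec_le_iff_embeds[OF that(4,5)]
      consec_le_iff_embeds[OF that(3,5)] by blast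
  have refl: "x \<le>\<^sub>f x" if "x \<in> perms" for x using that by (simp add: consec_le_iff_embeds embeds_refl)
  have Av: "Av B \<subseteq> perms" by (auto simp: Av_def)
  have dc: "downward_closed perms (\<le>\<^sub>f) (Av B)"
    unfolding downward_closed_def Av_def
  proof (intro conjI ballI impI CollectI notI)
    fix x y \<beta> assume "x \<in> {\<sigma> \<in> perms. \<forall>\<beta>\<in>B. \<not> \<beta> \<le>\<^sub>f \<sigma>}" "y \<in> perms" "y \<le>\<^sub>f x" "\<beta> \<in> B" "\<beta> \<le>\<^sub>f y"
    then show False using trans[of \<beta> y x] assms by blast
  qed auto
  show ?thesis
  proof
    assume at: "atomic perms (\<le>\<^sub>f) (Av B)"
    show "\<forall>x\<in>Av B. \<forall>y\<in>Av B. \<exists>z\<in>Av B. x \<le>\<^sub>f z \<and> y \<le>\<^sub>f z"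
    proof (rule ccontr)
      assume "\<not> ?thesis"
      then obtain x y where xy: "x \<in> Av B" "y \<in> Av B" "\<And>z. z \<in> Av B \<Longrightarrow> \<not> (x \<le>\<^sub>f z \<and> y \<le>\<^sub>f z)" by blast
      let ?D = "\<lambda>x. {w \<in> Av B. \<not> x \<le>\<^sub>f w}"
      have 1: "downward_closed perms (\<le>\<^sub>f) (?D x)" if x: "x \<in> Av B" for x
        unfolding downward_closed_def
      proof (intro conjI ballI impI CollectI notI)
        fix w v assume w: "w \<in> ?D x" "v \<in> perms" "v \<le>\<^sub>f w"
        show "v \<in> Av B" using dc w unfolding downward_closed_def by blast
        assume "x \<le>\<^sub>f v"
        then show False using trans[of x v w] w x Av by blast
      qed (use Av in blast)
      have 2: "?D x \<subset> Av B" if "x \<in> Av B" for x using that refl Av by blast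
      have "Av B = ?D x \<union> ?D y" using xy(3) by blast
      then have "\<exists>D E. downward_closed perms (\<le>\<^sub>f) D \<and> downward_closed perms (\<le>\<^sub>f) E \<and>
        D \<subset> Av B \<and> E \<subset> Av B \<and> Av B = D \<union> E"
        using 1 2 xy(1,2) by (intro exI[of _ "?D x"] exI[of _ "?D y"] conjI) simp_all
      then show False using at unfolding atomic_def by (elim conjE) (erule notE)
    qed
  next
    assume j: "\<forall>x\<in>Av B. \<forall>y\<in>Av B. \<exists>z\<in>Av B. x \<le>\<^sub>f z \<and> y \<le>\<^sub>f z"
    show "atomic perms (\<le>\<^sub>f) (Av B)"
      unfolding atomic_def
    proof (intro conjI dc notI)
      assume "\<exists>D E. downward_closed perms (\<le>\<^sub>f) D \<and> downward_closed perms (\<le>\<^sub>f) E \<and>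
        D \<subset> Av B \<and> E \<subset> Av B \<and> Av B = D \<union> E"
      then obtain D E where DE: "downward_closed perms (\<le>\<^sub>f) D" "downward_closed perms (\<le>\<^sub>f) E"
        "D \<subset> Av B" "E \<subset> Av B" "Av B = D \<union> E" by blast
      then obtain x y where xy: "x \<in> Av B" "x \<notin> D" "y \<in> Av B" "y \<notin> E" by blast
      then obtain z where "z \<in> Av B" "x \<le>\<^sub>f z" "y \<le>\<^sub>f z" using j by blast
      then show False using DE xy Av unfolding downward_closed_def by blast
    qed
  qed
qed

locale avoidance_class =
  fixes B :: "nat list set" and b :: nat
  assumes B: "B \<subseteq> perms" and b: "1 \<le> b" "\<And>\<beta>. \<beta> \<in> B \<Longrightarrow> length \<beta> \<le> b"
begin

sublocale local_class b "avoids B"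
  using b by (rule local_class_avoids)

lemma AvD: "x \<in> Av B \<Longrightarrow> avoids B (length x) (entries x)" "x \<in> Av B \<Longrightarrow> x \<in> perms"
  using B by (auto simp: Av_iff_avoids)

lemma standardize_in_Av:
  assumes "avoids B n f"
  shows "standardize n f \<in> Av B" "length (standardize n f) = n" "same_order n (entries (standardize n f)) 0 f 0"
  using avoids_standardize[OF B assms] standardize_spec[of f n] assms by (auto simp: avoids_def)

lemma joint_in_iff:
  assumes "x \<in> Av B" "y \<in> Av B"
  shows "joint_in l (length x) (entries x) (length y) (entries y) \<longleftrightarrow>
    (\<exists>z\<in>Av B. length z = l \<and> x \<le>\<^sub>f z \<and> y \<le>\<^sub>f z)"
proof
  assume "joint_in l (length x) (entries x) (length y) (entries y)"
  then obtain h where h: "avoids B l h" "embeds (length x) (entries x) l h" "embeds (length y) (entries y) l h"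
    by (auto simp: joint_in_def)
  note z = standardize_in_Av[OF h(1)]
  have "embeds (length x) (entries x) l (entries (standardize l h))" "embeds (length y) (entries y) l (entries (standardize l h))"
    using h(2,3) z(3) by (auto intro: embeds_cong same_order_sym)
  then show "\<exists>z\<in>Av B. length z = l \<and> x \<le>\<^sub>f z \<and> y \<le>\<^sub>f z"
    using z assms AvD(2) by (intro bexI[of _ "standardize l h"]) (simp_all add: consec_le_iff_embeds)
next
  assume "\<exists>z\<in>Av B. length z = l \<and> x \<le>\<^sub>f z \<and> y \<le>\<^sub>f z"
  then show "joint_in l (length x) (entries x) (length y) (entries y)"
    unfolding joint_in_def using AvD assms by (auto simp: consec_le_iff_embeds)
qed

theorem atomic_iff_bounded:
  assumes "R = num_windows + 4 * b + 3"
  shows "atomic perms (\<le>\<^sub>f) (Av B) \<longleftrightarrow> (\<forall>x\<in>Av B. \<forall>y\<in>Av B. length x \<le> R \<longrightarrow> length y \<le> R \<longrightarrow>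
    (\<exists>z\<in>Av B. length z \<le> 2 * R + num_windows + b \<and> x \<le>\<^sub>f z \<and> y \<le>\<^sub>f z))" (is "_ \<longleftrightarrow> ?bounded")
proof
  assume at: "atomic perms (\<le>\<^sub>f) (Av B)"
  show ?bounded
  proof (intro ballI impI)
    fix x y assume xy: "x \<in> Av B" "y \<in> Av B" "length x \<le> R" "length y \<le> R"
    then obtain z where "z \<in> Av B" "x \<le>\<^sub>f z" "y \<le>\<^sub>f z" using at atomic_iff_joint[OF B] by blast
    then have "joint_in (length z) (length x) (entries x) (length y) (entries y)" using joint_in_iff xy by blast
    then have "joint (length x) (entries x) (length y) (entries y)" by (auto simp: joint_def joint_in_def)
    then obtain l where "l \<le> length x + length y + num_windows + b" "joint_in l (length x) (entries x) (length y) (entries y)"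
      using joint_bounded by blast
    then obtain z where "z \<in> Av B" "length z = l" "x \<le>\<^sub>f z" "y \<le>\<^sub>f z" using joint_in_iff xy(1,2) by blast
    then show "\<exists>z\<in>Av B. length z \<le> 2 * R + num_windows + b \<and> x \<le>\<^sub>f z \<and> y \<le>\<^sub>f z"
      using xy(3,4) \<open>l \<le> _\<close> by (intro bexI[of _ z]) auto
  qed
next
  assume bd: ?bounded
  have J: "joint n f m g" if "n \<le> R" "m \<le> R" "avoids B n f" "avoids B m g" for n f m g
  proof -
    note x = standardize_in_Av[OF that(3)] and y = standardize_in_Av[OF that(4)]
    have "length (standardize n f) \<le> R" "length (standardize m g) \<le> R" using x(2) y(2) that(1,2) by simp_all
    then obtain z where z: "z \<in> Av B" "standardize n f \<le>\<^sub>f z" "standardize m g \<le>\<^sub>f z" using bd x(1) y(1) by blast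
    then have "joint_in (length z) n (entries (standardize n f)) m (entries (standardize m g))"
      using joint_in_iff[OF x(1) y(1)] x(2) y(2) by auto
    then have "joint n (entries (standardize n f)) m (entries (standardize m g))" by (auto simp: joint_def joint_in_def)
    then show ?thesis
    proof (rule joint_mono)
      show "embeds n f n (entries (standardize n f))" "embeds m g m (entries (standardize m g))"
        unfolding embeds_def using x(3) y(3) by (auto intro!: exI[of _ 0] same_order_sym)
    qed
  qed
  then have up: "joint_upto R" by (simp add: joint_upto_def)
  show "atomic perms (\<le>\<^sub>f) (Av B)"
    unfolding atomic_iff_joint[OF B]
  proof (intro ballI)
    fix x y assume xy: "x \<in> Av B" "y \<in> Av B"
    have "joint (length x) (entries x) (length y) (entries y)"
      using joint_embedding_if_upto[OF up] assms AvD(1) xy by simp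
    then obtain l where "joint_in l (length x) (entries x) (length y) (entries y)" by (auto simp: joint_def joint_in_def)
    then show "\<exists>z\<in>Av B. x \<le>\<^sub>f z \<and> y \<le>\<^sub>f z" using joint_in_iff xy by blast
  qed
qed

text \<open>
  All but finitely many elements of an infinite antichain have length at least \<open>b\<close> and so form a
  bad sequence; there is no infinite descent because lengths decrease.
\<close>

lemma wqo_iff_good: "wqo_on (\<le>\<^sub>f) (Av B) \<longleftrightarrow> \<not> has_bad_seq"
proof
  assume wqo: "wqo_on (\<le>\<^sub>f) (Av B)"
  show "\<not> has_bad_seq"
  proof
    assume has_bad_seq
    then obtain n f where f: "strict_mono n" "\<And>i. avoids B (n i) (f i)" "bad_seq n f"
      unfolding has_bad_seq_def by blast
    define s where "s i = standardize (n i) (f i)" for i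
    have s: "s i \<in> Av B" "length (s i) = n i" "same_order (n i) (entries (s i)) 0 (f i) 0" for i
      unfolding s_def using standardize_in_Av[OF f(2)] by blast+
    have no: "\<not> s i \<le>\<^sub>f s j" if "i \<noteq> j" for i j
    proof
      assume "s i \<le>\<^sub>f s j"
      then have e: "embeds (n i) (entries (s i)) (n j) (entries (s j))" using consec_le_iff_embeds AvD(2) s by simp
      then have "embeds (n i) (f i) (n j) (f j)" using s(3) same_order_sym embeds_cong by blast
      moreover have "i < j" using embeds_le[OF e] f(1) that
        by (metis leD linorder_neqE_nat strict_monoD)
      ultimately show False using f(3) by (simp add: bad_seq_def)
    qed
    have "inj s"
    proof (rule injI)
      fix i j assume "s i = s j"
      then have "n i = n j" using s(2) by metis
      then show "i = j" using f(1) by (meson injD strict_mono_imp_inj_on)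
    qed
    then have "infinite (range s)" using finite_imageD by blast
    moreover have "range s \<subseteq> Av B" using s(1) by blast
    moreover have "\<forall>x\<in>range s. \<forall>y\<in>range s. x \<noteq> y \<longrightarrow> \<not> x \<le>\<^sub>f y"
    proof (intro ballI impI)
      fix x y assume "x \<in> range s" "y \<in> range s" "x \<noteq> y"
      then obtain i j where "x = s i" "y = s j" "i \<noteq> j" by auto
      then show "\<not> x \<le>\<^sub>f y" using no by simp
    qed
    ultimately show False using wqo unfolding wqo_on_def by blast
  qed
next
  assume good: "\<not> has_bad_seq"
  have shorter: "length x < length y" if "x \<in> Av B" "y \<in> Av B" "x \<le>\<^sub>f y" "x \<noteq> y" for x y
  proof -
    have "embeds (length x) (entries x) (length y) (entries y)" using that consec_le_iff_embeds AvD(2) by blast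
    then obtain s where s: "s + length x \<le> length y" "same_order (length x) (entries x) 0 (entries y) s"
      unfolding embeds_def by blast
    have "length x \<noteq> length y"
    proof
      assume l: "length x = length y"
      then have "s = 0" using s(1) by simp
      then show False using perms_eq_if_same_order[of x y] s(2) l that AvD(2) by simp
    qed
    then show ?thesis using s(1) by simp
  qed
  have "\<not> (\<exists>s :: nat \<Rightarrow> nat list. \<forall>i. s i \<in> Av B \<and> s (Suc i) \<le>\<^sub>f s i \<and> s (Suc i) \<noteq> s i)"
  proof
    assume "\<exists>s :: nat \<Rightarrow> nat list. \<forall>i. s i \<in> Av B \<and> s (Suc i) \<le>\<^sub>f s i \<and> s (Suc i) \<noteq> s i"
    then obtain s :: "nat \<Rightarrow> nat list" where s: "\<And>i. s i \<in> Av B" "\<And>i. s (Suc i) \<le>\<^sub>f s i" "\<And>i. s (Suc i) \<noteq> s i"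
      by auto
    have dec: "length (s (Suc i)) < length (s i)" for i
      by (rule shorter[OF s(1) s(1) s(2) s(3)])
    have "length (s i) + i \<le> length (s 0)" for i
    proof (induction i)
      case (Suc i)
      then show ?case using dec[of i] by linarith
    qed simp
    from this[of "Suc (length (s 0))"] show False by simp
  qed
  moreover have "\<not> (\<exists>A\<subseteq>Av B. infinite A \<and> (\<forall>x\<in>A. \<forall>y\<in>A. x \<noteq> y \<longrightarrow> \<not> x \<le>\<^sub>f y))"
  proof
    assume "\<exists>A\<subseteq>Av B. infinite A \<and> (\<forall>x\<in>A. \<forall>y\<in>A. x \<noteq> y \<longrightarrow> \<not> x \<le>\<^sub>f y)"
    then obtain A where A: "A \<subseteq> Av B" "infinite A" "\<And>x y. x \<in> A \<Longrightarrow> y \<in> A \<Longrightarrow> x \<noteq> y \<Longrightarrow> \<not> x \<le>\<^sub>f y" by blast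
    have "{x \<in> A. length x < b} \<subseteq> {xs. set xs \<subseteq> {1..b} \<and> length xs \<le> b}"
    proof
      fix x assume "x \<in> {x \<in> A. length x < b}"
      then have "set x = {1..length x}" "length x < b" using A(1) AvD(2) by (auto simp: perms_iff)
      then show "x \<in> {xs. set xs \<subseteq> {1..b} \<and> length xs \<le> b}" by auto
    qed
    then have "finite {x \<in> A. length x < b}" by (rule finite_subset) (simp add: finite_lists_length_le)
    moreover have "A = {x \<in> A. length x < b} \<union> {x \<in> A. b \<le> length x}" by auto
    ultimately have "infinite {x \<in> A. b \<le> length x}" using A(2) by (metis finite_Un)
    then obtain e :: "nat \<Rightarrow> nat list" where e: "inj e" "range e \<subseteq> {x \<in> A. b \<le> length x}"
      using infinite_countable_subset by blast
    have eA: "e i \<in> A" "e i \<in> Av B" "b \<le> length (e i)" for i using e(2) A(1) by auto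
    then obtain i j where ij: "i < j" "embeds (length (e i)) (entries (e i)) (length (e j)) (entries (e j))"
      using good_sequences[OF good, of "\<lambda>i. length (e i)" "\<lambda>i. entries (e i)"] AvD(1) by blast
    then have "e i \<le>\<^sub>f e j" using consec_le_iff_embeds AvD(2) eA by blast
    moreover have "e i \<noteq> e j" using e(1) ij(1) by (auto dest: injD)
    ultimately show False using A(3) eA by blast
  qed
  ultimately show "wqo_on (\<le>\<^sub>f) (Av B)" unfolding wqo_on_def by blast
qed

lemma one_sided_same_order:
  assumes s: "same_order n f 0 g 0" and "one_sided n f i j" shows "one_sided n g i j"
proof -
  have w: "window b f t = window b g t" if "t + b \<le> n" for t using same_order_window[OF s that] by simp
  show ?thesis unfolding one_sided_def
  proof (intro impI)
    assume ij: "i < j" "j + b \<le> n" "window b g i = window b g j"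
    then have "window b f i = window b f j" using w[of i] w[of j] by simp
    then have "periodic f (j - i) 0 j \<or> periodic f (j - i) i (n - b)" using assms(2) ij by (simp add: one_sided_def)
    moreover have "same_windows b n f g" using s by (rule same_order_same_windows)
    moreover have "n - b + b \<le> n" using ij(2) by simp
    ultimately show "periodic g (j - i) 0 j \<or> periodic g (j - i) i (n - b)" using periodic_same_windows ij(2) by blast
  qed
qed

theorem wqo_iff_bounded:
  assumes M: "M = 3 * depth + 3 * num_windows + 2 * b + 5"
  shows "wqo_on (\<le>\<^sub>f) (Av B) \<longleftrightarrow>
    (\<forall>x\<in>Av B. length x \<le> M \<longrightarrow> (\<forall>j<length x. \<forall>i<j. one_sided (length x) (entries x) i j)) \<and>
    (\<forall>x\<in>Av B. length x \<le> M \<longrightarrow> (\<forall>y\<in>Av B. length y \<le> M \<longrightarrow> length y = length x \<longrightarrow> b \<le> length x \<longrightarrow>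
      same_windows b (length x) (entries x) (entries y) \<longrightarrow> (\<forall>q<length x. \<forall>u<q.
      right_deep (entries x) q \<or> left_deep (length x) (entries x) u \<longrightarrow>
      (entries x u < entries x q \<longleftrightarrow> entries y u < entries y q))))" (is "_ \<longleftrightarrow> ?P \<and> ?Q")
proof -
  have "(\<forall>n f i j. n \<le> M \<longrightarrow> avoids B n f \<longrightarrow> one_sided n f i j) \<longleftrightarrow> ?P"
  proof
    assume ?P
    have "one_sided n f i j" if "n \<le> M" "avoids B n f" for n f i j
    proof (cases "i < j \<and> j + b \<le> n")
      case True
      note x = standardize_in_Av[OF that(2)]
      have "one_sided n (entries (standardize n f)) i j" using \<open>?P\<close> x that(1) True b(1) by auto
      then show ?thesis using one_sided_same_order x(3) by blast
    qed (auto simp: one_sided_def)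
    then show "\<forall>n f i j. n \<le> M \<longrightarrow> avoids B n f \<longrightarrow> one_sided n f i j" by blast
  qed (use AvD(1) in blast)
  moreover have "(\<forall>n f u q. n \<le> M \<longrightarrow> \<not> deep_ambiguous n f u q) \<longleftrightarrow> ?Q"
  proof
    assume nb: "\<forall>n f u q. n \<le> M \<longrightarrow> \<not> deep_ambiguous n f u q"
    show ?Q
    proof (intro ballI impI allI, rule ccontr)
      fix x y q u assume *: "x \<in> Av B" "y \<in> Av B" "length x \<le> M" "length y = length x" "b \<le> length x"
        "same_windows b (length x) (entries x) (entries y)" "q < length x" "u < q"
        "right_deep (entries x) q \<or> left_deep (length x) (entries x) u"
        "\<not> (entries x u < entries x q \<longleftrightarrow> entries y u < entries y q)"
      have i: "inj_on (entries x) {..<length x}" "inj_on (entries y) {..<length x}"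
        using inj_on_entries[OF AvD(2)[OF *(1)]] inj_on_entries[OF AvD(2)[OF *(2)]] *(4) by auto
      have ne: "entries x u \<noteq> entries x q" "entries y u \<noteq> entries y q"
        using inj_onD[OF i(1), of u q] inj_onD[OF i(2), of u q] *(7,8) by auto
      have "ambiguous b (length x) (entries x) u q"
      proof (cases "entries x u < entries x q")
        case True
        then show ?thesis using *(6,10) ne i by (intro ambiguousI[of "entries x" _ "entries y"]) auto
      next
        case False
        then show ?thesis using *(6,10) ne i by (intro ambiguousI[of "entries y" _ "entries x"]) auto
      qed
      then have "deep_ambiguous (length x) (entries x) u q" using * AvD(1) by (simp add: deep_ambiguous_def)
      then show False using nb *(3) by blast
    qed
  next
    assume Q: ?Q
    show "\<forall>n f u q. n \<le> M \<longrightarrow> \<not> deep_ambiguous n f u q"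
    proof (intro allI impI notI)
      fix n f u q assume nM: "n \<le> M" and "deep_ambiguous n f u q"
      then have f: "b \<le> n" "avoids B n f" "u < q" "q < n" "right_deep f q \<or> left_deep n f u" "ambiguous b n f u q"
        by (auto simp: deep_ambiguous_def)
      then obtain g h where gh: "inj_on g {..<n}" "inj_on h {..<n}" "same_windows b n f g" "same_windows b n f h" "g u < g q" "h q < h u"
        unfolding ambiguous_def by blast
      have "avoids B n g" "avoids B n h" using gh f mem_if_same_windows by blast+
      note x = standardize_in_Av[OF this(1)] and y = standardize_in_Av[OF this(2)]
      have sx: "same_windows b n f (entries (standardize n g))" "same_windows b n f (entries (standardize n h))"
        using gh(3,4) same_order_same_windows[OF x(3), of b] same_order_same_windows[OF y(3), of b] same_windows_trans same_windows_sym by blast+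
      have "right_deep (entries (standardize n g)) q \<or> left_deep n (entries (standardize n g)) u"
        using f(4,5) right_deep_same_windows[OF sx(1)] left_deep_same_windows[OF sx(1)] by blast
      moreover have "same_windows b n (entries (standardize n g)) (entries (standardize n h))" using sx same_windows_sym same_windows_trans by blast
      ultimately have "entries (standardize n g) u < entries (standardize n g) q \<longleftrightarrow> entries (standardize n h) u < entries (standardize n h) q"
        using Q x(1,2) y(1,2) nM f(1,3,4) by metis
      then show False using same_orderD[OF x(3), of u q] same_orderD[OF y(3), of u q] gh(5,6) f(3,4) by simp
    qed
  qed
  ultimately show ?thesis unfolding wqo_iff_good using good_iff_bounded[of M] M by simp
qed

end

section \<open>Recursive functions and predicates\<close>

text \<open>
  The environment \<open>e\<close> provides the arguments \<open>e 0, \<dots>, e (n - 1)\<close>. Environments are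
  functions so that a bound variable can be made variable \<open>0\<close> by replacing \<open>e\<close> with
  \<open>\<lambda>i. e (Suc i)\<close> in the rest of a term. The rules below then prove computability by
  resolution along the structure of a definition.
\<close>

definition recursive_fun :: "nat \<Rightarrow> ((nat \<Rightarrow> nat) \<Rightarrow> nat) \<Rightarrow> bool" where
  "recursive_fun n F \<longleftrightarrow> (\<exists>r. \<forall>xs. length xs = n \<longrightarrow> computes r xs (F ((!) xs)))"

definition recursive_pred :: "nat \<Rightarrow> ((nat \<Rightarrow> nat) \<Rightarrow> bool) \<Rightarrow> bool" where
  "recursive_pred n P \<longleftrightarrow> recursive_fun n (\<lambda>e. if P e then 1 else 0)"

named_theorems computable

lemma recursive_fun_var: "i < n \<Longrightarrow> recursive_fun n (\<lambda>e. e i)"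
  unfolding recursive_fun_def using computes.proj by blast

lemma recursive_fun_comp1:
  assumes "\<And>x. computes f [x] (F x)" "recursive_fun n G" shows "recursive_fun n (\<lambda>e. F (G e))"
proof -
  obtain g where "\<And>xs. length xs = n \<Longrightarrow> computes g xs (G ((!) xs))" using assms(2) recursive_fun_def by auto
  then have "computes (Comp f [g]) xs (F (G ((!) xs)))" if "length xs = n" for xs
    using that assms(1) by (intro computes.comp[of xs "[g]" "[G ((!) xs)]"]) auto
  then show ?thesis unfolding recursive_fun_def by blast
qed

lemma recursive_fun_Suc: "recursive_fun n F \<Longrightarrow> recursive_fun n (\<lambda>e. Suc (F e))"
  by (rule recursive_fun_comp1[OF computes.succ])

lemma recursive_fun_const: "recursive_fun n (\<lambda>e. c)"
proof (induction c)
  case 0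
  show ?case unfolding recursive_fun_def using computes.zero by blast
qed (rule recursive_fun_Suc)

lemma recursive_fun_subst:
  assumes "recursive_fun (length Gs) F" "\<And>G. G \<in> set Gs \<Longrightarrow> recursive_fun n G"
  shows "recursive_fun n (\<lambda>e. F ((!) (map (\<lambda>G. G e) Gs)))"
proof -
  obtain f where f: "\<And>xs. length xs = length Gs \<Longrightarrow> computes f xs (F ((!) xs))"
    using assms(1) by (auto simp: recursive_fun_def)
  obtain r where r: "\<And>G xs. G \<in> set Gs \<Longrightarrow> length xs = n \<Longrightarrow> computes (r G) xs (G ((!) xs))"
    using assms(2) unfolding recursive_fun_def by metis
  have "computes (Comp f (map r Gs)) xs (F ((!) (map (\<lambda>G. G ((!) xs)) Gs)))" if "length xs = n" for xs
    using that by (intro computes.comp[where ys = "map (\<lambda>G. G ((!) xs)) Gs"] f)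
      (auto simp: list_all2_conv_all_nth intro: r)
  then show ?thesis unfolding recursive_fun_def by blast
qed

lemma recursive_fun_subst1: "recursive_fun 1 (\<lambda>e. F (e 0)) \<Longrightarrow> recursive_fun n a \<Longrightarrow> recursive_fun n (\<lambda>e. F (a e))"
  using recursive_fun_subst[of "[a]" "\<lambda>e. F (e 0)" n] by auto

lemma recursive_fun_subst2: "recursive_fun 2 (\<lambda>e. F (e 0) (e 1)) \<Longrightarrow> recursive_fun n a \<Longrightarrow> recursive_fun n c \<Longrightarrow> recursive_fun n (\<lambda>e. F (a e) (c e))"
  using recursive_fun_subst[of "[a, c]" "\<lambda>e. F (e 0) (e 1)" n] by (auto simp: numeral_2_eq_2)

lemma recursive_pred_subst1: "recursive_pred 1 (\<lambda>e. F (e 0)) \<Longrightarrow> recursive_fun n a \<Longrightarrow> recursive_pred n (\<lambda>e. F (a e))"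
  unfolding recursive_pred_def using recursive_fun_subst1[of "\<lambda>x. if F x then 1 else 0"] by blast

lemma recursive_pred_subst2: "recursive_pred 2 (\<lambda>e. F (e 0) (e 1)) \<Longrightarrow> recursive_fun n a \<Longrightarrow> recursive_fun n c \<Longrightarrow> recursive_pred n (\<lambda>e. F (a e) (c e))"
  unfolding recursive_pred_def using recursive_fun_subst2[of "\<lambda>x y. if F x y then 1 else 0"] by blast

lemma recursive_pred_subst3:
  assumes "recursive_pred 3 (\<lambda>e. F (e 0) (e 1) (e 2))" "recursive_fun n a1" "recursive_fun n a2" "recursive_fun n a3"
  shows "recursive_pred n (\<lambda>e. F (a1 e) (a2 e) (a3 e))"
  using recursive_fun_subst[of "[a1, a2, a3]" "\<lambda>e. if F (e 0) (e 1) (e 2) then 1 else 0" n] assms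
  unfolding recursive_pred_def by (auto simp: eval_nat_numeral)

lemma recursive_pred_subst4:
  assumes "recursive_pred 4 (\<lambda>e. F (e 0) (e 1) (e 2) (e 3))" "recursive_fun n a1" "recursive_fun n a2" "recursive_fun n a3" "recursive_fun n a4"
  shows "recursive_pred n (\<lambda>e. F (a1 e) (a2 e) (a3 e) (a4 e))"
  using recursive_fun_subst[of "[a1, a2, a3, a4]" "\<lambda>e. if F (e 0) (e 1) (e 2) (e 3) then 1 else 0" n] assms
  unfolding recursive_pred_def by (auto simp: eval_nat_numeral)

lemma recursive_pred_subst5:
  assumes "recursive_pred 5 (\<lambda>e. F (e 0) (e 1) (e 2) (e 3) (e 4))" "recursive_fun n a1" "recursive_fun n a2" "recursive_fun n a3" "recursive_fun n a4" "recursive_fun n a5"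
  shows "recursive_pred n (\<lambda>e. F (a1 e) (a2 e) (a3 e) (a4 e) (a5 e))"
  using recursive_fun_subst[of "[a1, a2, a3, a4, a5]" "\<lambda>e. if F (e 0) (e 1) (e 2) (e 3) (e 4) then 1 else 0" n] assms
  unfolding recursive_pred_def by (auto simp: eval_nat_numeral)

text \<open>
  Primitive recursion with the remaining arguments as parameters.
\<close>

lemma recursive_fun_rec:
  assumes "recursive_fun n g" "recursive_fun (Suc (Suc n)) (\<lambda>e. h (e 0) (e (Suc 0)) (\<lambda>i. e (Suc (Suc i))))" "recursive_fun n t"
  shows "recursive_fun n (\<lambda>e. rec_nat (g e) (\<lambda>i v. h i v e) (t e))"
proof -
  obtain rg where rg: "\<And>xs. length xs = n \<Longrightarrow> computes rg xs (g ((!) xs))" using assms(1) recursive_fun_def by auto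
  obtain rh where rh: "\<And>i v xs. length xs = n \<Longrightarrow> computes rh (i # v # xs) (h i v ((!) xs))"
  proof -
    obtain r where r: "\<And>xs. length xs = Suc (Suc n) \<Longrightarrow>
      computes r xs (h (xs ! 0) (xs ! Suc 0) (\<lambda>i. xs ! Suc (Suc i)))" using assms(2) recursive_fun_def by auto
    show thesis
    proof (rule that)
      fix i v and xs :: "nat list" assume "length xs = n"
      then show "computes r (i # v # xs) (h i v ((!) xs))" using r[of "i # v # xs"] by simp
    qed
  qed
  have rec: "computes (PrimRec rg rh) (k # xs) (rec_nat (g ((!) xs)) (\<lambda>i v. h i v ((!) xs)) k)"
    if "length xs = n" for k xs
  proof (induction k)
    case 0
    show ?case using computes.primrec_0[OF rg[OF that]] by simp
  next
    case (Suc k)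
    show ?case using computes.primrec_Suc[OF Suc rh[OF that]] by simp
  qed
  obtain rt where rt: "\<And>xs. length xs = n \<Longrightarrow> computes rt xs (t ((!) xs))" using assms(3) recursive_fun_def by auto
  have "computes (Comp (PrimRec rg rh) (rt # map Proj [0..<n])) xs
    (rec_nat (g ((!) xs)) (\<lambda>i v. h i v ((!) xs)) (t ((!) xs)))" if l: "length xs = n" for xs
  proof (rule computes.comp[OF _ rec[OF l]])
    show "list_all2 (\<lambda>g y. computes g xs y) (rt # map Proj [0..<n]) (t ((!) xs) # xs)"
    proof -
      have "list_all2 (\<lambda>g y. computes g xs y) (map Proj [0..<n]) xs"
        using l by (auto simp: list_all2_conv_all_nth intro: computes.proj)
      then show ?thesis using rt[OF l] by simp
    qed
  qed
  then show ?thesis unfolding recursive_fun_def by blast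
qed

lemma recursive_pred_if: "recursive_pred n P \<Longrightarrow> recursive_fun n (\<lambda>e. if P e then 1 else 0)"
  by (simp add: recursive_pred_def)

lemma recursive_fun_add: "recursive_fun n a \<Longrightarrow> recursive_fun n c \<Longrightarrow> recursive_fun n (\<lambda>e. a e + c e)"
proof -
  have "rec_nat x (\<lambda>i v. Suc v) y = x + y" for x y by (induction y) auto
  moreover assume "recursive_fun n a" "recursive_fun n c"
  then have "recursive_fun n (\<lambda>e. rec_nat (a e) (\<lambda>i v. Suc v) (c e))" by (intro recursive_fun_rec recursive_fun_Suc recursive_fun_var) auto
  ultimately show ?thesis by simp
qed

lemma recursive_fun_mult: "recursive_fun n a \<Longrightarrow> recursive_fun n c \<Longrightarrow> recursive_fun n (\<lambda>e. a e * c e)"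
proof (rule recursive_fun_subst2[where F = "(*)"])
  have "rec_nat 0 (\<lambda>i v. v + x) y = x * y" for x y :: nat by (induction y) auto
  moreover have "recursive_fun 2 (\<lambda>e. rec_nat 0 (\<lambda>i v. v + e 0) (e 1))"
    by (intro recursive_fun_rec recursive_fun_add recursive_fun_var recursive_fun_const) auto
  ultimately show "recursive_fun 2 (\<lambda>e. e 0 * e 1)" by simp
qed

lemma recursive_fun_power: "recursive_fun n a \<Longrightarrow> recursive_fun n c \<Longrightarrow> recursive_fun n (\<lambda>e. a e ^ c e)"
proof (rule recursive_fun_subst2[where F = "(^)"])
  have "rec_nat 1 (\<lambda>i v. v * x) y = x ^ y" for x y :: nat by (induction y) auto
  moreover have "recursive_fun 2 (\<lambda>e. rec_nat 1 (\<lambda>i v. v * e 0) (e 1))"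
    by (intro recursive_fun_rec recursive_fun_mult recursive_fun_var recursive_fun_const) auto
  ultimately show "recursive_fun 2 (\<lambda>e. e 0 ^ e 1)" by simp
qed

lemma recursive_fun_diff: "recursive_fun n a \<Longrightarrow> recursive_fun n c \<Longrightarrow> recursive_fun n (\<lambda>e. a e - c e)"
proof (rule recursive_fun_subst2[where F = "(-)"])
  have "rec_nat 0 (\<lambda>i v. i) x = x - 1" for x by (induction x) auto
  moreover have "recursive_fun 1 (\<lambda>e. rec_nat 0 (\<lambda>i v. i) (e 0))"
    by (intro recursive_fun_rec recursive_fun_var recursive_fun_const) auto
  ultimately have pred: "recursive_fun 1 (\<lambda>e. e 0 - 1)" by simp
  have pred: "recursive_fun m (\<lambda>e. f e - 1)" if "recursive_fun m f" for m f using recursive_fun_subst1[OF pred that] .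
  have "rec_nat x (\<lambda>i v. v - 1) y = x - y" for x y :: nat by (induction y) auto
  moreover have "recursive_fun 2 (\<lambda>e. rec_nat (e 0) (\<lambda>i v. v - 1) (e 1))"
    by (intro recursive_fun_rec pred recursive_fun_var) auto
  ultimately show "recursive_fun 2 (\<lambda>e. e 0 - e 1)" by simp
qed

lemma recursive_pred_not: "recursive_pred n P \<Longrightarrow> recursive_pred n (\<lambda>e. \<not> P e)"
proof -
  assume "recursive_pred n P"
  then have "recursive_fun n (\<lambda>e. 1 - (if P e then 1 else 0))" by (intro recursive_fun_diff recursive_fun_const recursive_pred_if)
  moreover have "(1 - (if P e then 1 else 0) :: nat) = (if \<not> P e then 1 else 0)" for e by simp
  ultimately show ?thesis by (simp add: recursive_pred_def)
qed

lemma recursive_pred_conj: "recursive_pred n P \<Longrightarrow> recursive_pred n Q \<Longrightarrow> recursive_pred n (\<lambda>e. P e \<and> Q e)"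
proof -
  assume "recursive_pred n P" "recursive_pred n Q"
  then have "recursive_fun n (\<lambda>e. (if P e then 1 else 0) * (if Q e then 1 else 0))" by (intro recursive_fun_mult recursive_pred_if)
  moreover have "((if P e then 1 else 0) * (if Q e then 1 else 0) :: nat) = (if P e \<and> Q e then 1 else 0)" for e by simp
  ultimately show ?thesis by (simp add: recursive_pred_def)
qed

lemma recursive_pred_disj: "recursive_pred n P \<Longrightarrow> recursive_pred n Q \<Longrightarrow> recursive_pred n (\<lambda>e. P e \<or> Q e)"
proof -
  assume "recursive_pred n P" "recursive_pred n Q"
  then have "recursive_pred n (\<lambda>e. \<not> (\<not> P e \<and> \<not> Q e))" by (intro recursive_pred_not recursive_pred_conj)
  then show ?thesis by simp
qed

lemma recursive_pred_imp: "recursive_pred n P \<Longrightarrow> recursive_pred n Q \<Longrightarrow> recursive_pred n (\<lambda>e. P e \<longrightarrow> Q e)"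
  unfolding imp_conv_disj by (intro recursive_pred_disj recursive_pred_not)

lemma recursive_pred_iff: "recursive_pred n P \<Longrightarrow> recursive_pred n Q \<Longrightarrow> recursive_pred n (\<lambda>e. P e \<longleftrightarrow> Q e)"
  unfolding iff_conv_conj_imp by (intro recursive_pred_conj recursive_pred_imp)

lemma recursive_pred_less: "recursive_fun n a \<Longrightarrow> recursive_fun n c \<Longrightarrow> recursive_pred n (\<lambda>e. a e < c e)"
proof -
  assume "recursive_fun n a" "recursive_fun n c"
  then have "recursive_fun n (\<lambda>e. 1 - (1 - (c e - a e)))" by (intro recursive_fun_diff recursive_fun_const)
  moreover have "1 - (1 - (c e - a e)) = (if a e < c e then 1 else 0)" for e by simp
  ultimately show ?thesis by (simp add: recursive_pred_def)
qed

lemma recursive_pred_le: "recursive_fun n a \<Longrightarrow> recursive_fun n c \<Longrightarrow> recursive_pred n (\<lambda>e. a e \<le> c e)"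
  unfolding not_less[symmetric] by (intro recursive_pred_not recursive_pred_less)

lemma recursive_pred_eq: "recursive_fun n a \<Longrightarrow> recursive_fun n c \<Longrightarrow> recursive_pred n (\<lambda>e. a e = c e)"
  unfolding eq_iff by (intro recursive_pred_conj recursive_pred_le)

lemma recursive_pred_all:
  assumes "recursive_fun n t" "recursive_pred (Suc n) (\<lambda>e. P (e 0) (\<lambda>i. e (Suc i)))"
  shows "recursive_pred n (\<lambda>e. \<forall>y<t e. P y e)"
proof -
  have "recursive_fun (Suc (Suc n)) (\<lambda>e. if P (e 0) (\<lambda>i. e (Suc (Suc i))) then 1 else 0)"
  proof -
    let ?F = "\<lambda>e. if P (e 0) (\<lambda>i. e (Suc i)) then 1 else (0::nat)"
    obtain r where r: "\<And>xs. length xs = Suc n \<Longrightarrow> computes r xs (?F ((!) xs))"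
      using assms(2) unfolding recursive_pred_def recursive_fun_def by blast
    have "computes (Comp r (Proj 0 # map (\<lambda>i. Proj (Suc (Suc i))) [0..<n])) xs
      (if P (xs ! 0) (\<lambda>i. xs ! Suc (Suc i)) then 1 else 0)" if l: "length xs = Suc (Suc n)" for xs
    proof -
      obtain y v zs where xs: "xs = y # v # zs" "length zs = n" using l by (auto simp: length_Suc_conv)
      show ?thesis
      proof (rule computes.comp)
        show "list_all2 (\<lambda>g y. computes g xs y) (Proj 0 # map (\<lambda>i. Proj (Suc (Suc i))) [0..<n]) (y # zs)"
          using xs computes.proj[of _ "y # v # zs"] by (fastforce simp: list_all2_conv_all_nth nth_Cons')
        show "computes r (y # zs) (if P (xs ! 0) (\<lambda>i. xs ! Suc (Suc i)) then 1 else 0)"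
          using r[of "y # zs"] xs by simp
      qed
    qed
    then show ?thesis unfolding recursive_fun_def by blast
  qed
  then have "recursive_fun n (\<lambda>e. rec_nat 1 (\<lambda>y v. v * (if P y e then 1 else 0)) (t e))"
    using assms(1) by (intro recursive_fun_rec recursive_fun_const recursive_fun_mult recursive_fun_var) auto
  moreover have "rec_nat 1 (\<lambda>y v. v * (if P y e then 1 else 0)) k = (if \<forall>y<k. P y e then 1 else (0::nat))" for e k
    by (induction k) (auto simp: less_Suc_eq)
  ultimately show ?thesis by (simp add: recursive_pred_def)
qed

lemma recursive_pred_ex:
  assumes "recursive_fun n t" "recursive_pred (Suc n) (\<lambda>e. P (e 0) (\<lambda>i. e (Suc i)))"
  shows "recursive_pred n (\<lambda>e. \<exists>y<t e. P y e)"
  using recursive_pred_not[OF recursive_pred_all[OF assms(1), of "\<lambda>y e. \<not> P y e"]] recursive_pred_not[OF assms(2)] by simp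

text \<open>
  Unbounded search, which ends because there is a solution in every environment.
\<close>

lemma recursive_fun_Least:
  assumes "recursive_pred (Suc n) (\<lambda>e. P (e 0) (\<lambda>i. e (Suc i)))" "\<And>e. \<exists>y. P y e"
  shows "recursive_fun n (\<lambda>e. LEAST y. P y e)"
proof -
  obtain r where r: "\<And>xs. length xs = Suc n \<Longrightarrow>
      computes r xs (if \<not> P (xs ! 0) (\<lambda>i. xs ! Suc i) then 1 else 0)"
    using recursive_pred_not[OF assms(1)] unfolding recursive_pred_def recursive_fun_def by blast
  have r': "computes r (y # xs) (if \<not> P y ((!) xs) then 1 else 0)" if "length xs = n" for y xs
    using r[of "y # xs"] that by simp
  have "computes (Mu r) xs (LEAST y. P y ((!) xs))" if l: "length xs = n" for xs
  proof (rule computes.mu)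
    have "P (LEAST y. P y ((!) xs)) ((!) xs)" using assms(2) by (rule LeastI_ex)
    then show "computes r ((LEAST y. P y ((!) xs)) # xs) 0" using r'[OF l, of "LEAST y. P y ((!) xs)"] by simp
    fix m assume "m < (LEAST y. P y ((!) xs))"
    then have "\<not> P m ((!) xs)" by (rule not_less_Least)
    then show "\<exists>y>0. computes r (m # xs) y" using r'[OF l, of m] by auto
  qed
  then show ?thesis unfolding recursive_fun_def by blast
qed

lemmas [computable] = recursive_fun_var recursive_fun_const recursive_fun_Suc recursive_fun_add recursive_fun_mult recursive_fun_power recursive_fun_diff
  recursive_pred_not recursive_pred_conj recursive_pred_disj recursive_pred_imp recursive_pred_iff recursive_pred_less recursive_pred_le recursive_pred_eq recursive_pred_all recursive_pred_ex

section \<open>Codes of lists\<close>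

lemma recursive_fun_prod_encode [computable]:
  "recursive_fun n a \<Longrightarrow> recursive_fun n c \<Longrightarrow> recursive_fun n (\<lambda>e. prod_encode (a e, c e))"
proof (rule recursive_fun_subst2[where F = "\<lambda>x y. prod_encode (x, y)"])
  have "rec_nat 0 (\<lambda>i v. v + Suc i) k = triangle k" for k by (induction k) auto
  moreover have "recursive_fun 1 (\<lambda>e. rec_nat 0 (\<lambda>i v. v + Suc i) (e 0))"
    by (intro recursive_fun_rec computable) auto
  ultimately have "recursive_fun 1 (\<lambda>e. triangle (e 0))" by simp
  from recursive_fun_subst1[OF this] have tri: "recursive_fun m f \<Longrightarrow> recursive_fun m (\<lambda>e. triangle (f e))" for m f .
  have "recursive_fun 2 (\<lambda>e. triangle (e 0 + e 1) + e 0)" by (intro tri computable) auto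
  then show "recursive_fun 2 (\<lambda>e. prod_encode (e 0, e 1))" by (simp add: prod_encode_def)
qed

text \<open>
  The code of the empty list is \<open>0\<close>; for it, head and tail default to \<open>0\<close>.
\<close>

definition code_hd :: "nat \<Rightarrow> nat" where
  "code_hd z = (LEAST h. z = 0 \<or> (\<exists>t<z. z = Suc (prod_encode (h, t))))"

definition code_tl :: "nat \<Rightarrow> nat" where
  "code_tl z = (LEAST t. z = 0 \<or> (\<exists>h<z. z = Suc (prod_encode (h, t))))"

lemma ex_code: "z = 0 \<or> (\<exists>h t. z = Suc (prod_encode (h, t)) \<and> h < z \<and> t < z)"
proof (cases z)
  case (Suc m)
  obtain h t where "prod_decode m = (h, t)" by fastforce
  then have "m = prod_encode (h, t)" by (metis prod_decode_inverse)
  then show ?thesis using Suc le_prod_encode_1[of h t] le_prod_encode_2[of t h] by auto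
qed simp

lemma ex_hd: "\<exists>h. z = 0 \<or> (\<exists>t<z. z = Suc (prod_encode (h, t)))"
  and ex_tl: "\<exists>t. z = 0 \<or> (\<exists>h<z. z = Suc (prod_encode (h, t)))"
  using ex_code[of z] by blast+

lemma code_hd_tl [simp]: "code_hd 0 = 0" "code_tl 0 = 0"
  "code_hd (Suc (prod_encode (h, t))) = h" "code_tl (Suc (prod_encode (h, t))) = t"
  using le_prod_encode_1[of h t] le_prod_encode_2[of t h]
  by (auto simp: code_hd_def code_tl_def prod_encode_eq less_Suc_eq_le intro!: Least_equality)

lemma recursive_fun_code_hd [computable]: "recursive_fun n a \<Longrightarrow> recursive_fun n (\<lambda>e. code_hd (a e))"
proof (rule recursive_fun_subst1[where F = code_hd])
  show "recursive_fun 1 (\<lambda>e. code_hd (e 0))" unfolding code_hd_def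
    by (intro recursive_fun_Least computable; (rule ex_hd | simp))
qed

lemma recursive_fun_code_tl [computable]: "recursive_fun n a \<Longrightarrow> recursive_fun n (\<lambda>e. code_tl (a e))"
proof (rule recursive_fun_subst1[where F = code_tl])
  show "recursive_fun 1 (\<lambda>e. code_tl (e 0))" unfolding code_tl_def
    by (intro recursive_fun_Least computable; (rule ex_tl | simp))
qed

text \<open>
  Accessing a coded list by iterating the tail function avoids any recursion over lists.
\<close>

definition code_drop :: "nat \<Rightarrow> nat \<Rightarrow> nat" where "code_drop z k = rec_nat z (\<lambda>_ v. code_tl v) k"
definition code_nth :: "nat \<Rightarrow> nat \<Rightarrow> nat" where "code_nth z k = code_hd (code_drop z k)"
definition code_length :: "nat \<Rightarrow> nat" where "code_length z = (LEAST k. code_drop z k = 0)"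

lemma recursive_fun_code_drop [computable]: "recursive_fun n a \<Longrightarrow> recursive_fun n c \<Longrightarrow> recursive_fun n (\<lambda>e. code_drop (a e) (c e))"
  by (rule recursive_fun_subst2[where F = code_drop]) (unfold code_drop_def, intro recursive_fun_rec computable, auto)

lemma recursive_fun_code_nth [computable]: "recursive_fun n a \<Longrightarrow> recursive_fun n c \<Longrightarrow> recursive_fun n (\<lambda>e. code_nth (a e) (c e))"
  unfolding code_nth_def by (intro computable)

lemma code_drop_list_encode: "code_drop (list_encode xs) k = list_encode (drop k xs)"
proof (induction k)
  case (Suc k)
  have "code_tl (list_encode ys) = list_encode (tl ys)" for ys by (cases ys) auto
  then show ?case using Suc by (simp add: code_drop_def drop_Suc tl_drop)
qed (simp add: code_drop_def)

lemma list_encode_eq_0: "list_encode xs = 0 \<longleftrightarrow> xs = []"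
  by (cases xs) auto

lemma code_length_list_encode [simp]: "code_length (list_encode xs) = length xs"
  unfolding code_length_def code_drop_list_encode list_encode_eq_0 by (rule Least_equality) auto

lemma code_nth_list_encode: "code_nth (list_encode xs) k = (if k < length xs then xs ! k else 0)"
proof (cases "k < length xs")
  case True
  then have "drop k xs = xs ! k # drop (Suc k) xs" by (simp add: Cons_nth_drop_Suc)
  then show ?thesis using True by (simp add: code_nth_def code_drop_list_encode)
qed (simp add: code_nth_def code_drop_list_encode)

lemma entries_code_nth: "entries xs p = real (code_nth (list_encode xs) p)"
  by (simp add: entries_def code_nth_list_encode)

lemma recursive_fun_code_length [computable]: "recursive_fun n a \<Longrightarrow> recursive_fun n (\<lambda>e. code_length (a e))"
proof (rule recursive_fun_subst1[where F = code_length])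
  have "\<exists>k. code_drop z k = 0" for z
    using code_drop_list_encode[of "list_decode z" "length (list_decode z)"] by auto
  then show "recursive_fun 1 (\<lambda>e. code_length (e 0))" unfolding code_length_def by (intro recursive_fun_Least computable) auto
qed

text \<open>
  The code of the list that consists of \<open>M\<close> copies of \<open>M\<close>.
\<close>

definition max_code :: "nat \<Rightarrow> nat" where "max_code M = rec_nat 0 (\<lambda>_ v. Suc (prod_encode (M, v))) M"

lemma recursive_fun_max_code [computable]: "recursive_fun n a \<Longrightarrow> recursive_fun n (\<lambda>e. max_code (a e))"
  by (rule recursive_fun_subst1[where F = max_code]) (unfold max_code_def, intro recursive_fun_rec computable, auto)

lemma prod_encode_mono: "a \<le> a' \<Longrightarrow> c \<le> c' \<Longrightarrow> prod_encode (a, c) \<le> prod_encode (a', c')"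
proof -
  assume "a \<le> a'" "c \<le> c'"
  moreover have "i \<le> j \<Longrightarrow> triangle i \<le> triangle j" for i j
    by (induction j) (auto simp: le_Suc_eq)
  ultimately show ?thesis by (simp add: prod_encode_def add_mono)
qed

lemma list_encode_le_max_code:
  assumes "set xs \<subseteq> {..M}" "length xs \<le> M" shows "list_encode xs \<le> max_code M"
proof -
  let ?r = "rec_nat 0 (\<lambda>_ v. Suc (prod_encode (M, v)))"
  have "list_encode xs \<le> ?r (length xs)" using assms(1)
    by (induction xs) (auto intro: prod_encode_mono)
  also have "?r k \<le> ?r l" if "k \<le> l" for k l
    using that
  proof (induction l rule: dec_induct)
    case (step l)
    have "?r l \<le> ?r (Suc l)" using le_prod_encode_2[of "?r l" M] by simp
    with step.IH show ?case by linarith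
  qed simp
  then have "?r (length xs) \<le> ?r M" using assms(2) by blast
  finally show ?thesis by (simp add: max_code_def)
qed

lemma length_le_list_encode: "length xs \<le> list_encode xs"
proof (induction xs)
  case (Cons x xs)
  then show ?case using le_prod_encode_2[of "list_encode xs" x] by simp
qed simp

section \<open>The criteria in terms of codes\<close>

definition code_same_order :: "nat \<Rightarrow> nat \<Rightarrow> nat \<Rightarrow> nat \<Rightarrow> nat \<Rightarrow> bool" where
  "code_same_order m x i y j \<longleftrightarrow> (\<forall>p<m. \<forall>q<m. code_nth x (i + p) < code_nth x (i + q) \<longleftrightarrow> code_nth y (j + p) < code_nth y (j + q))"

definition code_embeds :: "nat \<Rightarrow> nat \<Rightarrow> bool" where
  "code_embeds x y \<longleftrightarrow> (\<exists>s<Suc (code_length y). s + code_length x \<le> code_length y \<and> code_same_order (code_length x) x 0 y s)"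

definition code_perm :: "nat \<Rightarrow> bool" where
  "code_perm x \<longleftrightarrow> (\<forall>i<code_length x. 1 \<le> code_nth x i \<and> code_nth x i \<le> code_length x \<and> (\<forall>j<i. code_nth x i \<noteq> code_nth x j))"

text \<open>
  The digit of \<open>c\<close> at position \<open>e\<close> of its binary representation is \<open>1\<close>.
\<close>

definition code_member :: "nat \<Rightarrow> nat \<Rightarrow> bool" where
  "code_member c e \<longleftrightarrow> (\<exists>q<Suc c. \<exists>r<2 ^ e. c = (2 * q + 1) * 2 ^ e + r)"

text \<open>
  The elements of the set coded by \<open>c\<close> are smaller than \<open>c\<close>, which bounds the quantifier.
\<close>

definition code_Av :: "nat \<Rightarrow> nat \<Rightarrow> bool" where
  "code_Av c x \<longleftrightarrow> code_perm x \<and> (\<forall>\<beta><c. code_member c \<beta> \<longrightarrow> \<not> code_embeds \<beta> x)"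

definition code_periodic :: "nat \<Rightarrow> nat \<Rightarrow> nat \<Rightarrow> nat \<Rightarrow> nat \<Rightarrow> bool" where
  "code_periodic b x k i j \<longleftrightarrow> (\<forall>t<Suc j. i \<le> t \<longrightarrow> t + k \<le> j \<longrightarrow> code_same_order b x t x (t + k))"

definition code_one_sided :: "nat \<Rightarrow> nat \<Rightarrow> nat \<Rightarrow> nat \<Rightarrow> bool" where
  "code_one_sided b x i j \<longleftrightarrow> (i < j \<longrightarrow> j + b \<le> code_length x \<longrightarrow> code_same_order b x i x j \<longrightarrow>
     code_periodic b x (j - i) 0 j \<or> code_periodic b x (j - i) i (code_length x - b))"

definition code_right_deep :: "nat \<Rightarrow> nat \<Rightarrow> nat \<Rightarrow> nat \<Rightarrow> nat \<Rightarrow> bool" where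
  "code_right_deep b num_windows depth x q \<longleftrightarrow> (\<exists>k<Suc num_windows. 1 \<le> k \<and> depth \<le> q \<and> code_periodic b x k (q - depth) (q + 1 - b))"

definition code_left_deep :: "nat \<Rightarrow> nat \<Rightarrow> nat \<Rightarrow> nat \<Rightarrow> nat \<Rightarrow> bool" where
  "code_left_deep b num_windows depth x u \<longleftrightarrow> (\<exists>k<Suc num_windows. 1 \<le> k \<and> u + depth < code_length x \<and> code_periodic b x k u (u + depth + 1 - b))"

definition code_same_windows :: "nat \<Rightarrow> nat \<Rightarrow> nat \<Rightarrow> bool" where
  "code_same_windows b x y \<longleftrightarrow> (\<forall>t<Suc (code_length x). t + b \<le> code_length x \<longrightarrow> code_same_order b x t y t)"

lemma recursive_pred_code_same_order [computable]:
  "recursive_fun n m \<Longrightarrow> recursive_fun n x \<Longrightarrow> recursive_fun n i \<Longrightarrow> recursive_fun n y \<Longrightarrow> recursive_fun n j \<Longrightarrow>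
    recursive_pred n (\<lambda>e. code_same_order (m e) (x e) (i e) (y e) (j e))"
  by (rule recursive_pred_subst5[where F = code_same_order]) (unfold code_same_order_def, (intro computable; simp))

lemma recursive_pred_code_embeds [computable]: "recursive_fun n x \<Longrightarrow> recursive_fun n y \<Longrightarrow> recursive_pred n (\<lambda>e. code_embeds (x e) (y e))"
  by (rule recursive_pred_subst2[where F = code_embeds]) (unfold code_embeds_def, (intro computable; simp))

lemma recursive_pred_code_perm [computable]: "recursive_fun n x \<Longrightarrow> recursive_pred n (\<lambda>e. code_perm (x e))"
  by (rule recursive_pred_subst1[where F = code_perm]) (unfold code_perm_def, (intro computable; simp))

lemma recursive_pred_code_member [computable]: "recursive_fun n x \<Longrightarrow> recursive_fun n y \<Longrightarrow> recursive_pred n (\<lambda>e. code_member (x e) (y e))"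
  by (rule recursive_pred_subst2[where F = code_member]) (unfold code_member_def, (intro computable; simp))

lemma recursive_pred_code_Av [computable]: "recursive_fun n x \<Longrightarrow> recursive_fun n y \<Longrightarrow> recursive_pred n (\<lambda>e. code_Av (x e) (y e))"
  by (rule recursive_pred_subst2[where F = code_Av]) (unfold code_Av_def, (intro computable; simp))

lemma recursive_pred_code_periodic [computable]:
  "recursive_fun n m \<Longrightarrow> recursive_fun n x \<Longrightarrow> recursive_fun n k \<Longrightarrow> recursive_fun n i \<Longrightarrow> recursive_fun n j \<Longrightarrow>
    recursive_pred n (\<lambda>e. code_periodic (m e) (x e) (k e) (i e) (j e))"
  by (rule recursive_pred_subst5[where F = code_periodic]) (unfold code_periodic_def, (intro computable; simp))

lemma recursive_pred_code_one_sided [computable]: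
  "recursive_fun n m \<Longrightarrow> recursive_fun n x \<Longrightarrow> recursive_fun n i \<Longrightarrow> recursive_fun n j \<Longrightarrow> recursive_pred n (\<lambda>e. code_one_sided (m e) (x e) (i e) (j e))"
  by (rule recursive_pred_subst4[where F = code_one_sided]) (unfold code_one_sided_def, (intro computable; simp))

lemma recursive_pred_code_right_deep [computable]:
  "recursive_fun n m \<Longrightarrow> recursive_fun n k \<Longrightarrow> recursive_fun n l \<Longrightarrow> recursive_fun n x \<Longrightarrow> recursive_fun n q \<Longrightarrow>
    recursive_pred n (\<lambda>e. code_right_deep (m e) (k e) (l e) (x e) (q e))"
  by (rule recursive_pred_subst5[where F = code_right_deep]) (unfold code_right_deep_def, (intro computable; simp))

lemma recursive_pred_code_left_deep [computable]:
  "recursive_fun n m \<Longrightarrow> recursive_fun n k \<Longrightarrow> recursive_fun n l \<Longrightarrow> recursive_fun n x \<Longrightarrow> recursive_fun n q \<Longrightarrow>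
    recursive_pred n (\<lambda>e. code_left_deep (m e) (k e) (l e) (x e) (q e))"
  by (rule recursive_pred_subst5[where F = code_left_deep]) (unfold code_left_deep_def, (intro computable; simp))

lemma recursive_pred_code_same_windows [computable]:
  "recursive_fun n m \<Longrightarrow> recursive_fun n x \<Longrightarrow> recursive_fun n y \<Longrightarrow> recursive_pred n (\<lambda>e. code_same_windows (m e) (x e) (y e))"
  by (rule recursive_pred_subst3[where F = code_same_windows]) (unfold code_same_windows_def, (intro computable; simp))

section \<open>Correctness of the coded criteria\<close>

lemma code_same_order_iff: "code_same_order m (list_encode x) i (list_encode y) j \<longleftrightarrow> same_order m (entries x) i (entries y) j"
  by (simp add: code_same_order_def same_order_def entries_code_nth)

lemma code_embeds_iff: "code_embeds (list_encode x) (list_encode y) \<longleftrightarrow> embeds (length x) (entries x) (length y) (entries y)"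
  unfolding code_embeds_def embeds_def code_same_order_iff code_length_list_encode by (metis add_leD1 le_imp_less_Suc)

lemma code_perm_iff: "code_perm (list_encode x) \<longleftrightarrow> x \<in> perms"
proof
  assume p: "code_perm (list_encode x)"
  have p1: "1 \<le> x ! i \<and> x ! i \<le> length x" if "i < length x" for i
    using p that by (auto simp: code_perm_def code_nth_list_encode)
  have p2: "x ! i \<noteq> x ! j" if "i < length x" "j < i" for i j
    using p that by (auto simp: code_perm_def code_nth_list_encode)
  have d: "distinct x" unfolding distinct_conv_nth using p2 by (metis linorder_neqE_nat)
  have "set x \<subseteq> {1..length x}" using p1 by (auto simp: in_set_conv_nth)
  then have "set x = {1..length x}" using d by (intro card_subset_eq) (auto simp: distinct_card)
  then show "x \<in> perms" using d by (simp add: perms_iff)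
next
  assume x: "x \<in> perms"
  have "x ! i \<in> {1..length x}" if "i < length x" for i using x that by (metis nth_mem perms_iff)
  moreover have "x ! i \<noteq> x ! j" if "i < length x" "j < i" for i j
    using x that by (simp add: perms_iff nth_eq_iff_index_eq)
  ultimately show "code_perm (list_encode x)" by (auto simp: code_perm_def code_nth_list_encode)
qed

lemma code_member_iff: "code_member c e \<longleftrightarrow> e \<in> set_decode c"
proof
  assume "code_member c e"
  then obtain q r where "r < 2 ^ e" "c = (2 * q + 1) * 2 ^ e + r" by (auto simp: code_member_def)
  then have "c div 2 ^ e = 2 * q + 1" by (metis add_0_right div_less div_mult_self3 add.commute power_not_zero zero_neq_numeral)
  then show "e \<in> set_decode c" by (simp add: set_decode_def)
next
  assume "e \<in> set_decode c"
  then have "odd (c div 2 ^ e)" by (simp add: set_decode_def)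
  then obtain q where q: "c div 2 ^ e = 2 * q + 1" by (elim oddE)
  then have "c = (2 * q + 1) * 2 ^ e + c mod 2 ^ e" by (metis div_mult_mod_eq)
  moreover have "q < Suc c" using q div_le_dividend[of c "2 ^ e"] by simp
  moreover have "c mod 2 ^ e < 2 ^ e" by simp
  ultimately show "code_member c e" unfolding code_member_def by blast
qed

context
  fixes B :: "nat list set"
  assumes fin: "finite B" and B: "B \<subseteq> perms"
begin

lemma code_member_perm_set_code: "code_member (perm_set_code B) e \<longleftrightarrow> e \<in> list_encode ` B"
  unfolding code_member_iff perm_set_code_def using fin by (simp add: set_encode_inverse)

text \<open>
  The code of a set is at least \<open>2 ^ list_encode \<beta>\<close>.
\<close>

lemma code_bound: "\<beta> \<in> B \<Longrightarrow> list_encode \<beta> < perm_set_code B"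
proof -
  assume "\<beta> \<in> B"
  then have "odd (perm_set_code B div 2 ^ list_encode \<beta>)"
    using code_member_perm_set_code[of "list_encode \<beta>"] unfolding code_member_iff by (auto simp: set_decode_def)
  then have "2 ^ list_encode \<beta> \<le> perm_set_code B" by (metis div_less even_zero not_le_imp_less)
  then show ?thesis using less_exp[of "list_encode \<beta>"] by linarith
qed

lemma code_Av_iff: "code_Av (perm_set_code B) (list_encode x) \<longleftrightarrow> x \<in> Av B"
proof -
  have "(\<forall>e<perm_set_code B. code_member (perm_set_code B) e \<longrightarrow> \<not> code_embeds e (list_encode x)) \<longleftrightarrow>
    (\<forall>\<beta>\<in>B. \<not> embeds (length \<beta>) (entries \<beta>) (length x) (entries x))"
    unfolding code_member_perm_set_code using code_bound by (auto simp: code_embeds_iff[symmetric])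
  then show ?thesis unfolding code_Av_def code_perm_iff Av_def using B consec_le_iff_embeds by blast
qed

text \<open>
  Quantification over the members of bounded length is bounded quantification over codes.
\<close>

lemma all_codes:
  "(\<forall>z<Suc (max_code M). code_Av (perm_set_code B) z \<longrightarrow> code_length z \<le> M \<longrightarrow> P z) \<longleftrightarrow>
    (\<forall>x\<in>Av B. length x \<le> M \<longrightarrow> P (list_encode x))"
proof (intro iffI ballI impI allI)
  fix x assume *: "\<forall>z<Suc (max_code M). code_Av (perm_set_code B) z \<longrightarrow> code_length z \<le> M \<longrightarrow> P z"
    "x \<in> Av B" "length x \<le> M"
  have "set x \<subseteq> {..M}" using *(2,3) by (auto simp: Av_def perms_iff)
  then have "list_encode x < Suc (max_code M)" using list_encode_le_max_code *(3) by (simp add: less_Suc_eq_le)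
  then show "P (list_encode x)" using * code_Av_iff by simp
next
  fix z assume *: "\<forall>x\<in>Av B. length x \<le> M \<longrightarrow> P (list_encode x)" "z < Suc (max_code M)"
    "code_Av (perm_set_code B) z" "code_length z \<le> M"
  have z: "z = list_encode (list_decode z)" by simp
  then have "list_decode z \<in> Av B" "length (list_decode z) \<le> M"
    using *(3,4) code_Av_iff[of "list_decode z"] code_length_list_encode[of "list_decode z"] by simp_all
  then show "P z" using *(1) z by metis
qed

lemma ex_codes:
  "(\<exists>z<Suc (max_code M). code_Av (perm_set_code B) z \<and> code_length z \<le> M \<and> P z) \<longleftrightarrow>
    (\<exists>x\<in>Av B. length x \<le> M \<and> P (list_encode x))"
  using all_codes[of M "\<lambda>z. \<not> P z"] by blast

end

text \<open>
  The quantities in the two criteria as functions of the code \<open>c\<close> of the given set. As every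
  element of the set has a code, hence a length, below \<open>c\<close>, the windows may be given the length
  \<open>Suc c\<close>.
\<close>

definition bound_b :: "nat \<Rightarrow> nat" where "bound_b c = Suc c"
definition bound_N :: "nat \<Rightarrow> nat" where "bound_N c = 2 ^ (bound_b c * bound_b c)"
definition bound_K :: "nat \<Rightarrow> nat" where "bound_K c = bound_b c * bound_N c + bound_b c"
definition bound_R :: "nat \<Rightarrow> nat" where "bound_R c = bound_N c + 4 * bound_b c + 3"
definition bound_L :: "nat \<Rightarrow> nat" where "bound_L c = 2 * bound_R c + bound_N c + bound_b c"
definition bound_M :: "nat \<Rightarrow> nat" where "bound_M c = 3 * bound_K c + 3 * bound_N c + 2 * bound_b c + 5"

definition code_atomic :: "nat \<Rightarrow> bool" where
  "code_atomic c \<longleftrightarrow> (\<forall>x<Suc (max_code (bound_R c)). code_Av c x \<longrightarrow> code_length x \<le> bound_R c \<longrightarrow>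
    (\<forall>y<Suc (max_code (bound_R c)). code_Av c y \<longrightarrow> code_length y \<le> bound_R c \<longrightarrow>
    (\<exists>z<Suc (max_code (bound_L c)). code_Av c z \<and> code_length z \<le> bound_L c \<and> code_embeds x z \<and> code_embeds y z)))"

definition code_wqo :: "nat \<Rightarrow> bool" where
  "code_wqo c \<longleftrightarrow> (\<forall>x<Suc (max_code (bound_M c)). code_Av c x \<longrightarrow> code_length x \<le> bound_M c \<longrightarrow>
      (\<forall>j<code_length x. \<forall>i<j. code_one_sided (bound_b c) x i j)) \<and>
    (\<forall>x<Suc (max_code (bound_M c)). code_Av c x \<longrightarrow> code_length x \<le> bound_M c \<longrightarrow>
      (\<forall>y<Suc (max_code (bound_M c)). code_Av c y \<longrightarrow> code_length y \<le> bound_M c \<longrightarrow>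
      code_length y = code_length x \<longrightarrow> bound_b c \<le> code_length x \<longrightarrow> code_same_windows (bound_b c) x y \<longrightarrow> (\<forall>q<code_length x. \<forall>u<q.
      code_right_deep (bound_b c) (bound_N c) (bound_K c) x q \<or> code_left_deep (bound_b c) (bound_N c) (bound_K c) x u \<longrightarrow>
      (code_nth x u < code_nth x q \<longleftrightarrow> code_nth y u < code_nth y q))))"

lemma recursive_fun_bound_b [computable]: "recursive_fun n a \<Longrightarrow> recursive_fun n (\<lambda>e. bound_b (a e))"
  by (rule recursive_fun_subst1[where F = bound_b]) (unfold bound_b_def, (intro computable; simp))
lemma recursive_fun_bound_N [computable]: "recursive_fun n a \<Longrightarrow> recursive_fun n (\<lambda>e. bound_N (a e))"
  by (rule recursive_fun_subst1[where F = bound_N]) (unfold bound_N_def, (intro computable; simp))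
lemma recursive_fun_bound_K [computable]: "recursive_fun n a \<Longrightarrow> recursive_fun n (\<lambda>e. bound_K (a e))"
  by (rule recursive_fun_subst1[where F = bound_K]) (unfold bound_K_def, (intro computable; simp))
lemma recursive_fun_bound_R [computable]: "recursive_fun n a \<Longrightarrow> recursive_fun n (\<lambda>e. bound_R (a e))"
  by (rule recursive_fun_subst1[where F = bound_R]) (unfold bound_R_def, (intro computable; simp))
lemma recursive_fun_bound_L [computable]: "recursive_fun n a \<Longrightarrow> recursive_fun n (\<lambda>e. bound_L (a e))"
  by (rule recursive_fun_subst1[where F = bound_L]) (unfold bound_L_def, (intro computable; simp))
lemma recursive_fun_bound_M [computable]: "recursive_fun n a \<Longrightarrow> recursive_fun n (\<lambda>e. bound_M (a e))"
  by (rule recursive_fun_subst1[where F = bound_M]) (unfold bound_M_def, (intro computable; simp))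

lemma recursive_pred_code_atomic: "recursive_pred 1 (\<lambda>e. code_atomic (e 0))"
  unfolding code_atomic_def by (intro computable; simp)

lemma recursive_pred_code_wqo: "recursive_pred 1 (\<lambda>e. code_wqo (e 0))"
  unfolding code_wqo_def by (intro computable; simp)

lemma decidable_if_recursive:
  assumes "recursive_pred 1 (\<lambda>e. P (e 0))" "\<And>x. x \<in> D \<Longrightarrow> P (code x) \<longleftrightarrow> Q x"
  shows "decidable_on code D Q"
proof -
  obtain r where r: "\<And>xs. length xs = 1 \<Longrightarrow> computes r xs (if P (xs ! 0) then 1 else 0)"
    using assms(1) by (auto simp: recursive_pred_def recursive_fun_def)
  have "computes r [code x] (if Q x then 1 else 0)" if "x \<in> D" for x
    using r[of "[code x]"] assms(2)[OF that] by simp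
  then show ?thesis unfolding decidable_on_def by blast
qed

context avoidance_class
begin

lemma code_same_order_window: "code_same_order b (list_encode x) i (list_encode y) j \<longleftrightarrow> window b (entries x) i = window b (entries y) j"
  by (simp add: code_same_order_iff window_eq_iff)

lemma code_periodic_iff: "code_periodic b (list_encode x) k i j \<longleftrightarrow> periodic (entries x) k i j"
  unfolding code_periodic_def periodic_def code_same_order_window by (auto simp: less_Suc_eq_le)

lemma code_one_sided_iff: "code_one_sided b (list_encode x) i j \<longleftrightarrow> one_sided (length x) (entries x) i j"
  by (simp add: code_one_sided_def one_sided_def code_periodic_iff code_same_order_window)

lemma code_right_deep_iff: "code_right_deep b num_windows depth (list_encode x) q \<longleftrightarrow> right_deep (entries x) q"
  unfolding code_right_deep_def right_deep_def code_periodic_iff by (auto simp: less_Suc_eq_le)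

lemma code_left_deep_iff: "code_left_deep b num_windows depth (list_encode x) u \<longleftrightarrow> left_deep (length x) (entries x) u"
  unfolding code_left_deep_def left_deep_def code_periodic_iff code_length_list_encode by (auto simp: less_Suc_eq_le)

lemma code_same_windows_iff: "code_same_windows b (list_encode x) (list_encode y) \<longleftrightarrow> same_windows b (length x) (entries x) (entries y)"
  unfolding code_same_windows_def same_windows_def code_same_order_window code_length_list_encode by auto

end

lemma avoidance_class_code:
  assumes "finite B" "B \<subseteq> perms"
  shows "avoidance_class B (bound_b (perm_set_code B))"
proof
  fix \<beta> assume "\<beta> \<in> B"
  then show "length \<beta> \<le> bound_b (perm_set_code B)"
    using code_bound[OF assms] length_le_list_encode[of \<beta>] by (fastforce simp: bound_b_def)
qed (use assms in \<open>auto simp: bound_b_def\<close>)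

lemma code_atomic_iff:
  assumes "finite B" "B \<subseteq> perms"
  shows "code_atomic (perm_set_code B) \<longleftrightarrow> atomic perms (\<le>\<^sub>f) (Av B)"
proof -
  let ?c = "perm_set_code B"
  interpret avoidance_class B "bound_b ?c" by (rule avoidance_class_code[OF assms])
  have num_windows: "num_windows = bound_N ?c" by (simp add: num_windows_def bound_N_def)
  have R: "bound_R ?c = num_windows + 4 * bound_b ?c + 3" "bound_L ?c = 2 * bound_R ?c + num_windows + bound_b ?c" by (simp_all add: bound_R_def bound_L_def num_windows)
  have e: "code_embeds (list_encode x) (list_encode z) \<longleftrightarrow> x \<le>\<^sub>f z" if "x \<in> Av B" "z \<in> Av B" for x z
    using that AvD(2) by (simp add: code_embeds_iff consec_le_iff_embeds)
  have "code_atomic ?c \<longleftrightarrow> (\<forall>x\<in>Av B. length x \<le> bound_R ?c \<longrightarrow> (\<forall>y\<in>Av B. length y \<le> bound_R ?c \<longrightarrow>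
    (\<exists>z\<in>Av B. length z \<le> bound_L ?c \<and> code_embeds (list_encode x) (list_encode z) \<and> code_embeds (list_encode y) (list_encode z))))"
    unfolding code_atomic_def all_codes[OF assms] ex_codes[OF assms] ..
  also have "\<dots> \<longleftrightarrow> (\<forall>x\<in>Av B. length x \<le> bound_R ?c \<longrightarrow> (\<forall>y\<in>Av B. length y \<le> bound_R ?c \<longrightarrow>
    (\<exists>z\<in>Av B. length z \<le> bound_L ?c \<and> x \<le>\<^sub>f z \<and> y \<le>\<^sub>f z)))"
    by (intro ball_cong refl imp_cong bex_cong) (simp_all add: e)
  finally show ?thesis unfolding atomic_iff_bounded[OF R(1)] R(2) by blast
qed

lemma code_wqo_iff:
  assumes "finite B" "B \<subseteq> perms"
  shows "code_wqo (perm_set_code B) \<longleftrightarrow> wqo_on (\<le>\<^sub>f) (Av B)"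
proof -
  let ?c = "perm_set_code B"
  interpret avoidance_class B "bound_b ?c" by (rule avoidance_class_code[OF assms])
  have num_windows: "bound_N ?c = num_windows" by (simp add: num_windows_def bound_N_def)
  have depth: "bound_K ?c = depth" by (simp add: depth_def bound_K_def num_windows)
  have M: "bound_M ?c = 3 * depth + 3 * num_windows + 2 * bound_b ?c + 5" by (simp add: bound_M_def num_windows depth)
  have v: "code_nth (list_encode x) p < code_nth (list_encode x) q \<longleftrightarrow> entries x p < entries x q" for x p q
    by (simp add: entries_code_nth)
  show ?thesis
    unfolding code_wqo_def all_codes[OF assms] wqo_iff_bounded[OF M] num_windows depth v
      code_one_sided_iff code_right_deep_iff code_left_deep_iff code_same_windows_iff code_length_list_encode
    ..
qed

theorem theorem1p2:
  shows "decidable_on perm_set_code {B. finite B \<and> B \<subseteq> perms}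
           (\<lambda>B. atomic perms (\<le>\<^sub>f) (Av B)) \<and>
         decidable_on perm_set_code {B. finite B \<and> B \<subseteq> perms}
           (\<lambda>B. wqo_on (\<le>\<^sub>f) (Av B))"
  using decidable_if_recursive[OF recursive_pred_code_atomic] decidable_if_recursive[OF recursive_pred_code_wqo]
    code_atomic_iff code_wqo_iff by (metis (no_types, lifting) mem_Collect_eq)

end
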